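(* Let $f\in\mathbb{C}[x]$, let $F(x,y)=y^2+f(x)$, and let $\omega=P(x,y)\,dx+Q(x,y)\,dy$ with $P,Q\in\mathbb{C}[x,y]$. Let $p$ be a Morse singular point of $F$ and let $\delta(t)$ be the associated family of vanishing cycles. Then the system $dF+\varepsilon\omega=0$ has a tangential center at $p$ with associated vanishing cycle $\delta(t)$, that is, $I(t)=\int_{\delta(t)}\omega$ vanishes identically, if and only if (i) or (ii) holds: (i) the form $\omega$ is relatively exact, i.e. $\omega=A\,dF+dB$ with $A,B\in\mathbb{C}[x,y]$; (ii) $f$ is decomposable, i.e. $f=g\circ h$ with $g,h$ polynomials over $\mathbb{C}$ of degree greater than one, and $\omega=\tilde\omega+\pi^*\eta$, where $\pi(x,y)=(h(x),y)=(z,y)$, $\tilde\omega$ is a relatively exact polynomial $1$-form (with respect to $F$), $\eta$ is a polynomial $1$-form in $(z,y)$, and $\pi_*\delta(t)$ is homotopic to zero in the curve $\{(z,y)\in\mathbb{C}^2: y^2+g(z)=t\}$.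
   Context: A Morse singular point $p$ of $F$ is a critical point of $F:\mathbb{C}^2\to\mathbb{C}$ with nondegenerate Hessian. In suitable local holomorphic coordinates $(X,Y)$ at $p$, $F=F(p)+X^2+Y^2$. For $t\ne F(p)$ close to $F(p)$, the vanishing cycle $\delta(t)\subset F^{-1}(t)$ is the oriented loop (unique up to orientation and homotopy) which corresponds, for $t-F(p)>0$, to the real circle $X^2+Y^2=t-F(p)$ and which is continued continuously to the other values of $t$. The Abelian integral $I(t)=\int_{\delta(t)}\omega$ is considered as a function of $t$ near $F(p)$ (and by analytic continuation elsewhere). The system $dF+\varepsilon\omega=0$ is said to have a tangential center at $p$ if $I(t)\equiv 0$ for the vanishing cycle $\delta(t)$ at $p$. In (ii), note that $\pi$ maps $F^{-1}(t)$ into $\{y^2+g(z)=t\}$. *)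

theory Defs
  imports "HOL-Analysis.Analysis" "HOL-Computational_Algebra.Polynomial"
begin

text \<open>
  A polynomial in \<open>\<complex>[x,y]\<close> is represented in \<open>\<complex>[x][y]\<close>: the outer indeterminate is \<open>y\<close>, the
  coefficients are polynomials in \<open>x\<close>. The polynomial \<open>1\<close>-form \<open>P dx + Q dy\<close> is the pair \<open>(P, Q)\<close>;
  forms are added componentwise.
\<close>

type_synonym poly_form = "complex poly poly \<times> complex poly poly"

definition eval2 :: "complex poly poly \<Rightarrow> complex \<times> complex \<Rightarrow> complex" where
  "eval2 B q = poly (poly B [:snd q:]) (fst q)"

definition partial_x :: "complex poly poly \<Rightarrow> complex poly poly" where
  "partial_x B = map_poly pderiv B"

definition partial_y :: "complex poly poly \<Rightarrow> complex poly poly" where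
  "partial_y B = pderiv B"

definition ext_d :: "complex poly poly \<Rightarrow> poly_form" where
  "ext_d B = (partial_x B, partial_y B)"

definition scale_form :: "complex poly poly \<Rightarrow> poly_form \<Rightarrow> poly_form" where
  "scale_form A \<omega> = (A * fst \<omega>, A * snd \<omega>)"

definition relatively_exact :: "complex poly poly \<Rightarrow> poly_form \<Rightarrow> bool" where
  "relatively_exact F \<omega> \<longleftrightarrow> (\<exists>A B. \<omega> = scale_form A (ext_d F) + ext_d B)"

text \<open>
  Pullback under \<open>\<pi>(x,y) = (h(x),y)\<close>: a form \<open>R dz + S dy\<close> becomes
  \<open>R(h(x),y) h'(x) dx + S(h(x),y) dy\<close>.
\<close>

definition proj_map :: "complex poly \<Rightarrow> complex \<times> complex \<Rightarrow> complex \<times> complex" where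
  "proj_map h q = (poly h (fst q), snd q)"

definition subst_x :: "complex poly \<Rightarrow> complex poly poly \<Rightarrow> complex poly poly" where
  "subst_x h B = map_poly (\<lambda>c. c \<circ>\<^sub>p h) B"

definition pullback_form :: "complex poly \<Rightarrow> poly_form \<Rightarrow> poly_form" where
  "pullback_form h \<eta> = (subst_x h (fst \<eta>) * [:pderiv h:], subst_x h (snd \<eta>))"

definition form_integral :: "poly_form \<Rightarrow> (real \<Rightarrow> complex \<times> complex) \<Rightarrow> complex" where
  "form_integral \<omega> \<gamma> = integral {0..1}
     (\<lambda>s. eval2 (fst \<omega>) (\<gamma> s) * vector_derivative (\<lambda>s. fst (\<gamma> s)) (at s within {0..1})
        + eval2 (snd \<omega>) (\<gamma> s) * vector_derivative (\<lambda>s. snd (\<gamma> s)) (at s within {0..1}))"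

definition morse_point :: "complex poly poly \<Rightarrow> complex \<times> complex \<Rightarrow> bool" where
  "morse_point F p \<longleftrightarrow>
     eval2 (partial_x F) p = 0 \<and> eval2 (partial_y F) p = 0 \<and>
     eval2 (partial_x (partial_x F)) p * eval2 (partial_y (partial_y F)) p
       - eval2 (partial_x (partial_y F)) p * eval2 (partial_y (partial_x F)) p \<noteq> 0"

text \<open>Complex differentiability in two variables: the Frechet derivative is complex linear.\<close>

definition holomorphic2_on ::
    "(complex \<times> complex \<Rightarrow> complex \<times> complex) \<Rightarrow> (complex \<times> complex) set \<Rightarrow> bool" where
  "holomorphic2_on \<phi> U \<longleftrightarrow>
     (\<forall>q\<in>U. \<exists>a b c d. (\<phi> has_derivative (\<lambda>(u, v). (a * u + b * v, c * u + d * v))) (at q))"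

text \<open>
  Local holomorphic coordinates \<open>\<psi> = (X,Y)\<close> at \<open>p\<close>, with inverse \<open>\<phi>\<close>, in which
  \<open>F = F(p) + X\<^sup>2 + Y\<^sup>2\<close>.
\<close>

definition morse_coordinates ::
    "complex poly poly \<Rightarrow> complex \<times> complex \<Rightarrow> (complex \<times> complex) set \<Rightarrow> (complex \<times> complex) set \<Rightarrow>
     (complex \<times> complex \<Rightarrow> complex \<times> complex) \<Rightarrow> (complex \<times> complex \<Rightarrow> complex \<times> complex) \<Rightarrow> bool" where
  "morse_coordinates F p V W \<psi> \<phi> \<longleftrightarrow>
     open V \<and> p \<in> V \<and> open W \<and> homeomorphism V W \<psi> \<phi> \<and>
     holomorphic2_on \<psi> V \<and> holomorphic2_on \<phi> W \<and> \<psi> p = (0, 0) \<and>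
     (\<forall>q\<in>V. eval2 F q = eval2 F p + (fst (\<psi> q))\<^sup>2 + (snd (\<psi> q))\<^sup>2)"

text \<open>
  The loop \<open>\<delta>(t)\<close> is the circle \<open>(X,Y) = (r cos \<theta>, r sin \<theta>)\<close> with \<open>r\<^sup>2 = t - F(p)\<close>. For
  \<open>t - F(p) > 0\<close> this is the real circle, and letting \<open>r\<close> vary continuously gives its continuation
  to the other \<open>t\<close>. Replacing \<open>r\<close> by \<open>-r\<close> only moves the starting point by half a turn, so the
  oriented loop does not depend on the choice of the root (which may depend on \<open>t\<close>).
  The opposite orientation is obtained from the coordinates \<open>(X,-Y)\<close>.
\<close>

definition vanishing_cycles ::
    "complex poly poly \<Rightarrow> complex \<times> complex \<Rightarrow> (complex \<Rightarrow> real \<Rightarrow> complex \<times> complex) \<Rightarrow> bool" where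
  "vanishing_cycles F p \<delta> \<longleftrightarrow>
     (\<exists>V W \<psi> \<phi>. morse_coordinates F p V W \<psi> \<phi> \<and>
        (\<forall>\<^sub>F t in at (eval2 F p). \<exists>r. r\<^sup>2 = t - eval2 F p \<and>
           (\<forall>s\<in>{0..1}. \<delta> t s = \<phi> (r * of_real (cos (2 * pi * s)), r * of_real (sin (2 * pi * s))))))"

text \<open>
  \<open>I(t)\<close> is holomorphic in \<open>t\<close>, so vanishing identically means vanishing for all \<open>t \<noteq> F(p)\<close> close
  to \<open>F(p)\<close>.
\<close>

definition tangential_center ::
    "complex poly poly \<Rightarrow> poly_form \<Rightarrow> complex \<times> complex \<Rightarrow> (complex \<Rightarrow> real \<Rightarrow> complex \<times> complex) \<Rightarrow> bool"
  where
  "tangential_center F \<omega> p \<delta> \<longleftrightarrow> (\<forall>\<^sub>F t in at (eval2 F p). form_integral \<omega> (\<delta> t) = 0)"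

definition null_homotopic_in ::
    "(complex \<times> complex) set \<Rightarrow> (real \<Rightarrow> complex \<times> complex) \<Rightarrow> bool" where
  "null_homotopic_in S \<gamma> \<longleftrightarrow> (\<exists>a. homotopic_loops S \<gamma> (\<lambda>_. a))"

end

theory Submission
  imports Defs "HOL-Complex_Analysis.Complex_Analysis" "HOL-Computational_Algebra.Polynomial_Factorial"
    "HOL-Computational_Algebra.Field_as_Ring" "HOL-Computational_Algebra.Fundamental_Theorem_Algebra"
begin

text \<open>
  Modulo relatively exact forms \<open>\<omega>\<close> is \<open>y R'(x) dx\<close> for a polynomial \<open>R\<close>. Let \<open>\<xi>\<close> be a local coordinate at
  \<open>x\<^sub>0\<close> with \<open>f = f(x\<^sub>0) + \<xi>\<^sup>2\<close> and let \<open>X\<close> be its inverse. The vanishing cycle is homotopic in the level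
  curve to the loop \<open>(X(r cos \<theta>), \<plusminus>r sin \<theta>)\<close>, so \<open>I(t)\<close> is a multiple of the integral of
  \<open>sin\<^sup>2 \<theta> (R \<circ> X)'(r cos \<theta>)\<close>. It vanishes for all small \<open>r\<close> iff \<open>(R \<circ> X)'\<close> is odd, that is, iff \<open>R\<close>
  is invariant under the local involution \<open>X(w) \<mapsto> X(-w)\<close>, as \<open>f\<close> is. The polynomials invariant
  under this involution form an algebra closed under division, and such an algebra is \<open>\<complex>[h]\<close> for some \<open>h\<close>
  (a polynomial form of Lueroth's theorem). Hence \<open>f = g \<circ> h\<close> and \<open>R = S \<circ> h\<close> with \<open>h'(x\<^sub>0) = 0\<close>. If
  \<open>deg g = 1\<close>, then \<open>R\<close> is a polynomial in \<open>f\<close> and \<open>\<omega>\<close> is relatively exact. Otherwise \<open>\<omega>\<close> is, modulo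
  relatively exact forms, the pullback of \<open>y S'(z) dz\<close>.

  The converse, like the reduction to the standard loop, rests on the homotopy invariance of
  integrals of forms along loops in a smooth level curve.
\<close>

section \<open>Polynomial forms modulo relatively exact forms\<close>

text \<open>The vanishing cycle comes from an unspecified Morse chart and, for each
  \<open>t\<close>, from an unspecified square root of \<open>t - F(p)\<close>; nothing ties these
  roots together as \<open>t\<close> varies. Loops are therefore compared within one level curve at
  a time, and a sign \<open>\<mu>\<close> in the standard loop absorbs the choice of root. The
  homotopies are only continuous and a form on a level curve may have periods, so the integral is
  read off from a multivalued primitive lifted to the homotopy square. The weight
  \<open>sin\<^sup>2 \<theta>\<close> comes from \<open>y dx\<close>, where both \<open>y\<close>
  and \<open>d(r cos \<theta>)\<close> contribute a sine; its nonnegativity turns the vanishing of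
  the integrals into oddness. The involution is only a germ at \<open>x\<^sub>0\<close>, so no group
  acts on the polynomials. What remains of invariance is closure under sums, products and exact
  quotients, and the generator \<open>h\<close> has to come from these alone. Invariance of
  \<open>h\<close> also yields \<open>h'(x\<^sub>0) = 0\<close>, the source both of
  \<open>deg h > 1\<close> and of the contraction of the projected cycle.\<close>

lemma eval2_0 [simp]: "eval2 0 q = 0" by (simp add: eval2_def)
lemma eval2_pCons [simp]: "eval2 (pCons c B) q = poly c (fst q) + snd q * eval2 B q"
  by (simp add: eval2_def)
lemma eval2_add [simp]: "eval2 (A + B) q = eval2 A q + eval2 B q" by (simp add: eval2_def)
lemma eval2_mult [simp]: "eval2 (A * B) q = eval2 A q * eval2 B q" by (simp add: eval2_def)

lemma eval2_1 [simp]: "eval2 1 q = 1" by (simp add: eval2_def)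
lemma eval2_smult [simp]: "eval2 (smult c A) q = poly c (fst q) * eval2 A q" by (simp add: eval2_def)

lemma partial_x_pCons [simp]: "partial_x (pCons c B) = pCons (pderiv c) (partial_x B)"
  by (cases "c = 0 \<and> B = 0") (auto simp: partial_x_def map_poly_pCons)
lemma partial_x_0 [simp]: "partial_x 0 = 0" by (simp add: partial_x_def)
lemma coeff_partial_x [simp]: "coeff (partial_x B) i = pderiv (coeff B i)"
  by (simp add: partial_x_def coeff_map_poly)
lemma partial_x_add: "partial_x (A + B) = partial_x A + partial_x B"
  by (rule poly_eqI) (simp add: pderiv_add)
lemma pderiv_sum: "pderiv (sum f S) = (\<Sum>i\<in>S. pderiv (f i))"
  by (induction S rule: infinite_finite_induct) (auto simp: pderiv_add)
lemma partial_x_mult: "partial_x (A * B) = A * partial_x B + partial_x A * B"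
  by (rule poly_eqI) (simp add: coeff_mult pderiv_sum pderiv_mult sum.distrib, simp add: mult.commute)
lemma partial_x_monom: "partial_x (monom c j) = monom (pderiv c) j"
  by (rule poly_eqI) (simp add: if_distrib cong: if_cong)
lemma partial_y_pCons: "partial_y (pCons c B) = B + pCons 0 (partial_y B)"
  by (simp add: partial_y_def pderiv_pCons)
lemma partial_y_monom: "partial_y (monom c j) = monom (of_nat j * c) (j - 1)"
  by (simp add: partial_y_def pderiv_monom)

lemma eval2_has_derivative:
  "(eval2 B has_derivative (\<lambda>v. eval2 (partial_x B) q * fst v + eval2 (partial_y B) q * snd v)) (at q within S)"
proof (induction B)
  case 0
  have "eval2 0 = (\<lambda>_. 0)" by (simp add: fun_eq_iff)
  then show ?case by (simp add: partial_y_def)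
next
  case (pCons c B)
  have e: "eval2 (pCons c B) = (\<lambda>q. poly c (fst q) + snd q * eval2 B q)" by (simp add: fun_eq_iff)
  have "((\<lambda>q. poly c (fst q)) has_derivative (\<lambda>v. fst v * poly (pderiv c) (fst q))) (at q within S)"
    using has_derivative_compose[OF has_derivative_fst[OF has_derivative_ident]
        poly_DERIV[of c, unfolded has_field_derivative_def], of q S]
    by (simp add: mult.commute)
  from has_derivative_add[OF this has_derivative_mult[OF has_derivative_snd[OF has_derivative_ident] pCons.IH]]
  show ?case unfolding e
    by (rule has_derivative_eq_rhs) (simp add: partial_y_pCons algebra_simps fun_eq_iff)
qed

lemma fst_ext_d [simp]: "fst (ext_d B) = partial_x B" and snd_ext_d [simp]: "snd (ext_d B) = partial_y B"
  by (auto simp: ext_d_def)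

lemma ext_d_add: "ext_d (A + B) = ext_d A + ext_d B"
  by (simp add: ext_d_def partial_x_add partial_y_def pderiv_add)

lemma relatively_exact_add:
  assumes "relatively_exact F \<omega>" "relatively_exact F \<omega>'"
  shows "relatively_exact F (\<omega> + \<omega>')"
proof -
  obtain A B A' B' where "\<omega> = scale_form A (ext_d F) + ext_d B" "\<omega>' = scale_form A' (ext_d F) + ext_d B'"
    using assms by (auto simp: relatively_exact_def)
  then have "\<omega> + \<omega>' = scale_form (A + A') (ext_d F) + ext_d (B + B')"
    by (simp add: ext_d_add scale_form_def algebra_simps)
  then show ?thesis by (auto simp: relatively_exact_def)
qed

lemma relatively_exact_exact: "relatively_exact F (ext_d B)"
  unfolding relatively_exact_def by (intro exI[of _ 0] exI[of _ B]) (simp add: scale_form_def prod_eq_iff)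

lemma relatively_exact_scaled: "relatively_exact F (scale_form A (ext_d F))"
  unfolding relatively_exact_def
  by (intro exI[of _ A] exI[of _ 0]) (simp add: ext_d_def partial_y_def zero_prod_def[symmetric])

lemma relatively_exact_zero: "relatively_exact F 0"
  using relatively_exact_exact[of F 0] by (simp add: ext_d_def partial_y_def zero_prod_def)

text \<open>\<open>F dB = d(F B) - B dF\<close>. Together with \<open>f = F - y\<^sup>2\<close> this
  later handles coefficients that are polynomials in \<open>f\<close>.\<close>

lemma relatively_exact_mult_F:
  assumes "relatively_exact F \<omega>" shows "relatively_exact F (scale_form F \<omega>)"
proof -
  obtain A B where "\<omega> = scale_form A (ext_d F) + ext_d B"
    using assms by (auto simp: relatively_exact_def)
  then have "scale_form F \<omega> = scale_form (F * A - B) (ext_d F) + ext_d (F * B)"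
    by (simp add: prod_eq_iff scale_form_def partial_x_mult partial_y_def pderiv_mult algebra_simps)
  then show ?thesis by (auto simp: relatively_exact_def)
qed

lemma relatively_exact_uminus:
  assumes "relatively_exact F \<omega>" shows "relatively_exact F (- \<omega>)"
proof -
  obtain A B where "\<omega> = scale_form A (ext_d F) + ext_d B"
    using assms by (auto simp: relatively_exact_def)
  then have "- \<omega> = scale_form (- A) (ext_d F) + ext_d (- B)"
    by (auto simp: prod_eq_iff scale_form_def partial_y_def pderiv_minus intro!: poly_eqI)
  then show ?thesis by (auto simp: relatively_exact_def)
qed

lemma relatively_exact_diff:
  assumes "relatively_exact F \<omega>" "relatively_exact F \<omega>'"
  shows "relatively_exact F (\<omega> - \<omega>')"
  using relatively_exact_add[OF assms(1) relatively_exact_uminus[OF assms(2)]] by simp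

definition antideriv :: "complex poly \<Rightarrow> complex poly" where
  "antideriv c = (\<Sum>i\<le>degree c. monom (coeff c i / of_nat (Suc i)) (Suc i))"

lemma pderiv_antideriv [simp]: "pderiv (antideriv c) = c"
proof -
  have "pderiv (antideriv c) = (\<Sum>i\<le>degree c. monom (coeff c i) i)"
    unfolding antideriv_def pderiv_sum by (rule sum.cong) (simp_all add: pderiv_monom del: of_nat_Suc)
  then show ?thesis by (simp add: poly_as_sum_of_monoms)
qed

text \<open>
  Normal form modulo relatively exact forms: with \<open>C' = c\<close>,
  \<open>y\<^sup>j c dx = d(y\<^sup>j C) - (j/2) y\<^bsup>j-2\<^esup> C dF + (j/2) y\<^bsup>j-2\<^esup> C f' dx\<close>.
\<close>

lemma normal_form_monom_dx:
  assumes F: "F = [:f, 0, 1:]"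
  shows "\<exists>r. relatively_exact F ((monom c j, 0) - ([:0, r:], 0))"
proof (induction j arbitrary: c rule: less_induct)
  case (less j)
  consider "j = 0" | "j = 1" | k where "j = k + 2"
    by (metis One_nat_def add_2_eq_Suc' not0_implies_Suc)
  then show ?case
  proof cases
    case 1
    have "(monom c j, 0) = ext_d (monom (antideriv c) 0)"
      by (simp add: 1 ext_d_def partial_x_monom partial_y_monom)
    then have "relatively_exact F ((monom c j, 0) - ([:0, 0:], 0))"
      using relatively_exact_exact by (simp add: zero_prod_def[symmetric])
    then show ?thesis by blast
  next
    case 2
    have "monom c 1 = [:0, c:]" by (simp add: monom_Suc monom_0)
    then show ?thesis using 2 relatively_exact_zero by (intro exI[of _ c]) (simp add: zero_prod_def)
  next
    case 3
    define C where "C = antideriv c"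
    define e where "e = smult (of_nat j / 2) C"
    obtain r where r: "relatively_exact F ((monom (e * pderiv f) k, 0) - ([:0, r:], 0))"
      using less[of k "e * pderiv f"] 3 by auto
    have dF: "ext_d F = ([:pderiv f:], [:0, 2:])"
      by (simp add: F ext_d_def partial_y_def pderiv_pCons numeral_poly)
    \<comment> \<open>The \<open>dy\<close> component of \<open>e y\<^sup>k dF\<close> has to cancel
      that of \<open>d(y\<^sup>j C)\<close>; this fixes the factor \<open>j/2\<close> in
      \<open>e\<close>.\<close>
    have m2: "monom e k * [:0, 2:] = monom (of_nat j * C) (j - 1)"
    proof -
      have "e * 2 = of_nat j * C" 
        by (simp only: e_def mult_2_right smult_add_left[symmetric]) (simp add: of_nat_poly)
      moreover have "[:0, 2:] = (monom 2 1 :: complex poly poly)" by (simp add: monom_Suc monom_0)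
      ultimately show ?thesis using 3 by (simp add: mult_monom del: monom_Suc)
    qed
    have "relatively_exact F (ext_d (monom C j) - scale_form (monom e k) (ext_d F)
        + ((monom (e * pderiv f) k, 0) - ([:0, r:], 0)))"
      by (intro relatively_exact_add relatively_exact_diff relatively_exact_exact relatively_exact_scaled r)
    also have "ext_d (monom C j) - scale_form (monom e k) (ext_d F)
        + ((monom (e * pderiv f) k, 0) - ([:0, r:], 0)) = (monom c j, 0) - ([:0, r:], 0)"
      unfolding dF scale_form_def
      by (simp add: prod_eq_iff partial_x_monom partial_y_monom m2 del: mult_pCons_right)
        (simp add: C_def smult_monom mult.commute)
    finally show ?thesis by blast
  qed
qed

lemma normal_form_add:
  assumes "\<exists>r. relatively_exact F (\<omega> - ([:0, r:], 0))" "\<exists>r. relatively_exact F (\<omega>' - ([:0, r:], 0))"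
  shows "\<exists>r. relatively_exact F (\<omega> + \<omega>' - ([:0, r:], 0))"
proof -
  obtain r s where "relatively_exact F (\<omega> - ([:0, r:], 0))" "relatively_exact F (\<omega>' - ([:0, s:], 0))"
    using assms by blast
  then have "relatively_exact F ((\<omega> - ([:0, r:], 0)) + (\<omega>' - ([:0, s:], 0)))"
    by (rule relatively_exact_add)
  also have "(\<omega> - ([:0, r:], 0)) + (\<omega>' - ([:0, s:], 0)) = \<omega> + \<omega>' - ([:0, r + s:], 0)"
    by (simp add: prod_eq_iff)
  finally show ?thesis by blast
qed

text \<open>Integration by parts in \<open>y\<close>: with \<open>e = c / (j+1)\<close> the form is
  \<open>d(y^(j+1) e) - y^(j+1) e' dx\<close>, which leaves only a \<open>dx\<close>
  monomial.\<close>

lemma normal_form_monom_dy: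
  assumes F: "F = [:f, 0, 1:]"
  shows "\<exists>r. relatively_exact F ((0, monom c j) - ([:0, r:], 0))"
proof -
  define e where "e = smult (1 / of_nat (Suc j)) c"
  have "of_nat (Suc j) * e = c"
    by (simp add: e_def of_nat_poly del: of_nat_Suc)
  then have "(0, monom c j) = ext_d (monom e (Suc j)) + (monom (- pderiv e) (Suc j), 0)"
    by (auto simp: ext_d_def partial_x_monom partial_y_monom minus_monom[symmetric] simp del: of_nat_Suc)
  moreover have "\<exists>r. relatively_exact F (ext_d (monom e (Suc j)) - ([:0, r:], 0))"
    using relatively_exact_exact by (intro exI[of _ 0]) (simp add: zero_prod_def[symmetric])
  ultimately show ?thesis using normal_form_add[OF _ normal_form_monom_dx[OF F]] by simp
qed

lemma normal_form:
  assumes F: "F = [:f, 0, 1:]"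
  shows "\<exists>r. relatively_exact F (\<omega> - ([:0, r:], 0))"
proof -
  have z: "\<exists>r. relatively_exact F ((0, 0) - ([:0, r:], 0))"
    using relatively_exact_zero by (intro exI[of _ 0]) (simp add: zero_prod_def)
  have P: "\<exists>r. relatively_exact F ((\<Sum>i\<in>I. monom (coeff P i) i, 0) - ([:0, r:], 0))"
    if "finite I" for P I using that
  proof (induction I)
    case (insert i I)
    then show ?case using normal_form_add[OF normal_form_monom_dx[OF F] insert.IH] by simp
  qed (use z in simp)
  have Q: "\<exists>r. relatively_exact F ((0, \<Sum>i\<in>I. monom (coeff P i) i) - ([:0, r:], 0))"
    if "finite I" for P I using that
  proof (induction I)
    case (insert i I)
    then show ?case using normal_form_add[OF normal_form_monom_dy[OF F] insert.IH] by simp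
  qed (use z in simp)
  from normal_form_add[OF P[of "{..degree (fst \<omega>)}" "fst \<omega>"] Q[of "{..degree (snd \<omega>)}" "snd \<omega>"]]
  show ?thesis by (simp add: poly_as_sum_of_monoms)
qed

text \<open>Induction along the Horner form of \<open>S\<close>: a factor \<open>f\<close> is
  replaced by \<open>F - y\<^sup>2\<close>. The part with \<open>F\<close> stays relatively exact,
  and the part with \<open>y\<^sup>2\<close> raises the exponent, which is why \<open>k\<close> is
  arbitrary.\<close>

lemma relatively_exact_compose_dy:
  assumes F: "F = [:f, 0, 1:]"
  shows "relatively_exact F (0, monom (S \<circ>\<^sub>p f) k)"
proof (induction S arbitrary: k)
  case 0
  then show ?case using relatively_exact_zero by (simp add: zero_prod_def)
next
  case (pCons a S)
  have a: "(0, monom [:a:] k) = ext_d (monom [:a / of_nat (Suc k):] (Suc k))"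
    by (simp add: ext_d_def partial_x_monom partial_y_monom of_nat_poly del: of_nat_Suc)
  have "relatively_exact F (ext_d (monom [:a / of_nat (Suc k):] (Suc k))
      + (scale_form F (0, monom (S \<circ>\<^sub>p f) k) - (0, monom (S \<circ>\<^sub>p f) (k + 2))))"
    by (intro relatively_exact_add relatively_exact_diff relatively_exact_exact relatively_exact_mult_F pCons.IH)
  also have "ext_d (monom [:a / of_nat (Suc k):] (Suc k))
      + (scale_form F (0, monom (S \<circ>\<^sub>p f) k) - (0, monom (S \<circ>\<^sub>p f) (k + 2)))
      = (0, monom (pCons a S \<circ>\<^sub>p f) k)"
  proof -
    have "F * monom (S \<circ>\<^sub>p f) k = monom (f * (S \<circ>\<^sub>p f)) k + monom (S \<circ>\<^sub>p f) (k + 2)"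
      by (simp add: F smult_monom monom_Suc mult.commute)
    then show ?thesis
      unfolding a[symmetric]
      by (simp add: scale_form_def pcompose_pCons add_monom[symmetric] del: monom_Suc)
  qed
  finally show ?case .
qed

text \<open>\<open>y R' dx = d(y R) - R dy\<close>, and \<open>R dy\<close> has a polynomial in
  \<open>f\<close> as coefficient.\<close>

lemma relatively_exact_compose:
  assumes F: "F = [:f, 0, 1:]" and R: "R = S \<circ>\<^sub>p f"
  shows "relatively_exact F ([:0, pderiv R:], 0)"
proof -
  have "relatively_exact F (ext_d [:0, R:] - (0, monom (S \<circ>\<^sub>p f) 0))"
    by (intro relatively_exact_diff relatively_exact_exact relatively_exact_compose_dy[OF F])
  also have "ext_d [:0, R:] - (0, monom (S \<circ>\<^sub>p f) 0) = ([:0, pderiv R:], 0)"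
    by (simp add: ext_d_def R monom_0 partial_y_def pderiv_pCons)
  finally show ?thesis .
qed

section \<open>Substitution of a polynomial for \<open>x\<close>\<close>

lemma subst_x_pCons: "subst_x h (pCons c B) = pCons (c \<circ>\<^sub>p h) (subst_x h B)"
  by (cases "c = 0 \<and> B = 0") (auto simp: subst_x_def map_poly_pCons)

lemma eval2_subst_x: "eval2 (subst_x h B) q = eval2 B (proj_map h q)"
proof (induction B)
  case (pCons c B)
  then show ?case by (simp add: subst_x_pCons poly_pcompose proj_map_def)
qed (simp add: subst_x_def)

section \<open>Integrals of forms along homotopic loops\<close>

definition eval_form :: "poly_form \<Rightarrow> complex \<times> complex \<Rightarrow> complex \<times> complex \<Rightarrow> complex" where
  "eval_form \<omega> a v = eval2 (fst \<omega>) a * fst v + eval2 (snd \<omega>) a * snd v"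

text \<open>
  Near each \<open>q\<close> the curve is parametrized by a chart \<open>c\<close> whose inverse is the restriction of a linear
  map \<open>u\<close> (for level curves \<open>u\<close> will be one of the two coordinates).
\<close>

definition smooth_curve :: "(complex \<times> complex) set \<Rightarrow> bool" where
  "smooth_curve C \<longleftrightarrow> (\<forall>q\<in>C. \<exists>V u c e. open V \<and> q \<in> V \<and> bounded_linear u \<and>
     e > 0 \<and>
     (fst \<circ> c) holomorphic_on ball (u q) e \<and> (snd \<circ> c) holomorphic_on ball (u q) e \<and>
     c ` ball (u q) e \<subseteq> C \<and> (\<forall>a\<in>C \<inter> V. u a \<in> ball (u q) e \<and> c (u a) = a))"

text \<open>The derivative is prescribed at all points of \<open>C\<close> near \<open>q\<close>,
  not only at \<open>q\<close>; this is what makes two such functions differ by a local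
  constant.\<close>

definition local_primitive ::
    "(complex \<times> complex) set \<Rightarrow> poly_form \<Rightarrow> (complex \<times> complex \<Rightarrow> complex) \<Rightarrow> complex \<times> complex \<Rightarrow> bool" where
  "local_primitive C \<omega> \<Phi> q \<longleftrightarrow>
     (\<exists>U. open U \<and> q \<in> U \<and> (\<forall>a\<in>C \<inter> U. (\<Phi> has_derivative eval_form \<omega> a) (at a within C)))"

lemma smooth_curveE:
  assumes "smooth_curve C" "q \<in> C"
  obtains V u c e where "open V" "q \<in> V" "bounded_linear u"
    "e > 0"
    "(fst \<circ> c) holomorphic_on ball (u q) e" "(snd \<circ> c) holomorphic_on ball (u q) e"
    "c ` ball (u q) e \<subseteq> C" "\<And>a. a \<in> C \<Longrightarrow> a \<in> V \<Longrightarrow> u a \<in> ball (u q) e"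
    "\<And>a. a \<in> C \<Longrightarrow> a \<in> V \<Longrightarrow> c (u a) = a"
  using assms unfolding smooth_curve_def by (smt (verit) IntI)

lemma chart_has_derivative:
  assumes "(fst \<circ> c) holomorphic_on ball z e" "(snd \<circ> c) holomorphic_on ball z e" "w \<in> ball z e"
  shows "(c has_derivative (\<lambda>k. (deriv (fst \<circ> c) w * k, deriv (snd \<circ> c) w * k))) (at w)"
proof -
  have "(fst \<circ> c has_derivative (*) (deriv (fst \<circ> c) w)) (at w)"
    "(snd \<circ> c has_derivative (*) (deriv (snd \<circ> c) w)) (at w)"
    using assms by (metis DERIV_deriv_iff_field_differentiable has_field_derivative_def
        holomorphic_on_imp_differentiable_at open_ball)+
  from has_derivative_Pair[OF this] show ?thesis by simp
qed

text \<open>In the chart the form becomes \<open>dk w dw\<close> with \<open>dk\<close> holomorphic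
  on a disc, so it has a primitive \<open>\<kappa>\<close> there, and
  \<open>\<kappa> \<circ> u\<close> is the primitive on the curve.\<close>

lemma local_primitive_exists:
  assumes "smooth_curve C" "q \<in> C"
  shows "\<exists>\<Phi>. local_primitive C \<omega> \<Phi> q"
proof -
  obtain V u c e where c: "open V" "q \<in> V" "bounded_linear u"
    "e > 0"
    "(fst \<circ> c) holomorphic_on ball (u q) e" "(snd \<circ> c) holomorphic_on ball (u q) e"
    "c ` ball (u q) e \<subseteq> C" "\<And>a. a \<in> C \<Longrightarrow> a \<in> V \<Longrightarrow> u a \<in> ball (u q) e"
    "\<And>a. a \<in> C \<Longrightarrow> a \<in> V \<Longrightarrow> c (u a) = a"
    using smooth_curveE[OF assms] by metis
  define B where "B = ball (u q) e"
  define c1 c2 where "c1 = fst \<circ> c" and "c2 = snd \<circ> c"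
  have hol: "c1 holomorphic_on B" "c2 holomorphic_on B" using c by (auto simp: B_def c1_def c2_def)
  have ev: "(\<lambda>w. eval2 P (c w)) holomorphic_on B" for P
  proof (induction P)
    case (pCons p P)
    have "(\<lambda>w. poly p (c1 w) + c2 w * eval2 P (c w)) holomorphic_on B"
      by (intro holomorphic_intros hol pCons.IH)
    then show ?case by (simp add: c1_def c2_def)
  qed simp
  define dk where "dk w = eval2 (fst \<omega>) (c w) * deriv c1 w + eval2 (snd \<omega>) (c w) * deriv c2 w" for w
  have cB: "convex B" "open B" by (auto simp: B_def)
  have dk: "dk holomorphic_on B" unfolding dk_def
    by (intro holomorphic_intros ev holomorphic_deriv hol) (auto simp: B_def)
  obtain \<kappa> where \<kappa>: "\<And>w. w \<in> B \<Longrightarrow> (\<kappa> has_field_derivative dk w) (at w within B)"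
  proof (rule holomorphic_convex_primitive'[OF cB dk])
    fix g assume "\<And>w. w \<in> B \<Longrightarrow> (g has_field_derivative dk w) (at w within B)"
    then show thesis by (rule that)
  qed
  have \<kappa>': "(\<kappa> has_field_derivative dk w) (at w)" if "w \<in> B" for w
    using \<kappa>[OF that] by (simp only: at_within_open[OF that cB(2)])
  have "((\<lambda>b. \<kappa> (u b)) has_derivative eval_form \<omega> a) (at a within C)" if a: "a \<in> C \<inter> V" for a
  proof -
    have ua: "u a \<in> B" "c (u a) = a" using c(8,9)[of a] a by (auto simp: B_def)
    have du: "(u has_derivative u) (at a within C)" by (rule bounded_linear.has_derivative[OF c(3), of "\<lambda>x. x", simplified]) (rule has_derivative_ident)
    have d\<kappa>: "((\<lambda>b. \<kappa> (u b)) has_derivative (\<lambda>v. dk (u a) * u v)) (at a within C)"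
      using has_derivative_compose[OF du \<kappa>'[OF ua(1), unfolded has_field_derivative_def]] by simp
    have dc1: "((\<lambda>b. c1 (u b)) has_derivative (\<lambda>v. deriv c1 (u a) * u v)) (at a within C)"
      by (rule has_derivative_compose[OF du]) (use hol(1) ua(1) in \<open>simp add: B_def has_field_derivative_def[symmetric] holomorphic_derivI[OF _ open_ball]\<close>)
    have dc2: "((\<lambda>b. c2 (u b)) has_derivative (\<lambda>v. deriv c2 (u a) * u v)) (at a within C)"
      by (rule has_derivative_compose[OF du]) (use hol(2) ua(1) in \<open>simp add: B_def has_field_derivative_def[symmetric] holomorphic_derivI[OF _ open_ball]\<close>)
    \<comment> \<open>On \<open>C\<close> the added terms vanish, since \<open>c (u b) = b\<close> there.\<close>
    have "((\<lambda>b. \<kappa> (u b) + eval2 (fst \<omega>) a * (fst b - c1 (u b)) + eval2 (snd \<omega>) a * (snd b - c2 (u b)))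
      has_derivative (\<lambda>v. dk (u a) * u v + eval2 (fst \<omega>) a * (fst v - deriv c1 (u a) * u v)
         + eval2 (snd \<omega>) a * (snd v - deriv c2 (u a) * u v))) (at a within C)"
      by (intro has_derivative_add has_derivative_mult_right has_derivative_diff d\<kappa> dc1 dc2
          has_derivative_fst has_derivative_snd has_derivative_ident)
    also have "(\<lambda>v. dk (u a) * u v + eval2 (fst \<omega>) a * (fst v - deriv c1 (u a) * u v)
         + eval2 (snd \<omega>) a * (snd v - deriv c2 (u a) * u v)) = eval_form \<omega> a"
      by (simp add: fun_eq_iff eval_form_def dk_def ua algebra_simps)
    finally have D: "((\<lambda>b. \<kappa> (u b) + eval2 (fst \<omega>) a * (fst b - c1 (u b)) + eval2 (snd \<omega>) a * (snd b - c2 (u b)))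
      has_derivative eval_form \<omega> a) (at a within C)" .
    have "\<forall>\<^sub>F b in at a within C. \<kappa> (u b) + eval2 (fst \<omega>) a * (fst b - c1 (u b)) + eval2 (snd \<omega>) a * (snd b - c2 (u b)) = \<kappa> (u b)"
      unfolding eventually_at_topological using c(1,9) a by (intro exI[of _ V]) (auto simp: c1_def c2_def)
    from has_derivative_transform_eventually[OF D this] show ?thesis using a ua by (simp add: c1_def c2_def)
  qed
  then show ?thesis unfolding local_primitive_def using c(1,2) by blast
qed

text \<open>Composed with the chart, the difference has derivative zero on a disc, which is convex;
  so it is constant there.\<close>

lemma local_primitive_unique:
  assumes "smooth_curve C" "q \<in> C" "local_primitive C \<omega> \<Phi> q" "local_primitive C \<omega> \<Phi>' q"
  shows "\<exists>V. open V \<and> q \<in> V \<and> (\<forall>a\<in>C \<inter> V. \<Phi> a - \<Phi>' a = \<Phi> q - \<Phi>' q)"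
proof -
  obtain V u c e where c: "open V" "q \<in> V" "bounded_linear u"
    "e > 0"
    "(fst \<circ> c) holomorphic_on ball (u q) e" "(snd \<circ> c) holomorphic_on ball (u q) e"
    "c ` ball (u q) e \<subseteq> C" "\<And>a. a \<in> C \<Longrightarrow> a \<in> V \<Longrightarrow> u a \<in> ball (u q) e"
    "\<And>a. a \<in> C \<Longrightarrow> a \<in> V \<Longrightarrow> c (u a) = a"
    using smooth_curveE[OF assms(1,2)] by metis
  obtain U U' where U: "open U" "q \<in> U" "\<And>a. a \<in> C \<inter> U \<Longrightarrow> (\<Phi> has_derivative eval_form \<omega> a) (at a within C)"
    and U': "open U'" "q \<in> U'" "\<And>a. a \<in> C \<inter> U' \<Longrightarrow> (\<Phi>' has_derivative eval_form \<omega> a) (at a within C)"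
    using assms(3,4) unfolding local_primitive_def by blast
  have dc: "(c has_derivative (\<lambda>k. (deriv (fst \<circ> c) w * k, deriv (snd \<circ> c) w * k))) (at w)" if "w \<in> ball (u q) e" for w
    using chart_has_derivative[OF c(5,6) that] .
  have "continuous_on (ball (u q) e) c"
    using dc by (meson continuous_at_imp_continuous_on has_derivative_continuous)
  then have "open (c -` (U \<inter> U') \<inter> ball (u q) e)"
    using U U' by (metis continuous_on_open_vimage open_Int open_ball)
  moreover have "u q \<in> c -` (U \<inter> U') \<inter> ball (u q) e" using c(2,4,9) U U' assms(2) by auto
  ultimately obtain d where d: "d > 0" "ball (u q) d \<subseteq> c -` (U \<inter> U') \<inter> ball (u q) e"
    by (meson openE)
  have const: "\<Phi> (c w) - \<Phi>' (c w) = \<Phi> q - \<Phi>' q" if w: "w \<in> ball (u q) d" for w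
  proof -
    have "((\<lambda>w. \<Phi> (c w) - \<Phi>' (c w)) has_derivative (\<lambda>_. 0)) (at w within ball (u q) d)" if "w \<in> ball (u q) d" for w
    proof -
      have w: "w \<in> ball (u q) e" "c w \<in> C \<inter> U" "c w \<in> C \<inter> U'" using that d(2) c(7) by blast+
      have "((\<lambda>x. \<Phi> x - \<Phi>' x) has_derivative (\<lambda>_. 0)) (at (c w) within C)"
        using has_derivative_diff[OF U(3)[OF w(2)] U'(3)[OF w(3)]] by simp
      then have "((\<lambda>x. \<Phi> x - \<Phi>' x) has_derivative (\<lambda>_. 0)) (at (c w) within c ` ball (u q) d)"
        by (rule has_derivative_subset) (use c(7) d(2) in blast)
      from has_derivative_in_compose[OF has_derivative_at_withinI[OF dc[OF w(1)]] this] show ?thesis by simp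
    qed
    then have "\<Phi> (c w) - \<Phi>' (c w) = \<Phi> (c (u q)) - \<Phi>' (c (u q))"
      by (rule has_derivative_zero_unique[OF convex_ball]) (use w d in auto)
    then show ?thesis using c(2,9) assms(2) by simp
  qed
  have "open (u -` ball (u q) d)" using c(3) by (metis linear_continuous_on continuous_on_open_vimage open_UNIV open_ball inf_top.right_neutral)
  moreover have "\<Phi> a - \<Phi>' a = \<Phi> q - \<Phi>' q" if "a \<in> C" "a \<in> V" "u a \<in> ball (u q) d" for a
    using const[OF that(3)] c(9)[OF that(1,2)] by simp
  ultimately show ?thesis
    using c(1,2) d(1) by (intro exI[of _ "V \<inter> u -` ball (u q) d"] conjI ballI open_Int) simp_all
qed

text \<open>
  \<open>\<Psi>\<close> is a continuous choice, along \<open>H\<close>, of the multivalued primitive of \<open>\<omega>\<close> on \<open>C\<close>. It need not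
  factor through \<open>H\<close>.
\<close>

definition integral_lift ::
    "(complex \<times> complex) set \<Rightarrow> poly_form \<Rightarrow> ('a::topological_space \<Rightarrow> complex \<times> complex) \<Rightarrow> 'a set \<Rightarrow> ('a \<Rightarrow> complex) \<Rightarrow> bool" where
  "integral_lift C \<omega> H A \<Psi> \<longleftrightarrow>
     (\<forall>k\<in>A. \<exists>\<Phi>. local_primitive C \<omega> \<Phi> (H k) \<and> (\<forall>\<^sub>F l in at k within A. \<Psi> l - \<Phi> (H l) = \<Psi> k - \<Phi> (H k)))"

text \<open>A lift comes with some primitive at each point. Near \<open>H k\<close> any other one
  differs from it by a constant, so the primitive may be chosen freely, in particular the same for
  two lifts or for two points with the same image.\<close>

lemma integral_lift_any:
  assumes C: "smooth_curve C" and H: "continuous_on A H" "H ` A \<subseteq> C"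
    and L: "integral_lift C \<omega> H A \<Psi>" and k: "k \<in> A" and P: "local_primitive C \<omega> \<Phi> (H k)"
  shows "\<forall>\<^sub>F l in at k within A. \<Psi> l - \<Phi> (H l) = \<Psi> k - \<Phi> (H k)"
proof -
  obtain \<Phi>' where P': "local_primitive C \<omega> \<Phi>' (H k)" and e: "\<forall>\<^sub>F l in at k within A. \<Psi> l - \<Phi>' (H l) = \<Psi> k - \<Phi>' (H k)"
    using L k by (auto simp: integral_lift_def)
  obtain V where V: "open V" "H k \<in> V" "\<And>a. a \<in> C \<inter> V \<Longrightarrow> \<Phi> a - \<Phi>' a = \<Phi> (H k) - \<Phi>' (H k)"
    using local_primitive_unique[OF C _ P P'] H k by blast
  have "\<forall>\<^sub>F l in at k within A. H l \<in> V"
    using H(1) k V(1,2) by (metis continuous_on_def topological_tendstoD)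
  moreover have "\<forall>\<^sub>F l in at k within A. l \<in> A" by (simp add: eventually_at_topological exI[of _ UNIV])
  ultimately show ?thesis using e
  proof eventually_elim
    case (elim l)
    then have "\<Phi> (H l) - \<Phi>' (H l) = \<Phi> (H k) - \<Phi>' (H k)" using V(3) H(2) by blast
    then show ?case using elim(3) by algebra
  qed
qed

lemma integral_lift_subset:
  assumes "integral_lift C \<omega> H A \<Psi>" "B \<subseteq> A"
  shows "integral_lift C \<omega> H B \<Psi>"
  using assms unfolding integral_lift_def by (meson at_le filter_leD subsetD)

text \<open>On the overlap the two lifts differ by a locally constant function. Connectedness makes
  it one constant \<open>d\<close>, by which the second lift is shifted.\<close>

lemma integral_lift_glue:
  assumes C: "smooth_curve C" and H: "continuous_on (A \<union> B) H" "H ` (A \<union> B) \<subseteq> C"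
    and A: "integral_lift C \<omega> H A \<Psi>" and B: "integral_lift C \<omega> H B \<Psi>'"
    and cl: "closed A" "closed B" and conn: "connected (A \<inter> B)"
  shows "\<exists>\<Psi>. integral_lift C \<omega> H (A \<union> B) \<Psi>"
proof -
  have HA: "continuous_on A H" "H ` A \<subseteq> C" "continuous_on B H" "H ` B \<subseteq> C"
    using H by (auto intro: continuous_on_subset)
  have loc: "\<forall>\<^sub>F l in at k within A \<inter> B. \<Psi> k - \<Psi>' k = \<Psi> l - \<Psi>' l" if k: "k \<in> A \<inter> B" for k
  proof -
    obtain \<Phi> where P: "local_primitive C \<omega> \<Phi> (H k)" using A k by (auto simp: integral_lift_def)
    have "\<forall>\<^sub>F l in at k within A \<inter> B. \<Psi> l - \<Phi> (H l) = \<Psi> k - \<Phi> (H k)"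
      using integral_lift_any[OF C HA(1,2) A _ P] k by (meson Int_lower1 at_le filter_leD IntD1)
    moreover have "\<forall>\<^sub>F l in at k within A \<inter> B. \<Psi>' l - \<Phi> (H l) = \<Psi>' k - \<Phi> (H k)"
      using integral_lift_any[OF C HA(3,4) B _ P] k by (meson Int_lower2 at_le filter_leD IntD2)
    ultimately show ?thesis by eventually_elim algebra
  qed
  obtain d where d: "\<And>k. k \<in> A \<inter> B \<Longrightarrow> \<Psi> k - \<Psi>' k = d"
  proof (cases "A \<inter> B = {}")
    case False
    then obtain k0 where "k0 \<in> A \<inter> B" by blast
    then show thesis
      using connected_local_const[OF conn, of _ k0 "\<lambda>k. \<Psi> k - \<Psi>' k"] loc that by blast
  qed (use that in auto)
  define \<Xi> where "\<Xi> k = (if k \<in> A then \<Psi> k else \<Psi>' k + d)" for k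
  have \<Xi>B: "\<Xi> k = \<Psi>' k + d" if "k \<in> B" for k using that d[of k] by (auto simp: \<Xi>_def algebra_simps)
  have "integral_lift C \<omega> H (A \<union> B) \<Xi>"
    unfolding integral_lift_def
  proof
    fix k assume k: "k \<in> A \<union> B"
    obtain \<Phi> where P: "local_primitive C \<omega> \<Phi> (H k)" using local_primitive_exists[OF C] H k by blast
    have a: "\<forall>\<^sub>F l in at k within A. \<Xi> l - \<Phi> (H l) = \<Xi> k - \<Phi> (H k)"
    proof (cases "k \<in> A")
      case True
      have "\<forall>\<^sub>F l in at k within A. l \<in> A" by (simp add: eventually_at_topological exI[of _ UNIV])
      with integral_lift_any[OF C HA(1,2) A True P] show ?thesis
        by eventually_elim (simp add: \<Xi>_def True)
    next
      case False
      \<comment> \<open>A point outside a closed set is not a limit point of it, so the condition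
        coming from that set is void.\<close>
      then have "at k within A = bot" using cl(1) by (metis closed_limpt not_trivial_limit_within trivial_limit_within)
      then show ?thesis by simp
    qed
    have b: "\<forall>\<^sub>F l in at k within B. \<Xi> l - \<Phi> (H l) = \<Xi> k - \<Phi> (H k)"
    proof (cases "k \<in> B")
      case True
      have "\<forall>\<^sub>F l in at k within B. l \<in> B" by (simp add: eventually_at_topological exI[of _ UNIV])
      with integral_lift_any[OF C HA(3,4) B True P] show ?thesis
        by eventually_elim (simp add: \<Xi>B True)
    next
      case False
      then have "at k within B = bot" using cl(2) by (metis closed_limpt not_trivial_limit_within trivial_limit_within)
      then show ?thesis by simp
    qed
    show "\<exists>\<Phi>. local_primitive C \<omega> \<Phi> (H k) \<and> (\<forall>\<^sub>F l in at k within A \<union> B. \<Xi> l - \<Phi> (H l) = \<Xi> k - \<Phi> (H k))"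
      using P a b by (auto simp: at_within_union eventually_sup)
  qed
  then show ?thesis by blast
qed

lemma integral_lift_local:
  assumes C: "smooth_curve C" and H: "continuous_on K H" "H ` K \<subseteq> C" and k: "k \<in> K"
  shows "\<exists>U. open U \<and> k \<in> U \<and> (\<forall>A\<subseteq>K \<inter> U. \<exists>\<Psi>. integral_lift C \<omega> H A \<Psi>)"
proof -
  obtain \<Phi> where "local_primitive C \<omega> \<Phi> (H k)" using local_primitive_exists[OF C] H k by blast
  then obtain V where V: "open V" "H k \<in> V" "\<And>a. a \<in> C \<inter> V \<Longrightarrow> (\<Phi> has_derivative eval_form \<omega> a) (at a within C)"
    unfolding local_primitive_def by blast
  obtain U where U: "open U" "U \<inter> K = H -` V \<inter> K"
    using H(1) V(1) unfolding continuous_on_open_invariant by blast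
  have "integral_lift C \<omega> H A (\<Phi> \<circ> H)" if "A \<subseteq> K \<inter> U" for A
    unfolding integral_lift_def local_primitive_def o_def
    using V U(2) that by (intro ballI exI[of _ \<Phi>] conjI exI[of _ V]) (blast | simp)+
  moreover have "k \<in> U" using U k V by blast
  ultimately show ?thesis using U by blast
qed

text \<open>Two nested bisections: small boxes are stacked to thin vertical strips, and these are
  joined side by side. Adjacent boxes meet in a convex set, so gluing applies each time.\<close>

lemma integral_lift_square:
  fixes H :: "real \<times> real \<Rightarrow> complex \<times> complex"
  assumes C: "smooth_curve C" and H: "continuous_on ({0..1} \<times> {0..1}) H" "H ` ({0..1} \<times> {0..1}) \<subseteq> C"
  shows "\<exists>\<Psi>. integral_lift C \<omega> H ({0..1} \<times> {0..1}) \<Psi>"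
proof -
  define K where "K = {0..1::real} \<times> {0..1::real}"
  note H = H[folded K_def]
  \<comment> \<open>The intervals tested in Bolzano's principle may stick out of
    \<open>[0,1]\<close>, so a lift is asked for only on the part inside the square.\<close>
  define G where "G S \<longleftrightarrow> (\<exists>\<Psi>. integral_lift C \<omega> H (K \<inter> S) \<Psi>)" for S
  have glue: "G (S \<union> T)" if "G S" "G T" "closed S" "closed T" "convex (S \<inter> T)" for S T
  proof -
    have "continuous_on (K \<inter> S \<union> K \<inter> T) H" "H ` (K \<inter> S \<union> K \<inter> T) \<subseteq> C"
      using H by (auto intro: continuous_on_subset)
    moreover have "closed K" "convex K" by (auto simp: K_def closed_Times convex_Times)
    moreover have "connected ((K \<inter> S) \<inter> (K \<inter> T))"
      using convex_connected[OF convex_Int[OF \<open>convex K\<close> that(5)]] by (simp add: Int_ac)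
    ultimately have "\<exists>\<Psi>. integral_lift C \<omega> H (K \<inter> S \<union> K \<inter> T) \<Psi>"
      using that integral_lift_glue[OF C] unfolding G_def by (meson closed_Int)
    then show ?thesis by (simp add: G_def Int_Un_distrib)
  qed
  have sub: "G S" if "G T" "K \<inter> S \<subseteq> T" for S T
    using that integral_lift_subset unfolding G_def by (metis Int_subset_iff inf_le1)
  \<comment> \<open>The admissible width of a strip is part of the bisected property: stacking two
    boxes keeps the smaller of their widths.\<close>
  have rect: "\<exists>\<delta>>0. \<forall>a b. a \<le> x \<and> x \<le> b \<and> b - a < \<delta> \<longrightarrow> G ({a..b} \<times> {0..1})" if x: "0 \<le> x" "x \<le> 1" for x
  proof -
    have "\<exists>\<delta>>0. \<forall>a b. a \<le> x \<and> x \<le> b \<and> b - a < \<delta> \<longrightarrow> G ({a..b} \<times> {0..1})"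
    proof (rule Bolzano[of "0::real" 1 "\<lambda>c d. \<exists>\<delta>>0. \<forall>a b. a \<le> x \<and> x \<le> b \<and> b - a < \<delta> \<longrightarrow> G ({a..b} \<times> {c..d})"])
      fix c d e :: real
      assume "\<exists>\<delta>>0. \<forall>a b. a \<le> x \<and> x \<le> b \<and> b - a < \<delta> \<longrightarrow> G ({a..b} \<times> {c..d})"
        "\<exists>\<delta>>0. \<forall>a b. a \<le> x \<and> x \<le> b \<and> b - a < \<delta> \<longrightarrow> G ({a..b} \<times> {d..e})"
      then obtain \<delta> \<delta>' where \<delta>: "\<delta> > 0" "\<delta>' > 0"
        "\<And>a b. a \<le> x \<Longrightarrow> x \<le> b \<Longrightarrow> b - a < \<delta> \<Longrightarrow> G ({a..b} \<times> {c..d})"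
        "\<And>a b. a \<le> x \<Longrightarrow> x \<le> b \<Longrightarrow> b - a < \<delta>' \<Longrightarrow> G ({a..b} \<times> {d..e})" by blast
      assume cde: "c \<le> d" "d \<le> e"
      have "G ({a..b} \<times> {c..e})" if "a \<le> x" "x \<le> b" "b - a < min \<delta> \<delta>'" for a b
      proof -
        have "G ({a..b} \<times> {c..d} \<union> {a..b} \<times> {d..e})"
          using \<delta> that by (intro glue) (auto simp: closed_Times convex_Times intro!: convex_Int)
        moreover have "{a..b} \<times> {c..d} \<union> {a..b} \<times> {d..e} = {a..b} \<times> {c..e}" using cde by auto
        ultimately show ?thesis by simp
      qed
      then show "\<exists>\<delta>>0. \<forall>a b. a \<le> x \<and> x \<le> b \<and> b - a < \<delta> \<longrightarrow> G ({a..b} \<times> {c..e})"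
        using \<delta> by (intro exI[of _ "min \<delta> \<delta>'"]) auto
    next
      fix y :: real assume y: "0 \<le> y" "y \<le> 1"
      have "(x, y) \<in> K" using x y by (auto simp: K_def)
      then obtain U where U: "open U" "(x, y) \<in> U" "\<And>A. A \<subseteq> K \<inter> U \<Longrightarrow> \<exists>\<Psi>. integral_lift C \<omega> H A \<Psi>"
        using integral_lift_local[OF C H] by metis
      obtain X Y where XY: "open X" "open Y" "x \<in> X" "y \<in> Y" "X \<times> Y \<subseteq> U"
        using open_prod_elim[OF U(1,2)] by (metis mem_Sigma_iff)
      obtain \<delta> \<epsilon> where de: "\<delta> > 0" "\<epsilon> > 0" "ball x \<delta> \<subseteq> X" "ball y \<epsilon> \<subseteq> Y" using XY by (meson openE)
      have "G ({a..b} \<times> {c..d})" if "a \<le> x" "x \<le> b" "b - a < \<delta>" "c \<le> y" "y \<le> d" "d - c < \<epsilon>" for a b c d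
      proof -
        have "{a..b} \<subseteq> ball x \<delta>" "{c..d} \<subseteq> ball y \<epsilon>" using that by (auto simp: dist_real_def)
        then have "{a..b} \<times> {c..d} \<subseteq> U" using de XY by blast
        then show ?thesis unfolding G_def by (intro U(3)) auto
      qed
      then show "\<exists>\<epsilon>>0. \<forall>c d. c \<le> y \<and> y \<le> d \<and> d - c < \<epsilon> \<longrightarrow>
          (\<exists>\<delta>>0. \<forall>a b. a \<le> x \<and> x \<le> b \<and> b - a < \<delta> \<longrightarrow> G ({a..b} \<times> {c..d}))"
        using de by blast
    qed simp
    then show ?thesis .
  qed
  have "G ({0..1} \<times> {0..1})"
  proof (rule Bolzano[of "0::real" 1 "\<lambda>a b. G ({a..b} \<times> {0..1})"])
    fix a b c :: real assume "G ({a..b} \<times> {0..1})" "G ({b..c} \<times> {0..1})" "a \<le> b" "b \<le> c"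
    moreover have "{a..c} \<times> {0..1::real} = {a..b} \<times> {0..1} \<union> {b..c} \<times> {0..1}" using calculation by auto
    moreover have "G ({a..b} \<times> {0..1} \<union> {b..c} \<times> {0..1})"
      using calculation(1,2) by (intro glue) (auto simp: closed_Times convex_Times intro!: convex_Int)
    ultimately show "G ({a..c} \<times> {0..1})" by simp
  qed (use rect in auto)
  then show ?thesis by (simp add: G_def K_def)
qed

section \<open>The integral along a path as the increment of a primitive\<close>

definition differentiable_path :: "(real \<Rightarrow> complex \<times> complex) \<Rightarrow> bool" where
  "differentiable_path \<gamma> \<longleftrightarrow> (\<forall>s\<in>{0..1}. \<gamma> differentiable (at s within {0..1}))"

text \<open>\<open>form_integral\<close> takes the default value 0 on a non-integrable integrand.
  This relation carries integrability along, as additivity requires.\<close>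

definition has_form_integral :: "poly_form \<Rightarrow> (real \<Rightarrow> complex \<times> complex) \<Rightarrow> complex \<Rightarrow> bool" where
  "has_form_integral \<omega> \<gamma> I \<longleftrightarrow> ((\<lambda>s. eval2 (fst \<omega>) (\<gamma> s) * vector_derivative (\<lambda>s. fst (\<gamma> s)) (at s within {0..1})
        + eval2 (snd \<omega>) (\<gamma> s) * vector_derivative (\<lambda>s. snd (\<gamma> s)) (at s within {0..1})) has_integral I) {0..1}"

lemma form_integral_eqI: "has_form_integral \<omega> \<gamma> I \<Longrightarrow> form_integral \<omega> \<gamma> = I"
  unfolding has_form_integral_def form_integral_def by (rule integral_unique)

lemma has_form_integral_add:
  "has_form_integral \<omega> \<gamma> I \<Longrightarrow> has_form_integral \<omega>' \<gamma> J \<Longrightarrow> has_form_integral (\<omega> + \<omega>') \<gamma> (I + J)"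
  unfolding has_form_integral_def by (drule (1) has_integral_add) (simp add: algebra_simps)

lemma differentiable_path_derivatives:
  assumes "differentiable_path \<gamma>" "s \<in> {0..1}"
  shows "(\<gamma> has_vector_derivative (vector_derivative (\<lambda>s. fst (\<gamma> s)) (at s within {0..1}),
     vector_derivative (\<lambda>s. snd (\<gamma> s)) (at s within {0..1}))) (at s within {0..1})"
proof -
  obtain D where D: "(\<gamma> has_derivative D) (at s within {0..1})"
    using assms unfolding differentiable_path_def differentiable_def by blast
  have "(\<lambda>s. fst (\<gamma> s)) differentiable (at s within {0..1})" "(\<lambda>s. snd (\<gamma> s)) differentiable (at s within {0..1})"
    using differentiableI[OF has_derivative_fst[OF D]] differentiableI[OF has_derivative_snd[OF D]] by simp_all
  then have "((\<lambda>s. fst (\<gamma> s)) has_vector_derivative vector_derivative (\<lambda>s. fst (\<gamma> s)) (at s within {0..1})) (at s within {0..1})"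
    "((\<lambda>s. snd (\<gamma> s)) has_vector_derivative vector_derivative (\<lambda>s. snd (\<gamma> s)) (at s within {0..1})) (at s within {0..1})"
    by (simp_all add: vector_derivative_works)
  from has_vector_derivative_Pair[OF this] show ?thesis by simp
qed

text \<open>Near each parameter \<open>\<Psi>\<close> is a local primitive along the path plus a
  constant, hence differentiable with the right derivative. The gauge integral allows the
  fundamental theorem with a derivative that exists everywhere but may be discontinuous.\<close>

lemma has_form_integral_primitive:
  assumes \<gamma>: "differentiable_path \<gamma>"
    and \<Psi>: "\<And>s. s \<in> {0..1} \<Longrightarrow> \<exists>\<Phi>. local_primitive C \<omega> \<Phi> (\<gamma> s) \<and>
       (\<forall>\<^sub>F l in at s within {0..1}. \<Psi> l - \<Phi> (\<gamma> l) = \<Psi> s - \<Phi> (\<gamma> s))"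
    and C: "\<gamma> ` {0..1} \<subseteq> C"
  shows "has_form_integral \<omega> \<gamma> (\<Psi> 1 - \<Psi> 0)"
  unfolding has_form_integral_def
proof (rule fundamental_theorem_of_calculus)
  fix s :: real assume s: "s \<in> {0..1}"
  obtain \<Phi> where P: "local_primitive C \<omega> \<Phi> (\<gamma> s)" "\<forall>\<^sub>F l in at s within {0..1}. \<Psi> l - \<Phi> (\<gamma> l) = \<Psi> s - \<Phi> (\<gamma> s)"
    using \<Psi>[OF s] by blast
  have "(\<Phi> has_derivative eval_form \<omega> (\<gamma> s)) (at (\<gamma> s) within \<gamma> ` {0..1})"
    using P(1) C s unfolding local_primitive_def by (meson IntI has_derivative_subset image_subset_iff)
  from has_derivative_in_compose[OF differentiable_path_derivatives[OF \<gamma> s, unfolded has_vector_derivative_def] this]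
  have "((\<lambda>s. \<Phi> (\<gamma> s)) has_vector_derivative (eval2 (fst \<omega>) (\<gamma> s) * vector_derivative (\<lambda>s. fst (\<gamma> s)) (at s within {0..1})
        + eval2 (snd \<omega>) (\<gamma> s) * vector_derivative (\<lambda>s. snd (\<gamma> s)) (at s within {0..1}))) (at s within {0..1})"
    by (simp add: has_vector_derivative_def eval_form_def scaleR_conv_of_real algebra_simps)
  then have D: "((\<lambda>l. \<Phi> (\<gamma> l) + (\<Psi> s - \<Phi> (\<gamma> s))) has_vector_derivative (eval2 (fst \<omega>) (\<gamma> s) * vector_derivative (\<lambda>s. fst (\<gamma> s)) (at s within {0..1})
        + eval2 (snd \<omega>) (\<gamma> s) * vector_derivative (\<lambda>s. snd (\<gamma> s)) (at s within {0..1}))) (at s within {0..1})"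
    by (simp add: has_vector_derivative_add_const)
  have "\<forall>\<^sub>F l in at s within {0..1}. \<Phi> (\<gamma> l) + (\<Psi> s - \<Phi> (\<gamma> s)) = \<Psi> l"
    using P(2) by eventually_elim (simp add: algebra_simps)
  with D show "(\<Psi> has_vector_derivative (eval2 (fst \<omega>) (\<gamma> s) * vector_derivative (\<lambda>s. fst (\<gamma> s)) (at s within {0..1})
        + eval2 (snd \<omega>) (\<gamma> s) * vector_derivative (\<lambda>s. snd (\<gamma> s)) (at s within {0..1}))) (at s within {0..1})"
    unfolding has_vector_derivative_def
    by (rule has_derivative_transform_eventually) (use s in auto)
qed simp

text \<open>With a lift \<open>\<Psi>\<close> on the square, the integrals along the two end loops
  are the values of \<open>\<Psi> (x, 1) - \<Psi> (x, 0)\<close> at \<open>x = 0\<close> and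
  \<open>x = 1\<close>. As \<open>H (x, 1) = H (x, 0)\<close>, one primitive serves on both edges,
  so this difference is locally constant in \<open>x\<close>. Nothing is differentiated on the
  intermediate loops.\<close>

lemma homotopic_loops_form_integral:
  assumes C: "smooth_curve C" and hom: "homotopic_loops C \<gamma> \<gamma>'"
    and diff: "differentiable_path \<gamma>" "differentiable_path \<gamma>'"
  shows "\<exists>I. has_form_integral \<omega> \<gamma> I \<and> has_form_integral \<omega> \<gamma>' I"
proof -
  obtain H where H: "continuous_on ({0..1::real} \<times> {0..1::real}) H" "H \<in> ({0..1} \<times> {0..1}) \<rightarrow> C"
    "\<And>x. x \<in> {0..1} \<Longrightarrow> H (0, x) = \<gamma> x" "\<And>x. x \<in> {0..1} \<Longrightarrow> H (1, x) = \<gamma>' x"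
    "\<And>t. t \<in> {0..1} \<Longrightarrow> H (t, 1) = H (t, 0)"
    using hom unfolding homotopic_loops by (auto simp: pathfinish_def pathstart_def o_def)
  have HC: "H ` ({0..1} \<times> {0..1}) \<subseteq> C" using H(2) by auto
  obtain \<Psi> where L: "integral_lift C \<omega> H ({0..1} \<times> {0..1}) \<Psi>"
    using integral_lift_square[OF C H(1) HC] by blast
  have side: "\<forall>\<^sub>F l in at s within {0..1}. \<Psi> (u l) - \<Phi> (H (u l)) = \<Psi> (u s) - \<Phi> (H (u s))"
    if s: "s \<in> {0..1}" and u: "continuous_on {0..1} u" "u ` {0..1} \<subseteq> {0..1} \<times> {0..1}"
      and P: "local_primitive C \<omega> \<Phi> (H (u s))" for s \<Phi> and u :: "real \<Rightarrow> real \<times> real"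
  proof -
    have "\<forall>\<^sub>F l in at (u s) within {0..1} \<times> {0..1}. \<Psi> l - \<Phi> (H l) = \<Psi> (u s) - \<Phi> (H (u s))"
      using integral_lift_any[OF C H(1) HC L _ P] s u(2) by blast
    \<comment> \<open>The path \<open>u\<close> may return to the value \<open>u s\<close>, which
      the punctured filter omits. The equation is trivial there, so the full neighbourhood filter
      can be used.\<close>
    then have ev: "\<forall>\<^sub>F l in inf (nhds (u s)) (principal ({0..1} \<times> {0..1})). \<Psi> l - \<Phi> (H l) = \<Psi> (u s) - \<Phi> (H (u s))"
      by (auto simp: at_within_def eventually_inf_principal elim: eventually_mono)
    have "filterlim u (nhds (u s)) (at s within {0..1})"
      using u(1) s by (simp add: continuous_on_def)
    moreover have "filterlim u (principal ({0..1} \<times> {0..1})) (at s within {0..1})"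
      using u(2) by (auto simp: filterlim_principal eventually_at_topological intro!: exI[of _ UNIV])
    ultimately have "filterlim u (inf (nhds (u s)) (principal ({0..1} \<times> {0..1}))) (at s within {0..1})"
      by (simp add: filterlim_inf)
    from eventually_compose_filterlim[OF ev this] show ?thesis .
  qed
  have ends: "has_form_integral \<omega> \<gamma>1 (\<Psi> (x, 1) - \<Psi> (x, 0))"
    if x: "x \<in> {0..1}" and \<gamma>1: "\<And>s. s \<in> {0..1} \<Longrightarrow> H (x, s) = \<gamma>1 s" "differentiable_path \<gamma>1" for x \<gamma>1
  proof (rule has_form_integral_primitive[OF \<gamma>1(2), of C])
    show "\<gamma>1 ` {0..1} \<subseteq> C" using \<gamma>1(1) x HC by force
    fix s :: real assume s: "s \<in> {0..1}"
    obtain \<Phi> where P: "local_primitive C \<omega> \<Phi> (H (x, s))"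
      using local_primitive_exists[OF C] HC x s by blast
    have "continuous_on {0..1} (Pair x)" by (rule continuous_on_Pair[OF continuous_on_const continuous_on_id])
    moreover have "Pair x ` {0..1} \<subseteq> {0..1} \<times> {0..1}" using x by auto
    ultimately have "\<forall>\<^sub>F l in at s within {0..1}. \<Psi> (x, l) - \<Phi> (H (x, l)) = \<Psi> (x, s) - \<Phi> (H (x, s))"
      using side[OF s, of "\<lambda>l. (x, l)"] P by blast
    moreover have "\<forall>\<^sub>F l in at s within {0..1}. l \<in> {0..1}" by (simp add: eventually_at_topological exI[of _ UNIV])
    ultimately have "\<forall>\<^sub>F l in at s within {0..1}. \<Psi> (x, l) - \<Phi> (\<gamma>1 l) = \<Psi> (x, s) - \<Phi> (\<gamma>1 s)"
      by eventually_elim (use \<gamma>1(1) s in auto)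
    then show "\<exists>\<Phi>. local_primitive C \<omega> \<Phi> (\<gamma>1 s) \<and> (\<forall>\<^sub>F l in at s within {0..1}. \<Psi> (x, l) - \<Phi> (\<gamma>1 l) = \<Psi> (x, s) - \<Phi> (\<gamma>1 s))"
      using P \<gamma>1(1)[OF s] by auto
  qed
  have "\<Psi> (0, 1) - \<Psi> (0, 0) = \<Psi> (1, 1) - \<Psi> (1, 0)"
  proof (rule connected_local_const[of "{0..1::real}" 0 1 "\<lambda>x. \<Psi> (x, 1) - \<Psi> (x, 0)"])
    show "\<forall>a\<in>{0..1}. \<forall>\<^sub>F b in at a within {0..1}. \<Psi> (a, 1) - \<Psi> (a, 0) = \<Psi> (b, 1) - \<Psi> (b, 0)"
    proof
      fix x :: real assume x: "x \<in> {0..1}"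
      obtain \<Phi> where P: "local_primitive C \<omega> \<Phi> (H (x, 0))"
        using local_primitive_exists[OF C] HC x by (metis atLeastAtMost_iff image_subset_iff mem_Sigma_iff order_refl zero_le_one)
      have u: "continuous_on {0..1} (\<lambda>l. (l, b))" "(\<lambda>l. (l, b)) ` {0..1} \<subseteq> {0..1} \<times> {0..1}"
        if "b \<in> {0..1}" for b :: real using that by (auto intro!: continuous_on_Pair)
      have "\<forall>\<^sub>F l in at x within {0..1}. \<Psi> (l, 0) - \<Phi> (H (l, 0)) = \<Psi> (x, 0) - \<Phi> (H (x, 0))"
        using side[OF x u, of 0 \<Phi>] P by simp
      moreover have "\<forall>\<^sub>F l in at x within {0..1}. \<Psi> (l, 1) - \<Phi> (H (l, 1)) = \<Psi> (x, 1) - \<Phi> (H (x, 1))"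
        using side[OF x u, of 1 \<Phi>] P H(5)[OF x] by simp
      moreover have "\<forall>\<^sub>F l in at x within {0..1}. l \<in> {0..1}" by (simp add: eventually_at_topological exI[of _ UNIV])
      ultimately show "\<forall>\<^sub>F b in at x within {0..1}. \<Psi> (x, 1) - \<Psi> (x, 0) = \<Psi> (b, 1) - \<Psi> (b, 0)"
      proof eventually_elim
        case (elim l)
        then have "\<Psi> (l, 1) - \<Phi> (H (l, 0)) = \<Psi> (x, 1) - \<Phi> (H (x, 0))"
          using H(5)[OF x] H(5)[of l] by simp
        with elim(1) show ?case by algebra
      qed
    qed
  qed auto
  moreover have "has_form_integral \<omega> \<gamma> (\<Psi> (0, 1) - \<Psi> (0, 0))" using H diff by (intro ends) auto
  moreover have "has_form_integral \<omega> \<gamma>' (\<Psi> (1, 1) - \<Psi> (1, 0))" using H diff by (intro ends) auto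
  ultimately show ?thesis by auto
qed

section \<open>Level curves and projections\<close>

definition level :: "complex poly \<Rightarrow> complex \<Rightarrow> (complex \<times> complex) set" where
  "level g t = {(z, y). y\<^sup>2 + poly g z = t}"

lemma mem_level [simp]: "(z, y) \<in> level g t \<longleftrightarrow> y\<^sup>2 + poly g z = t" by (simp add: level_def)

lemma local_inverse:
  assumes f: "f holomorphic_on S" "open S" "z0 \<in> S" "deriv f z0 \<noteq> 0"
  obtains G e r where "e > 0" "r > 0" "ball z0 r \<subseteq> S" "G holomorphic_on ball (f z0) e"
    "\<And>w. w \<in> ball (f z0) e \<Longrightarrow> f (G w) = w" "\<And>w. w \<in> ball (f z0) e \<Longrightarrow> G w \<in> ball z0 r"
    "\<And>z. z \<in> ball z0 r \<Longrightarrow> G (f z) = z"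
proof -
  obtain r where r: "r > 0" "ball z0 r \<subseteq> S" "inj_on f (ball z0 r)"
    using has_complex_derivative_locally_injective[OF f(1,3,2,4)] by metis
  have hol: "f holomorphic_on ball z0 r" using f(1) r(2) by (rule holomorphic_on_subset)
  obtain G where G: "G holomorphic_on f ` ball z0 r" "\<And>z. z \<in> ball z0 r \<Longrightarrow> G (f z) = z"
    using holomorphic_has_inverse[OF hol open_ball r(3)] by metis
  have "open (f ` ball z0 r)" by (rule open_mapping_thm3[OF hol open_ball r(3)])
  then obtain e where e: "e > 0" "ball (f z0) e \<subseteq> f ` ball z0 r"
    using r(1) by (meson centre_in_ball image_eqI openE)
  show thesis
  proof (rule that[OF e(1) r(1,2)])
    show "G holomorphic_on ball (f z0) e" using G(1) e(2) by (rule holomorphic_on_subset)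
  qed (use G(2) e(2) in force)+
qed

lemma deriv_poly: "deriv (poly g) z = poly (pderiv g) z"
  by (rule DERIV_imp_deriv[OF poly_DERIV])

text \<open>Where \<open>y \<noteq> 0\<close> the curve is locally a graph over the
  \<open>z\<close>-line by a square root. Where \<open>y = 0\<close>, the point is not critical for
  \<open>g\<close>, so inverting \<open>g\<close> gives a graph over the
  \<open>y\<close>-line.\<close>

lemma smooth_curve_level:
  assumes "\<And>z. poly g z = t \<Longrightarrow> poly (pderiv g) z \<noteq> 0"
  shows "smooth_curve (level g t)"
  unfolding smooth_curve_def
proof
  fix q assume q: "q \<in> level g t"
  obtain z0 y0 where [simp]: "q = (z0, y0)" by (cases q)
  have eq: "y0\<^sup>2 + poly g z0 = t" using q by simp
  show "\<exists>V u c e. open V \<and> q \<in> V \<and> bounded_linear u \<and> e > 0 \<and>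
     (fst \<circ> c) holomorphic_on ball (u q) e \<and> (snd \<circ> c) holomorphic_on ball (u q) e \<and>
     c ` ball (u q) e \<subseteq> level g t \<and> (\<forall>a\<in>level g t \<inter> V. u a \<in> ball (u q) e \<and> c (u a) = a)"
  proof (cases "y0 = 0")
    case False
    \<comment> \<open>Dividing by \<open>y0\<^sup>2\<close> brings the radicand close to 1, away
      from the cut of \<open>csqrt\<close>. The condition \<open>Re (y / y0) > 0\<close> in
      \<open>V\<close> then selects the sheet through \<open>q\<close>.\<close>
    define \<phi> where "\<phi> z = (t - poly g z) / y0\<^sup>2" for z
    have "open (\<phi> -` ball 1 1)"
      unfolding \<phi>_def by (intro open_vimage continuous_intros) (use False in auto)
    moreover have "\<phi> z0 = 1" using eq False by (auto simp: \<phi>_def field_simps)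
    ultimately obtain e where e: "e > 0" "ball z0 e \<subseteq> \<phi> -` ball 1 1"
      by (metis centre_in_ball openE vimageI zero_less_one)
    have re: "Re (\<phi> z) > 0" if "z \<in> ball z0 e" for z
    proof -
      have "norm (1 - \<phi> z) < 1" using e(2) that by (auto simp: dist_norm)
      then show ?thesis using abs_Re_le_cmod[of "1 - \<phi> z"] by simp
    qed
    define c where "c z = (z, y0 * csqrt (\<phi> z))" for z
    define V where "V = {p. fst p \<in> ball z0 e \<and> Re (snd p / y0) > 0}"
    have "open V"
    proof -
      have "V = (fst -` ball z0 e) \<inter> ((\<lambda>p. Re (snd p / y0)) -` {0<..})" by (auto simp: V_def)
      moreover have "open ((\<lambda>p::complex \<times> complex. Re (snd p / y0)) -` {0<..})"
        by (intro open_vimage continuous_intros) (use False in auto)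
      ultimately show ?thesis by (simp add: open_Int open_vimage_fst)
    qed
    moreover have "q \<in> V" using e False by (simp add: V_def)
    moreover have "(fst \<circ> c) holomorphic_on ball (fst q) e"
      by (simp add: c_def o_def)
    moreover have "(snd \<circ> c) holomorphic_on ball (fst q) e"
      unfolding c_def o_def snd_conv
    proof (intro holomorphic_intros)
      show "\<phi> holomorphic_on ball (fst q) e" unfolding \<phi>_def by (intro holomorphic_intros) (use False in auto)
      show "\<phi> z \<notin> \<real>\<^sub>\<le>\<^sub>0" if "z \<in> ball (fst q) e" for z
        using re[of z] that by (auto simp: complex_nonpos_Reals_iff)
    qed
    moreover have "c ` ball (fst q) e \<subseteq> level g t"
      using False by (auto simp: c_def power_mult_distrib \<phi>_def)
    moreover have "\<forall>a\<in>level g t \<inter> V. fst a \<in> ball (fst q) e \<and> c (fst a) = a"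
    proof
      fix a assume a: "a \<in> level g t \<inter> V"
      obtain z y where [simp]: "a = (z, y)" by (cases a)
      have "\<phi> z = (y / y0)\<^sup>2" using a by (auto simp: \<phi>_def power_divide)
      moreover have "Re (y / y0) > 0" using a by (auto simp: V_def)
      ultimately have "csqrt (\<phi> z) = y / y0" by (simp add: csqrt_square)
      then show "fst a \<in> ball (fst q) e \<and> c (fst a) = a" using a False by (auto simp: V_def c_def)
    qed
    ultimately show ?thesis
      using e(1) bounded_linear_fst by (intro exI[of _ V] exI[of _ fst] exI[of _ c] exI[of _ e]) auto
  next
    case True
    then have t: "t = poly g z0" using eq by simp
    have "deriv (poly g) z0 \<noteq> 0" using assms t by (simp add: deriv_poly)
    then obtain G e r where G: "e > 0" "r > 0" "G holomorphic_on ball (poly g z0) e"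
      "\<And>w. w \<in> ball (poly g z0) e \<Longrightarrow> poly g (G w) = w" "\<And>w. w \<in> ball (poly g z0) e \<Longrightarrow> G w \<in> ball z0 r"
      "\<And>z. z \<in> ball z0 r \<Longrightarrow> G (poly g z) = z"
      using local_inverse[OF poly_holomorphic_on[OF holomorphic_on_ident] open_UNIV UNIV_I, of g z0] by metis
    have "open ((\<lambda>y. t - y\<^sup>2) -` ball t e)" by (intro open_vimage continuous_intros) auto
    then obtain d where d: "d > 0" "ball 0 d \<subseteq> (\<lambda>y. t - y\<^sup>2) -` ball t e"
      using G(1) by (metis (no_types, lifting) centre_in_ball diff_zero openE vimageI zero_power2)
    have dd: "t - y\<^sup>2 \<in> ball t e" if "y \<in> ball 0 d" for y using d that by blast
    define c where "c y = (G (t - y\<^sup>2), y)" for y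
    define V where "V = ball z0 r \<times> ball (0::complex) d"
    have sq: "snd q = 0" using True by simp
    have "(fst \<circ> c) holomorphic_on ball (snd q) d"
    proof -
      have "(G \<circ> (\<lambda>y. t - y\<^sup>2)) holomorphic_on ball 0 d"
        by (rule holomorphic_on_compose_gen[of _ _ _ "ball t e"]) (use G(3) t dd in \<open>auto intro!: holomorphic_intros\<close>)
      then show ?thesis by (simp add: True c_def o_def)
    qed
    moreover have "(snd \<circ> c) holomorphic_on ball (snd q) d" by (simp add: c_def o_def)
    moreover have "c ` ball (snd q) d \<subseteq> level g t"
      unfolding sq using G(4) dd by (auto simp: c_def t)
    moreover have "\<forall>a\<in>level g t \<inter> V. snd a \<in> ball (snd q) d \<and> c (snd a) = a"
    proof
      fix a assume a: "a \<in> level g t \<inter> V"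
      obtain z y where [simp]: "a = (z, y)" by (cases a)
      have "poly g z = t - y\<^sup>2" using a by (auto simp: algebra_simps)
      then have "G (t - y\<^sup>2) = z" using G(6)[of z] a by (auto simp: V_def)
      then show "snd a \<in> ball (snd q) d \<and> c (snd a) = a" using a unfolding sq by (auto simp: V_def c_def)
    qed
    moreover have "open V" "q \<in> V" using True G(2) d(1) by (auto simp: V_def open_Times)
    ultimately show ?thesis
      using d(1) bounded_linear_snd by (intro exI[of _ V] exI[of _ snd] exI[of _ c] exI[of _ d]) auto
  qed
qed

text \<open>There are finitely many critical values; \<open>t0\<close> may be one of them, and the
  punctured neighbourhood leaves it out.\<close>

lemma eventually_smooth_level:
  assumes "degree g > 0"
  shows "\<forall>\<^sub>F t in at t0. smooth_curve (level g t)"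
proof -
  define B where "B = poly g ` {z. poly (pderiv g) z = 0}"
  have "pderiv g \<noteq> 0" using assms by (simp add: pderiv_eq_0_iff)
  then have "finite B" unfolding B_def by (intro finite_imageI poly_roots_finite)
  then have "open (- (B - {t0}))" by (intro open_Compl finite_imp_closed) auto
  then have "\<forall>\<^sub>F t in at t0. t \<notin> B"
    unfolding eventually_at_topological by (intro exI[of _ "- (B - {t0})"]) auto
  then show ?thesis by eventually_elim (auto intro!: smooth_curve_level simp: B_def)
qed

text \<open>\<open>B\<close> is a single-valued primitive on the level curve. To see this,
  \<open>A(a) (F - t)\<close> is added to it: this vanishes on the curve and contributes
  \<open>A dF\<close> to the derivative at \<open>a\<close>.\<close>

lemma relatively_exact_integral:
  assumes ex: "relatively_exact [:f, 0, 1:] \<omega>" and \<gamma>: "differentiable_path \<gamma>" "\<gamma> ` {0..1} \<subseteq> level f t" "\<gamma> 0 = \<gamma> 1"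
  shows "has_form_integral \<omega> \<gamma> 0"
proof -
  obtain A B where \<omega>: "\<omega> = scale_form A (ext_d [:f, 0, 1:]) + ext_d B"
    using ex by (auto simp: relatively_exact_def)
  have D: "(eval2 B has_derivative eval_form \<omega> a) (at a within level f t)" if a: "a \<in> level f t" for a
  proof -
    have "((\<lambda>b. eval2 B b + eval2 A a * (eval2 [:f, 0, 1:] b - t)) has_derivative
      (\<lambda>v. (eval2 (partial_x B) a * fst v + eval2 (partial_y B) a * snd v) + eval2 A a *
        ((eval2 (partial_x [:f, 0, 1:]) a * fst v + eval2 (partial_y [:f, 0, 1:]) a * snd v) - 0))) (at a within level f t)"
      by (intro has_derivative_add has_derivative_mult_right has_derivative_diff eval2_has_derivative has_derivative_const)
    also have "(\<lambda>v. (eval2 (partial_x B) a * fst v + eval2 (partial_y B) a * snd v) + eval2 A a *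
        ((eval2 (partial_x [:f, 0, 1:]) a * fst v + eval2 (partial_y [:f, 0, 1:]) a * snd v) - 0)) = eval_form \<omega> a"
      unfolding \<omega> eval_form_def fun_eq_iff
      by (simp add: scale_form_def algebra_simps del: partial_x_pCons)
    finally show ?thesis
      by (rule has_derivative_transform[OF a, rotated])
        (auto simp: level_def power2_eq_square algebra_simps one_pCons[symmetric])
  qed
  have "has_form_integral \<omega> \<gamma> (eval2 B (\<gamma> 1) - eval2 B (\<gamma> 0))"
  proof (rule has_form_integral_primitive[OF \<gamma>(1) _ \<gamma>(2)])
    show "\<exists>\<Phi>. local_primitive (level f t) \<omega> \<Phi> (\<gamma> s) \<and>
      (\<forall>\<^sub>F l in at s within {0..1}. eval2 B (\<gamma> l) - \<Phi> (\<gamma> l) = eval2 B (\<gamma> s) - \<Phi> (\<gamma> s))" for s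
      unfolding local_primitive_def using D by (intro exI[of _ "eval2 B"] conjI exI[of _ UNIV]) auto
  qed
  then show ?thesis using \<gamma>(3) by simp
qed

section \<open>Pullbacks and null-homotopic loops\<close>

lemma differentiable_path_proj_map:
  assumes "differentiable_path \<gamma>" "s \<in> {0..1}"
  shows "((\<lambda>s. poly h (fst (\<gamma> s))) has_vector_derivative
      poly (pderiv h) (fst (\<gamma> s)) * vector_derivative (\<lambda>s. fst (\<gamma> s)) (at s within {0..1})) (at s within {0..1})"
    "((\<lambda>s. snd (\<gamma> s)) has_vector_derivative vector_derivative (\<lambda>s. snd (\<gamma> s)) (at s within {0..1})) (at s within {0..1})"
proof -
  note D = differentiable_path_derivatives[OF assms, unfolded has_vector_derivative_def]
  have 1: "((\<lambda>s. fst (\<gamma> s)) has_derivative (\<lambda>x. x *\<^sub>R vector_derivative (\<lambda>s. fst (\<gamma> s)) (at s within {0..1}))) (at s within {0..1})"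
    using has_derivative_fst[OF D] by simp
  show "((\<lambda>s. snd (\<gamma> s)) has_vector_derivative vector_derivative (\<lambda>s. snd (\<gamma> s)) (at s within {0..1})) (at s within {0..1})"
    using has_derivative_snd[OF D] by (simp add: has_vector_derivative_def)
  show "((\<lambda>s. poly h (fst (\<gamma> s))) has_vector_derivative
      poly (pderiv h) (fst (\<gamma> s)) * vector_derivative (\<lambda>s. fst (\<gamma> s)) (at s within {0..1})) (at s within {0..1})"
    using has_derivative_compose[OF 1 poly_DERIV[of h, unfolded has_field_derivative_def]]
    by (simp add: has_vector_derivative_def)
qed

lemma vector_derivative_01:
  "(f has_vector_derivative f') (at s within {0..1}) \<Longrightarrow> s \<in> {0..1} \<Longrightarrow>
    vector_derivative f (at s within {0..1::real}) = f'"
  for f :: "real \<Rightarrow> complex"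
  by (rule vector_derivative_within_closed_interval) auto

lemma has_form_integral_pullback:
  assumes "differentiable_path \<gamma>"
  shows "has_form_integral (pullback_form h \<eta>) \<gamma> I \<longleftrightarrow> has_form_integral \<eta> (proj_map h \<circ> \<gamma>) I"
  unfolding has_form_integral_def
proof (rule has_integral_cong)
  fix s :: real assume s: "s \<in> {0..1}"
  show "eval2 (fst (pullback_form h \<eta>)) (\<gamma> s) * vector_derivative (\<lambda>s. fst (\<gamma> s)) (at s within {0..1}) +
         eval2 (snd (pullback_form h \<eta>)) (\<gamma> s) * vector_derivative (\<lambda>s. snd (\<gamma> s)) (at s within {0..1}) =
    eval2 (fst \<eta>) ((proj_map h \<circ> \<gamma>) s) * vector_derivative (\<lambda>s. fst ((proj_map h \<circ> \<gamma>) s)) (at s within {0..1}) +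
         eval2 (snd \<eta>) ((proj_map h \<circ> \<gamma>) s) * vector_derivative (\<lambda>s. snd ((proj_map h \<circ> \<gamma>) s)) (at s within {0..1})"
    using vector_derivative_01[OF differentiable_path_proj_map(1)[OF assms s, of h] s]
    by (simp add: proj_map_def pullback_form_def eval2_subst_x)
qed

lemma differentiable_path_proj:
  assumes "differentiable_path \<gamma>" shows "differentiable_path (proj_map h \<circ> \<gamma>)"
  unfolding differentiable_path_def
proof
  fix s :: real assume s: "s \<in> {0..1}"
  from has_vector_derivative_Pair[OF differentiable_path_proj_map(1)[OF assms s, of h]
      differentiable_path_proj_map(2)[OF assms s]]
  show "(proj_map h \<circ> \<gamma>) differentiable (at s within {0..1})"
    unfolding has_vector_derivative_def by (auto simp: proj_map_def o_def intro: differentiableI)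
qed

lemma null_homotopic_integral:
  assumes "smooth_curve C" "null_homotopic_in C \<gamma>" "differentiable_path \<gamma>"
  shows "has_form_integral \<omega> \<gamma> 0"
proof -
  obtain a where "homotopic_loops C \<gamma> (\<lambda>_. a)" using assms(2) by (auto simp: null_homotopic_in_def)
  moreover have "differentiable_path (\<lambda>_. a)" by (simp add: differentiable_path_def)
  ultimately obtain I where I: "has_form_integral \<omega> \<gamma> I" "has_form_integral \<omega> (\<lambda>_. a) I"
    using homotopic_loops_form_integral[OF assms(1) _ assms(3)] by blast
  have "vector_derivative (\<lambda>_. b) (at s within {0..1}) = 0" if "s \<in> {0..1}" for b :: complex and s :: real
    using that by (intro vector_derivative_01) auto
  then have "has_form_integral \<omega> (\<lambda>_. a) 0"
    unfolding has_form_integral_def by (intro has_integral_is_0) auto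
  then have "I = 0" using I(2) unfolding has_form_integral_def by (intro has_integral_unique)
  then show ?thesis using I(1) by simp
qed

text \<open>\<open>f - f(x0) = (x - x0)\<^sup>2 k\<close> with
  \<open>k(x0) = f''(x0) / 2 \<noteq> 0\<close>, so \<open>\<xi> = (x - x0) sqrt k\<close> has a
  simple zero at \<open>x0\<close> and a local inverse.\<close>

lemma morse_function_coordinate:
  fixes f :: "complex poly"
  assumes f: "poly (pderiv f) x0 = 0" "poly (pderiv (pderiv f)) x0 \<noteq> 0"
  obtains \<xi> X e N where "e > 0" "open N" "x0 \<in> N" "\<xi> holomorphic_on N" "\<xi> x0 = 0"
    "\<And>x. x \<in> N \<Longrightarrow> poly f x = poly f x0 + (\<xi> x)\<^sup>2" "X holomorphic_on ball 0 e"
    "\<And>w. w \<in> ball 0 e \<Longrightarrow> X w \<in> N" "\<And>w. w \<in> ball 0 e \<Longrightarrow> \<xi> (X w) = w" "\<And>x. x \<in> N \<Longrightarrow> X (\<xi> x) = x"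
proof -
  have "[:- x0, 1:] dvd f - [:poly f x0:]" by (simp add: poly_eq_0_iff_dvd[symmetric])
  then obtain k1 where k1: "f - [:poly f x0:] = [:- x0, 1:] * k1" by (elim dvdE)
  then have f1: "f = [:- x0, 1:] * k1 + [:poly f x0:]" by (metis diff_add_cancel)
  have "pderiv f = [:- x0, 1:] * pderiv k1 + k1"
    by (subst f1) (simp add: pderiv_add pderiv_mult pderiv_pCons del: mult_pCons_left)
  then have "poly k1 x0 = 0" using f(1) by simp
  then obtain k where k: "k1 = [:- x0, 1:] * k" unfolding poly_eq_0_iff_dvd by (elim dvdE)
  have fx: "poly f x = poly f x0 + (x - x0)\<^sup>2 * poly k x" for x
    using arg_cong[OF f1, of "\<lambda>p. poly p x"] by (simp add: k power2_eq_square algebra_simps)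
  have "poly (pderiv (pderiv f)) x0 = 2 * poly k x0"
    by (subst f1) (simp add: k pderiv_add pderiv_mult pderiv_pCons del: mult_pCons_left mult_pCons_right)
  then have k0: "poly k x0 \<noteq> 0" using f(2) by auto
  define \<phi> where "\<phi> x = poly k x / poly k x0" for x
  have "open (\<phi> -` ball 1 1)"
    unfolding \<phi>_def by (intro open_vimage continuous_intros) (use k0 in auto)
  moreover have "\<phi> x0 = 1" using k0 by (auto simp: \<phi>_def field_simps)
  ultimately obtain e0 where e0: "e0 > 0" "ball x0 e0 \<subseteq> \<phi> -` ball 1 1"
    by (metis centre_in_ball openE vimageI zero_less_one)
  have re: "\<phi> x \<notin> \<real>\<^sub>\<le>\<^sub>0" if "x \<in> ball x0 e0" for x
  proof -
    have "norm (1 - \<phi> x) < 1" using e0(2) that by (auto simp: dist_norm)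
    then show ?thesis using abs_Re_le_cmod[of "1 - \<phi> x"] by (auto simp: complex_nonpos_Reals_iff)
  qed
  \<comment> \<open>A branch of \<open>sqrt k\<close>: the constant \<open>k(x0)\<close> may lie on
    the cut of \<open>csqrt\<close>, so it is split off and only the ratio near 1 is treated as a
    function.\<close>
  define s where "s x = csqrt (poly k x0) * csqrt (\<phi> x)" for x
  define \<xi> where "\<xi> x = (x - x0) * s x" for x
  have "\<phi> holomorphic_on ball x0 e0" unfolding \<phi>_def by (intro holomorphic_intros) (use k0 in auto)
  then have hs: "s holomorphic_on ball x0 e0" unfolding s_def by (intro holomorphic_intros re)
  then have h\<xi>: "\<xi> holomorphic_on ball x0 e0" unfolding \<xi>_def by (intro holomorphic_intros)
  have "(s has_field_derivative deriv s x0) (at x0)"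
    using hs e0(1) by (intro holomorphic_derivI[OF _ open_ball]) auto
  then have "(\<xi> has_field_derivative s x0) (at x0)"
    unfolding \<xi>_def by (auto intro!: derivative_eq_intros)
  then have "deriv \<xi> x0 = s x0" by (rule DERIV_imp_deriv)
  moreover have "s x0 \<noteq> 0" using k0 \<open>\<phi> x0 = 1\<close> by (simp add: s_def)
  ultimately have d: "deriv \<xi> x0 \<noteq> 0" by simp
  have \<xi>0: "\<xi> x0 = 0" by (simp add: \<xi>_def)
  have x0: "x0 \<in> ball x0 e0" using e0(1) by simp
  obtain X e r where X: "e > 0" "r > 0" "ball x0 r \<subseteq> ball x0 e0" "X holomorphic_on ball (\<xi> x0) e"
    "\<And>w. w \<in> ball (\<xi> x0) e \<Longrightarrow> \<xi> (X w) = w" "\<And>w. w \<in> ball (\<xi> x0) e \<Longrightarrow> X w \<in> ball x0 r"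
    "\<And>z. z \<in> ball x0 r \<Longrightarrow> X (\<xi> z) = z"
    using local_inverse[OF h\<xi> open_ball x0 d] by metis
  show thesis
  proof (rule that[OF X(1) open_ball[of x0 r]])
    show "\<xi> holomorphic_on ball x0 r" using h\<xi> X(3) by (rule holomorphic_on_subset)
    show "poly f x = poly f x0 + (\<xi> x)\<^sup>2" for x
      using k0 by (simp add: fx[of x] \<xi>_def s_def power_mult_distrib \<phi>_def)
  qed (use X \<xi>0 in auto)
qed

section \<open>Vanishing cycles\<close>

text \<open>
  The even part is \<open>w\<^sup>N v(w)\<close> with \<open>N\<close> even and \<open>v(0) \<noteq> 0\<close> unless it vanishes. For small real \<open>r\<close>
  the integral would then have a nonzero real part after division by \<open>v(0)\<close>.
\<close>

lemma holomorphic_even_part_zero: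
  fixes q :: "complex \<Rightarrow> complex"
  assumes e: "e > 0" and q: "q holomorphic_on ball 0 e" and \<rho>: "\<rho> > 0"
    and int: "\<And>r. r \<noteq> 0 \<Longrightarrow> norm r < \<rho> \<Longrightarrow>
      ((\<lambda>s. of_real ((sin (2 * pi * s))\<^sup>2) * q (r * of_real (cos (2 * pi * s)))) has_integral 0) {0..1}"
  shows "\<exists>d>0. d \<le> e \<and> (\<forall>w\<in>ball 0 d. q w + q (- w) = 0)"
proof -
  define E where "E w = q w + q (- w)" for w
  have "(q \<circ> uminus) holomorphic_on ball 0 e"
    by (rule holomorphic_on_compose_gen[OF _ q]) (auto intro!: holomorphic_intros)
  then have E: "E holomorphic_on ball 0 e"
    unfolding E_def by (intro holomorphic_intros q) (simp add: o_def)
  show ?thesis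
  proof (cases "\<forall>w\<in>ball 0 e. E w = 0")
    case True
    then show ?thesis using e by (auto simp: E_def)
  next
    case False
    have "\<exists>N v d. d > 0 \<and> d \<le> e \<and> v holomorphic_on ball 0 d \<and>
       (\<forall>w\<in>ball 0 d. E w = w ^ N * v w) \<and> v 0 \<noteq> 0"
    proof (cases "E 0 = 0")
      case True
      have nc: "\<not> E constant_on ball 0 e"
        using False True e unfolding constant_on_def by (metis centre_in_ball)
      have z: "0 \<in> ball (0::complex) e" using e by simp
      show ?thesis
      proof (rule holomorphic_factor_zero_nonconstant[OF E open_ball connected_ball z True nc])
        fix g r and n :: nat
        assume *: "0 < r" "ball 0 r \<subseteq> ball 0 e" "g holomorphic_on ball 0 r"
          "\<And>w. w \<in> ball 0 r \<Longrightarrow> E w = (w - 0)^n * g w" "\<And>w. w \<in> ball 0 r \<Longrightarrow> g w \<noteq> 0"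
        show ?thesis
          using * e by (intro exI[of _ n] exI[of _ g] exI[of _ "min r e"])
            (auto intro: holomorphic_on_subset)
      qed
    next
      case False
      then show ?thesis using E e by (intro exI[of _ 0] exI[of _ E] exI[of _ e]) auto
    qed
    then obtain N v d where d: "d > 0" "d \<le> e" and v: "v holomorphic_on ball 0 d" "v 0 \<noteq> 0"
      and Ev: "\<And>w. w \<in> ball 0 d \<Longrightarrow> E w = w ^ N * v w" by metis
    have contv: "continuous_on (ball 0 d) v" using v(1) by (rule holomorphic_on_imp_continuous_on)
    then have cv: "(v \<longlongrightarrow> v 0) (at 0)"
      using d(1) by (metis centre_in_ball continuous_on_def at_within_open open_ball)
    \<comment> \<open>\<open>E\<close> is even by construction. An odd \<open>N\<close> would force
      \<open>v (- w) = - v w\<close> and in the limit \<open>v 0 = 0\<close>.\<close>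
    have "even N"
    proof (rule ccontr)
      assume "odd N"
      have "((\<lambda>w. v (- w)) \<longlongrightarrow> v 0) (at 0)"
        using filterlim_compose[OF cv, of uminus "at 0"] by (simp add: filterlim_at tendsto_minus_cancel_left[symmetric] eventually_at_filter)
      then have "((\<lambda>w. v w + v (- w)) \<longlongrightarrow> v 0 + v 0) (at 0)" by (intro tendsto_add cv)
      moreover have "\<forall>\<^sub>F w in at 0. v w + v (- w) = 0"
        unfolding eventually_at_topological
      proof (intro exI[of _ "ball 0 d"] conjI ballI impI)
        fix w :: complex assume w: "w \<in> ball 0 d" "w \<noteq> 0"
        have "w ^ N * v w = (- w) ^ N * v (- w)"
          using Ev[of w] Ev[of "- w"] w by (simp add: E_def add.commute)
        then have "w ^ N * (v w + v (- w)) = 0" using \<open>odd N\<close> by (simp add: algebra_simps)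
        then show "v w + v (- w) = 0" using w by simp
      qed (use d in auto)
      ultimately have "((\<lambda>w. 0) \<longlongrightarrow> v 0 + v 0) (at (0::complex))" by (rule Lim_transform_eventually)
      then have "v 0 + v 0 = 0" by (metis tendsto_const_iff at_neq_bot)
      then show False using v(2) by simp
    qed
    have "((\<lambda>w. Re (v w / v 0)) \<longlongrightarrow> Re (v 0 / v 0)) (at 0)"
      using v(2) by (intro tendsto_intros cv)
    then have "\<forall>\<^sub>F w in at 0. Re (v w / v 0) > 0" using v(2) by (intro order_tendstoD) auto
    then obtain d1 where d1: "d1 > 0" "\<And>w. w \<noteq> 0 \<Longrightarrow> dist w 0 < d1 \<Longrightarrow> Re (v w / v 0) > 0"
      unfolding eventually_at by auto
    have pos: "Re (v w / v 0) > 0" if "norm w < d1" for w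
      using d1(2)[of w] that v(2) by (cases "w = 0") auto
    define r where "r = Min {\<rho>, d, d1} / 2"
    have r: "r > 0" "r < \<rho>" "r < d" "r < d1" using \<rho> d(1) d1(1) by (auto simp: r_def)
    define c where "c s = cos (2 * pi * s)" for s
    define z where "z s = complex_of_real r * of_real (c s)" for s
    have zn: "norm (z s) \<le> r" for s
      using r(1) by (simp add: z_def norm_mult c_def mult_left_le)
    \<comment> \<open>The hypothesis for \<open>r\<close> and for \<open>- r\<close> gives the two
      halves of \<open>E\<close>.\<close>
    have "((\<lambda>s. of_real ((sin (2 * pi * s))\<^sup>2) * q (z s)) has_integral 0) {0..1}"
      "((\<lambda>s. of_real ((sin (2 * pi * s))\<^sup>2) * q (- z s)) has_integral 0) {0..1}"
      using int[of "of_real r"] int[of "- of_real r"] r by (auto simp: z_def c_def)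
    from has_integral_add[OF this]
    have "((\<lambda>s. of_real ((sin (2 * pi * s))\<^sup>2) * E (z s)) has_integral 0) {0..1}"
      by (simp add: E_def distrib_left)
    then have "((\<lambda>s. Re (of_real ((sin (2 * pi * s))\<^sup>2) * E (z s) * (1 / v 0))) has_integral Re (0 * (1 / v 0))) {0..1}"
      by (intro has_integral_Re has_integral_mult_left)
    moreover have "Re (of_real ((sin (2 * pi * s))\<^sup>2) * E (z s) * (1 / v 0))
        = (sin (2 * pi * s))\<^sup>2 * (r * c s) ^ N * Re (v (z s) / v 0)" for s
    proof -
      have "E (z s) = z s ^ N * v (z s)" using zn[of s] r by (intro Ev) auto
      then have "of_real ((sin (2 * pi * s))\<^sup>2) * E (z s) * (1 / v 0)
        = of_real ((sin (2 * pi * s))\<^sup>2 * (r * c s) ^ N) * (v (z s) / v 0)"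
        by (simp add: z_def)
      moreover have "Re (of_real a * b) = a * Re b" for a b by simp
      ultimately show ?thesis by (simp only:)
    qed
    ultimately have I: "((\<lambda>s. (sin (2 * pi * s))\<^sup>2 * (r * c s) ^ N * Re (v (z s) / v 0)) has_integral 0) {0..1}"
      by simp
    have "z s \<in> ball 0 d" for s using zn[of s] r by simp
    then have "z ` {0..1} \<subseteq> ball 0 d" by blast
    moreover have "continuous_on {0..1} z" unfolding z_def c_def by (intro continuous_intros)
    ultimately have "continuous_on {0..1} (\<lambda>s. v (z s))" by (intro continuous_on_compose2[OF contv])
    then have cont: "continuous_on {0..1} (\<lambda>s. (sin (2 * pi * s))\<^sup>2 * (r * c s) ^ N * Re (v (z s) / v 0))"
      unfolding c_def by (intro continuous_intros) (use v(2) in auto)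
    \<comment> \<open>A continuous nonnegative integrand with integral zero vanishes everywhere. At
      45 degrees, however, sine and cosine are both nonzero.\<close>
    have "(sin (2 * pi * (1/8)))\<^sup>2 * (r * c (1/8)) ^ N * Re (v (z (1/8)) / v 0) = 0"
    proof -
      have "integral {0..1} (\<lambda>s. (sin (2 * pi * s))\<^sup>2 * (r * c s) ^ N * Re (v (z s) / v 0)) = 0"
        using I by (rule integral_unique)
      moreover have "0 \<le> (sin (2 * pi * s))\<^sup>2 * (r * c s) ^ N * Re (v (z s) / v 0)" for s
        using pos[of "z s"] zn[of s] r \<open>even N\<close> by (intro mult_nonneg_nonneg) auto
      ultimately have "\<forall>s\<in>{0..1}. (sin (2 * pi * s))\<^sup>2 * (r * c s) ^ N * Re (v (z s) / v 0) = 0"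
        using integral_eq_0_iff[OF cont zero_less_one] by blast
      then show ?thesis by (rule bspec) simp
    qed
    moreover have "sin (2 * pi * (1/8)) \<noteq> 0" "c (1/8) \<noteq> 0"
      using sin_45 cos_45 by (auto simp: c_def)
    moreover have "Re (v (z (1/8)) / v 0) > 0" using pos zn[of "1/8"] r by auto
    ultimately show ?thesis using r(1) by simp
  qed
qed

text \<open>For \<open>\<sigma> = 1\<close> or \<open>\<sigma> = - 1\<close> this is
  \<open>exp (\<sigma> \<i> \<theta>)\<close> with \<open>\<theta> = 2 pi s\<close>; the sign is the
  orientation.\<close>

definition unit_loop :: "complex \<Rightarrow> real \<Rightarrow> complex" where
  "unit_loop \<sigma> s = of_real (cos (2 * pi * s)) + \<sigma> * \<i> * of_real (sin (2 * pi * s))"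

lemma norm_unit_loop: "\<sigma> = 1 \<or> \<sigma> = - 1 \<Longrightarrow> norm (unit_loop \<sigma> s) = 1"
  by (auto simp: unit_loop_def cmod_def)

lemma unit_loop_inverse: "\<sigma> = 1 \<or> \<sigma> = - 1 \<Longrightarrow> unit_loop \<sigma> s * unit_loop (- \<sigma>) s = 1"
  by (auto simp: unit_loop_def algebra_simps of_real_mult[symmetric] simp del: of_real_mult)
    (metis (no_types, lifting) of_real_1 of_real_add power2_eq_square sin_cos_squared_add3 add.commute)+

text \<open>A straight segment from \<open>\<alpha>\<close> to \<open>\<mu>\<close> could pass
  through 0. The segment between the logarithms is used instead: its exponential has modulus moving
  monotonically from \<open>norm \<alpha>\<close> to 1, so the loop stays in the annulus.\<close>

lemma homotopic_loops_annulus_scale: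
  assumes \<sigma>: "\<sigma> = 1 \<or> \<sigma> = - 1" and r: "r \<noteq> (0::complex)" and \<alpha>: "\<alpha> \<noteq> 0" and \<mu>: "norm \<mu> = 1"
    and k: "k \<le> 1" "k \<le> norm \<alpha>" and K: "K \<ge> 1" "K \<ge> norm \<alpha>"
  shows "homotopic_loops {w. k * norm r \<le> norm w \<and> norm w \<le> K * norm r}
     (\<lambda>s. r * \<alpha> * unit_loop \<sigma> s) (\<lambda>s. r * \<mu> * unit_loop \<sigma> s)"
proof -
  define m where "m \<tau> = exp (of_real (1 - \<tau>) * Ln \<alpha> + of_real \<tau> * Ln \<mu>)" for \<tau> :: real
  have \<mu>0: "\<mu> \<noteq> 0" using \<mu> by auto
  have nm: "norm (m \<tau>) = exp ((1 - \<tau>) * ln (norm \<alpha>))" for \<tau>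
    using \<mu> \<mu>0 \<alpha> by (simp add: m_def norm_exp_eq_Re)
  have bounds: "k \<le> norm (m \<tau>) \<and> norm (m \<tau>) \<le> K" if \<tau>: "\<tau> \<in> {0..1}" for \<tau>
  proof (cases "norm \<alpha> \<ge> 1")
    case True
    then have "ln (norm \<alpha>) \<ge> 0" by simp
    then have "0 \<le> (1 - \<tau>) * ln (norm \<alpha>)" "(1 - \<tau>) * ln (norm \<alpha>) \<le> ln (norm \<alpha>)"
      using \<tau> by (auto intro!: mult_left_le_one_le)
    then have "1 \<le> norm (m \<tau>)" "norm (m \<tau>) \<le> exp (ln (norm \<alpha>))" unfolding nm by simp_all
    then show ?thesis using \<alpha> k K by simp
  next
    case False
    then have "ln (norm \<alpha>) \<le> 0" using \<alpha> by simp
    then have "(1 - \<tau>) * ln (norm \<alpha>) \<le> 0" "ln (norm \<alpha>) \<le> (1 - \<tau>) * ln (norm \<alpha>)"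
      using \<tau> mult_nonneg_nonpos[of "1 - \<tau>" "ln (norm \<alpha>)"] mult_nonneg_nonpos[of \<tau> "ln (norm \<alpha>)"]
      by (auto simp: left_diff_distrib)
    then have "norm (m \<tau>) \<le> 1" "exp (ln (norm \<alpha>)) \<le> norm (m \<tau>)" unfolding nm by simp_all
    then show ?thesis using \<alpha> k K by simp
  qed
  show ?thesis
    unfolding homotopic_loops
  proof (intro exI[of _ "\<lambda>(\<tau>, s). r * m \<tau> * unit_loop \<sigma> s"] conjI ballI)
    show "continuous_on ({0..1} \<times> {0..1}) (\<lambda>(\<tau>, s). r * m \<tau> * unit_loop \<sigma> s)"
      unfolding m_def unit_loop_def case_prod_unfold by (intro continuous_intros)
    show "(\<lambda>(\<tau>, s). r * m \<tau> * unit_loop \<sigma> s) \<in> {0..1} \<times> {0..1} \<rightarrow> {w. k * norm r \<le> norm w \<and> norm w \<le> K * norm r}"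
      using bounds by (auto simp: norm_mult norm_unit_loop[OF \<sigma>] mult.commute[of "norm r"] intro!: mult_right_mono)
  qed (use \<alpha> \<mu>0 in \<open>auto simp: m_def pathfinish_def pathstart_def unit_loop_def\<close>)
qed

definition circle_pair :: "complex \<Rightarrow> real \<Rightarrow> complex \<times> complex" where
  "circle_pair r s = (r * of_real (cos (2 * pi * s)), r * of_real (sin (2 * pi * s)))"

lemma norm_circle_pair: "norm (circle_pair r s) = norm r"
  by (simp add: circle_pair_def norm_Pair norm_mult power_mult_distrib distrib_left[symmetric])

lemma has_vector_derivative_circle_pair:
  "(circle_pair r has_vector_derivative
     (r * of_real (- sin (2 * pi * s) * (2 * pi)), r * of_real (cos (2 * pi * s) * (2 * pi)))) (at s within S)"
proof -
  have c: "((\<lambda>s. cos (2 * pi * s)) has_real_derivative - sin (2 * pi * s) * (2 * pi)) (at s within S)"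
    by (rule has_field_derivative_at_within, rule DERIV_fun_cos, rule DERIV_cmult_Id)
  have d: "((\<lambda>s. sin (2 * pi * s)) has_real_derivative cos (2 * pi * s) * (2 * pi)) (at s within S)"
    by (rule has_field_derivative_at_within, rule DERIV_fun_sin, rule DERIV_cmult_Id)
  show ?thesis unfolding circle_pair_def
    by (intro has_vector_derivative_Pair has_vector_derivative_mult_right has_vector_derivative_of_real c d)
qed

lemma continuous_on_circle_pair: "continuous_on S (circle_pair r)"
  unfolding circle_pair_def by (intro continuous_intros)

section \<open>Loops in a Morse chart\<close>

locale morse_chart =
  fixes f :: "complex poly" and x0 :: complex and V W :: "(complex \<times> complex) set"
    and \<psi> \<phi> :: "complex \<times> complex \<Rightarrow> complex \<times> complex"
  assumes coords: "morse_coordinates [:f, 0, 1:] (x0, 0) V W \<psi> \<phi>"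
begin

lemma zero_in_W: "(0, 0) \<in> W" and \<phi>_zero: "\<phi> (0, 0) = (x0, 0)" and open_W: "open W"
  and continuous_\<phi>: "continuous_on W \<phi>"
  using coords unfolding morse_coordinates_def homeomorphism_def by (metis imageI)+

lemma level_\<phi>:
  assumes "v \<in> W"
  shows "(snd (\<phi> v))\<^sup>2 + poly f (fst (\<phi> v)) = poly f x0 + (fst v)\<^sup>2 + (snd v)\<^sup>2"
proof -
  have "\<phi> v \<in> V" "\<psi> (\<phi> v) = v"
    using coords assms unfolding morse_coordinates_def homeomorphism_def by auto
  then have "eval2 [:f, 0, 1:] (\<phi> v) = eval2 [:f, 0, 1:] (x0, 0) + (fst v)\<^sup>2 + (snd v)\<^sup>2"
    using coords unfolding morse_coordinates_def by metis
  then show ?thesis by (simp add: power2_eq_square algebra_simps)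
qed

lemma loop_near:
  assumes "open N" "(x0, 0) \<in> N"
  obtains \<rho> where "\<rho> > 0" "\<And>v. norm v < \<rho> \<Longrightarrow> v \<in> W" "\<And>v. norm v < \<rho> \<Longrightarrow> \<phi> v \<in> N"
proof -
  have "open (\<phi> -` N \<inter> W)"
    using continuous_\<phi> open_W assms(1) by (simp add: continuous_on_open_vimage)
  moreover have "(0, 0) \<in> \<phi> -` N \<inter> W" using \<phi>_zero zero_in_W assms(2) by simp
  ultimately obtain \<rho> where "\<rho> > 0" "ball (0, 0) \<rho> \<subseteq> \<phi> -` N \<inter> W" by (meson openE)
  then show thesis using that[of \<rho>] by (auto simp: zero_prod_def[symmetric] subset_iff)
qed

lemma loop_differentiable:
  assumes "\<And>s. circle_pair r s \<in> W"
  shows "differentiable_path (\<lambda>s. \<phi> (circle_pair r s))"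
  unfolding differentiable_path_def
proof
  fix s :: real
  obtain \<phi>' where "(\<phi> has_derivative \<phi>') (at (circle_pair r s))"
    using coords assms[of s] unfolding morse_coordinates_def holomorphic2_on_def by blast
  from has_derivative_compose[OF has_vector_derivative_circle_pair[unfolded has_vector_derivative_def] this]
  show "(\<lambda>s. \<phi> (circle_pair r s)) differentiable (at s within {0..1})"
    by (rule differentiableI)
qed

lemma loop_in_level:
  assumes "\<And>s. circle_pair r s \<in> W"
  shows "\<phi> (circle_pair r s) \<in> level f (poly f x0 + r\<^sup>2)"
proof -
  have "(fst (circle_pair r s))\<^sup>2 + (snd (circle_pair r s))\<^sup>2
      = r\<^sup>2 * of_real ((cos (2 * pi * s))\<^sup>2 + (sin (2 * pi * s))\<^sup>2)"
    by (simp add: circle_pair_def power_mult_distrib algebra_simps del: sin_cos_squared_add2)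
  also have "\<dots> = r\<^sup>2" by simp
  finally show ?thesis using level_\<phi>[OF assms[of s]]
    by (cases "\<phi> (circle_pair r s)") (simp add: add.assoc)
qed

text \<open>
  In the coordinate \<open>w = \<xi>(x) + \<i> y\<close> the level curve is an annulus, because \<open>\<xi>(x)\<^sup>2 + y\<^sup>2 = r\<^sup>2\<close> there and
  hence \<open>\<xi>(x) - \<i> y = r\<^sup>2 / w\<close>. To first order in \<open>r\<close> the vanishing cycle is
  \<open>r \<alpha> (cos \<theta> + \<sigma> \<i> sin \<theta>)\<close>, since the linear part of a Morse chart preserves \<open>X\<^sup>2 + Y\<^sup>2\<close>.
\<close>

lemma loop_homotopic_standard:
  assumes e: "e > 0" and N: "open N" "x0 \<in> N" and \<xi>: "\<xi> holomorphic_on N" "\<xi> x0 = 0"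
    "\<And>x. x \<in> N \<Longrightarrow> poly f x = poly f x0 + (\<xi> x)\<^sup>2"
    and X: "X holomorphic_on ball 0 e" "\<And>w. w \<in> ball 0 e \<Longrightarrow> X w \<in> N" "\<And>w. w \<in> ball 0 e \<Longrightarrow> \<xi> (X w) = w"
    "\<And>x. x \<in> N \<Longrightarrow> X (\<xi> x) = x"
  obtains \<rho> \<sigma> where "\<rho> > 0" "\<sigma> = 1 \<or> \<sigma> = - 1"
    "\<And>r \<mu>. r \<noteq> 0 \<Longrightarrow> norm r < \<rho> \<Longrightarrow> \<mu> = 1 \<or> \<mu> = - 1 \<Longrightarrow>
       homotopic_loops (level f (poly f x0 + r\<^sup>2)) (\<lambda>s. \<phi> (circle_pair r s))
         (\<lambda>s. (X (r * \<mu> * of_real (cos (2 * pi * s))), \<sigma> * r * \<mu> * of_real (sin (2 * pi * s))))"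
proof -
  obtain a b c d where d\<phi>: "(\<phi> has_derivative (\<lambda>(u, v). (a * u + b * v, c * u + d * v))) (at (0, 0))"
    using coords zero_in_W unfolding morse_coordinates_def holomorphic2_on_def by blast
  have "open (N \<times> (UNIV :: complex set))" using N by (simp add: open_Times)
  then obtain \<rho>0 where \<rho>0: "\<rho>0 > 0" "\<And>v. norm v < \<rho>0 \<Longrightarrow> v \<in> W" "\<And>v. norm v < \<rho>0 \<Longrightarrow> fst (\<phi> v) \<in> N"
    using loop_near[of "N \<times> UNIV"] N(2) by (metis UNIV_I mem_Sigma_iff mem_Times_iff)
  \<comment> \<open>For \<open>\<eta> = 1\<close> and \<open>\<eta> = - 1\<close> these are
    \<open>\<xi> + \<i> y\<close> and \<open>\<xi> - \<i> y\<close> in the chart; \<open>A\<close>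
    and \<open>B\<close> are the coefficients of their linear parts.\<close>
  define \<Omega> where "\<Omega> \<eta> v = \<xi> (fst (\<phi> v)) + \<eta> * \<i> * snd (\<phi> v)" for \<eta> v
  define A where "A \<eta> = deriv \<xi> x0 * a + \<eta> * \<i> * c" for \<eta>
  define B where "B \<eta> = deriv \<xi> x0 * b + \<eta> * \<i> * d" for \<eta>
  have prod: "\<Omega> 1 v * \<Omega> (- 1) v = (fst v)\<^sup>2 + (snd v)\<^sup>2" if "norm v < \<rho>0" for v
  proof -
    have "\<Omega> 1 v * \<Omega> (- 1) v = (\<xi> (fst (\<phi> v)))\<^sup>2 + (snd (\<phi> v))\<^sup>2"
      by (simp add: \<Omega>_def power2_eq_square algebra_simps)
    then show ?thesis using level_\<phi>[OF \<rho>0(2)[OF that]] \<xi>(3)[OF \<rho>0(3)[OF that]] by (simp add: algebra_simps)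
  qed
  have d\<Omega>: "(\<Omega> \<eta> has_derivative (\<lambda>v. A \<eta> * fst v + B \<eta> * snd v)) (at (0, 0))" for \<eta>
  proof -
    have "(\<xi> has_field_derivative deriv \<xi> x0) (at x0)" by (rule holomorphic_derivI[OF \<xi>(1) N])
    then have 1: "(\<xi> has_derivative (*) (deriv \<xi> x0)) (at (fst (\<phi> (0, 0))))"
      by (simp add: \<phi>_zero has_field_derivative_def)
    show ?thesis unfolding \<Omega>_def
      by (rule has_derivative_eq_rhs[OF has_derivative_add[OF has_derivative_compose[OF has_derivative_fst[OF d\<phi>] 1]
            has_derivative_mult_right[OF has_derivative_snd[OF d\<phi>]]]])
        (auto simp: A_def B_def fun_eq_iff algebra_simps)
  qed
  have \<Omega>0: "\<Omega> \<eta> (0, 0) = 0" for \<eta> by (simp add: \<Omega>_def \<phi>_zero \<xi>(2))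
  \<comment> \<open>The quadratic part of \<open>prod\<close>: evaluate at
    \<open>(h u, h v)\<close>, divide by \<open>h\<^sup>2\<close> and let \<open>h\<close> tend to
    0.\<close>
  have quad: "(A 1 * u + B 1 * v) * (A (- 1) * u + B (- 1) * v) = u\<^sup>2 + v\<^sup>2" for u v
  proof -
    have lim: "((\<lambda>h. \<Omega> \<eta> (h * u, h * v) / h) \<longlongrightarrow> A \<eta> * u + B \<eta> * v) (at 0)" for \<eta>
    proof -
      have "((\<lambda>h. (h * u, h * v)) has_derivative (\<lambda>h. (h * u, h * v))) (at 0)"
        by (intro has_derivative_Pair has_derivative_mult_left has_derivative_ident)
      from has_derivative_compose[OF this, of "\<Omega> \<eta>" "\<lambda>v. A \<eta> * fst v + B \<eta> * snd v"] d\<Omega>[of \<eta>]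
      have "((\<lambda>h. \<Omega> \<eta> (h * u, h * v)) has_derivative (\<lambda>h. A \<eta> * (h * u) + B \<eta> * (h * v))) (at 0)" by simp
      then have "((\<lambda>h. \<Omega> \<eta> (h * u, h * v)) has_field_derivative (A \<eta> * u + B \<eta> * v)) (at 0)"
        unfolding has_field_derivative_def by (rule has_derivative_eq_rhs) (simp add: fun_eq_iff algebra_simps)
      then show ?thesis by (simp add: has_field_derivative_iff \<Omega>0)
    qed
    have "((\<lambda>h. (\<Omega> 1 (h * u, h * v) / h) * (\<Omega> (- 1) (h * u, h * v) / h)) \<longlongrightarrow> (A 1 * u + B 1 * v) * (A (- 1) * u + B (- 1) * v)) (at 0)"
      by (intro tendsto_mult lim)
    moreover have "\<forall>\<^sub>F h in at 0. (\<Omega> 1 (h * u, h * v) / h) * (\<Omega> (- 1) (h * u, h * v) / h) = u\<^sup>2 + v\<^sup>2"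
    proof -
      have "((\<lambda>h. norm (h * u, h * v)) \<longlongrightarrow> norm (0 * u, 0 * v)) (at (0::complex))" by (intro tendsto_intros)
      then have "\<forall>\<^sub>F h in at 0. norm (h * u, h * v) < \<rho>0"
        by (rule order_tendstoD) (use \<rho>0(1) in \<open>simp add: zero_prod_def[symmetric]\<close>)
      moreover have "\<forall>\<^sub>F h in at (0::complex). h \<noteq> 0" by (simp add: eventually_at_filter)
      ultimately show ?thesis
      proof eventually_elim
        case (elim h)
        have "(\<Omega> 1 (h * u, h * v) / h) * (\<Omega> (- 1) (h * u, h * v) / h) = ((h * u)\<^sup>2 + (h * v)\<^sup>2) / h\<^sup>2"
          using prod[OF elim(1)] by (simp add: power2_eq_square)
        also have "\<dots> = u\<^sup>2 + v\<^sup>2" using elim(2) by (simp add: power_mult_distrib field_simps)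
        finally show ?case .
      qed
    qed
    ultimately have "((\<lambda>h::complex. u\<^sup>2 + v\<^sup>2) \<longlongrightarrow> (A 1 * u + B 1 * v) * (A (- 1) * u + B (- 1) * v)) (at 0)"
      by (rule Lim_transform_eventually)
    then show ?thesis by (metis tendsto_const_iff at_neq_bot)
  qed
  have AB: "A 1 * A (- 1) = 1" "B 1 * B (- 1) = 1" "A 1 * B (- 1) + B 1 * A (- 1) = 0"
    using quad[of 1 0] quad[of 0 1] quad[of 1 1] by (auto simp: algebra_simps)
  define \<alpha> where "\<alpha> = A 1"
  have \<alpha>: "\<alpha> \<noteq> 0" using AB(1) by (auto simp: \<alpha>_def)
  have "(B 1)\<^sup>2 + \<alpha>\<^sup>2 = 0" unfolding \<alpha>_def using AB by algebra
  then have "(B 1 - \<i> * \<alpha>) * (B 1 + \<i> * \<alpha>) = 0" by (simp add: power2_eq_square algebra_simps)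
  \<comment> \<open>The two linear parts multiply to
    \<open>u\<^sup>2 + v\<^sup>2 = (u + \<i> v) (u - \<i> v)\<close>, so the first is a multiple of
    one factor; \<open>\<sigma>\<close> tells which.\<close>
  then obtain \<sigma> :: complex where \<sigma>: "\<sigma> = 1 \<or> \<sigma> = - 1" "B 1 = \<sigma> * \<i> * \<alpha>"
    by (metis add.inverse_inverse add_eq_0_iff2 eq_iff_diff_eq_0 minus_mult_left mult_1 mult_eq_0_iff)
  \<comment> \<open>The linear approximation error is at most half of
    \<open>norm \<alpha> * norm r\<close>, so all moduli met lie between
    \<open>norm \<alpha> / 2\<close> and \<open>3 * norm \<alpha> / 2\<close> times
    \<open>norm r\<close>; the 1 admits the target loop of modulus \<open>norm r\<close>.\<close>
  define k where "k = min (norm \<alpha> / 2) 1"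
  define K where "K = max (3 * norm \<alpha> / 2) 1"
  have kK: "k > 0" "k \<le> 1" "k \<le> norm \<alpha>" "K \<ge> 1" "K \<ge> norm \<alpha>" using \<alpha>
    by (auto simp: k_def K_def min_le_iff_disj le_max_iff_disj)
  obtain \<rho>1 where \<rho>1: "\<rho>1 > 0" "\<And>v. norm v < \<rho>1 \<Longrightarrow> norm (\<Omega> 1 v - (\<alpha> * fst v + B 1 * snd v)) \<le> norm \<alpha> / 2 * norm v"
  proof -
    have "\<exists>d>0. \<forall>y. norm (y - (0, 0)) < d \<longrightarrow>
        norm (\<Omega> 1 y - \<Omega> 1 (0, 0) - (A 1 * fst (y - (0, 0)) + B 1 * snd (y - (0, 0)))) \<le> norm \<alpha> / 2 * norm (y - (0, 0))"
      using d\<Omega>[of 1] \<alpha> unfolding has_derivative_at_alt by (meson half_gt_zero zero_less_norm_iff)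
    then show thesis using that unfolding \<Omega>0 by (auto simp: zero_prod_def[symmetric] \<alpha>_def)
  qed
  \<comment> \<open>On the annulus \<open>z + r\<^sup>2 / z\<close> has modulus at most
    \<open>norm r * (K + 1 / k)\<close>; the last bound keeps half of it in the domain of
    \<open>X\<close>.\<close>
  define \<rho> where "\<rho> = Min {\<rho>0, \<rho>1, e / (K + 1 / k)}"
  have Kk: "K + 1 / k > 0" using kK by (intro add_pos_pos) auto
  have \<rho>: "\<rho> > 0" using \<rho>0(1) \<rho>1(1) e Kk by (auto simp: \<rho>_def)
  show thesis
  proof (rule that[OF \<rho> \<sigma>(1)])
    fix r \<mu> :: complex assume r: "r \<noteq> 0" "norm r < \<rho>" and \<mu>: "\<mu> = 1 \<or> \<mu> = - 1"
    have r': "norm r < \<rho>0" "norm r < \<rho>1" "norm r * (K + 1 / k) < e"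
      using r(2) Kk by (auto simp: \<rho>_def field_simps)
    define An :: "complex set" where "An = {w. k * norm r \<le> norm w \<and> norm w \<le> K * norm r}"
    define w where "w s = \<Omega> 1 (circle_pair r s)" for s
    have near: "norm (w s - r * \<alpha> * unit_loop \<sigma> s) \<le> norm \<alpha> / 2 * norm r" for s
      using \<rho>1(2)[of "circle_pair r s"] r'
      by (simp add: w_def norm_circle_pair) (simp add: circle_pair_def unit_loop_def \<sigma>(2) algebra_simps)
    have An1: "z \<in> An" if "norm (z - r * \<alpha> * unit_loop \<sigma> s) \<le> norm \<alpha> / 2 * norm r" for z s
    proof -
      have n: "norm (r * \<alpha> * unit_loop \<sigma> s) = norm \<alpha> * norm r"
        by (simp add: norm_mult norm_unit_loop[OF \<sigma>(1)])
      have "norm z \<le> 3 * norm \<alpha> / 2 * norm r"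
        using norm_triangle_sub[of z "r * \<alpha> * unit_loop \<sigma> s"] that unfolding n by simp
      moreover have "norm \<alpha> / 2 * norm r \<le> norm z"
        using norm_triangle_sub[of "r * \<alpha> * unit_loop \<sigma> s" z] that unfolding n by (simp add: norm_minus_commute)
      moreover have "k * norm r \<le> norm \<alpha> / 2 * norm r" "3 * norm \<alpha> / 2 * norm r \<le> K * norm r"
        by (intro mult_right_mono; simp add: k_def K_def)+
      ultimately show ?thesis by (auto simp: An_def)
    qed
    have inW: "circle_pair r s \<in> W" "fst (\<phi> (circle_pair r s)) \<in> N" for s
      using \<rho>0(2,3)[of "circle_pair r s"] r' by (simp_all add: norm_circle_pair)
    have contw: "continuous_on S w" for S
    proof -
      have "continuous_on UNIV (\<lambda>s. \<phi> (circle_pair r s))"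
        by (rule continuous_on_compose2[OF continuous_\<phi> continuous_on_circle_pair])
          (use inW in auto)
      then have c: "continuous_on UNIV (\<lambda>s. fst (\<phi> (circle_pair r s)))" "continuous_on UNIV (\<lambda>s. snd (\<phi> (circle_pair r s)))"
        by (auto intro: continuous_intros)
      have "continuous_on UNIV (\<lambda>s. \<xi> (fst (\<phi> (circle_pair r s))))"
        by (rule continuous_on_compose2[OF holomorphic_on_imp_continuous_on[OF \<xi>(1)] c(1)])
          (use inW in auto)
      then have "continuous_on UNIV w" unfolding w_def \<Omega>_def by (intro continuous_intros c)
      then show ?thesis by (rule continuous_on_subset) simp
    qed
    have ends: "circle_pair r 1 = circle_pair r 0" "unit_loop \<sigma> 1 = unit_loop \<sigma> 0"
      by (simp_all add: circle_pair_def unit_loop_def)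
    have h1: "homotopic_loops An w (\<lambda>s. r * \<alpha> * unit_loop \<sigma> s)"
    proof (rule homotopic_loops_linear)
      show "path w" by (simp add: path_def contw)
      show "path (\<lambda>s. r * \<alpha> * unit_loop \<sigma> s)" unfolding path_def unit_loop_def by (intro continuous_intros)
      show "closed_segment (w s) (r * \<alpha> * unit_loop \<sigma> s) \<subseteq> An" for s
      proof
        fix z assume "z \<in> closed_segment (w s) (r * \<alpha> * unit_loop \<sigma> s)"
        then have "norm (z - r * \<alpha> * unit_loop \<sigma> s) \<le> norm (w s - r * \<alpha> * unit_loop \<sigma> s)"
          by (metis segment_bound(2) closed_segment_commute norm_minus_commute segment_bound(1))
        then show "z \<in> An" using near[of s] by (intro An1[of _ s]) simp
      qed
    qed (simp_all add: pathstart_def pathfinish_def w_def ends)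
    have h2: "homotopic_loops An (\<lambda>s. r * \<alpha> * unit_loop \<sigma> s) (\<lambda>s. r * \<mu> * unit_loop \<sigma> s)"
      unfolding An_def by (rule homotopic_loops_annulus_scale[OF \<sigma>(1) r(1) \<alpha> _ kK(2,3,4,5)]) (use \<mu> in auto)
    \<comment> \<open>The inverse of \<open>z = \<xi>(x) + \<i> y\<close> on the level curve: half
      the sum of \<open>z\<close> and \<open>r\<^sup>2 / z\<close> is \<open>\<xi>(x)\<close>, and
      their difference is \<open>2 \<i> y\<close>. It carries homotopies in the annulus to the
      curve.\<close>
    define C where "C z = (X ((z + r\<^sup>2 / z) / 2), (z - r\<^sup>2 / z) / (2 * \<i>))" for z
    have An0: "z \<noteq> 0" if "z \<in> An" for z using that kK r(1) by (auto simp: An_def mult_le_0_iff)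
    have Anb: "(z + r\<^sup>2 / z) / 2 \<in> ball 0 e" if z: "z \<in> An" for z
    proof -
      have "norm (r\<^sup>2 / z) \<le> (norm r)\<^sup>2 / (k * norm r)"
        unfolding norm_divide norm_power
        by (rule divide_left_mono) (use z kK r(1) An0[OF z] in \<open>auto simp: An_def\<close>)
      also have "\<dots> = norm r * (1 / k)" using r(1) kK by (simp add: power2_eq_square)
      finally have "norm (z + r\<^sup>2 / z) \<le> norm r * (K + 1 / k)"
        using z norm_triangle_ineq[of z "r\<^sup>2 / z"] by (simp add: An_def algebra_simps)
      then show ?thesis using r'(3) e by simp
    qed
    have Cl: "C z \<in> level f (poly f x0 + r\<^sup>2)" if z: "z \<in> An" for z
    proof -
      have "poly f (X ((z + r\<^sup>2 / z) / 2)) = poly f x0 + ((z + r\<^sup>2 / z) / 2)\<^sup>2"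
        using \<xi>(3)[OF X(2)[OF Anb[OF z]]] X(3)[OF Anb[OF z]] by simp
      moreover have "((z - r\<^sup>2 / z) / (2 * \<i>))\<^sup>2 + ((z + r\<^sup>2 / z) / 2)\<^sup>2 = r\<^sup>2"
      proof -
        have "(a / (2 * \<i>))\<^sup>2 = - (a\<^sup>2) / 4" for a by (simp add: power_divide power_mult_distrib)
        moreover have "- ((z - q)\<^sup>2) / 4 + ((z + q) / 2)\<^sup>2 = z * q" for q
          by (simp add: power_divide power2_sum power2_diff add_divide_distrib[symmetric])
        ultimately show ?thesis using An0[OF z] by simp
      qed
      ultimately show ?thesis by (simp add: C_def algebra_simps)
    qed
    have "continuous_on An C"
      unfolding C_def
    proof (intro continuous_intros)
      show "continuous_on An (\<lambda>z. X ((z + r\<^sup>2 / z) / 2))"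
        by (rule continuous_on_compose2[OF holomorphic_on_imp_continuous_on[OF X(1)]])
          (use Anb An0 in \<open>auto intro!: continuous_intros\<close>)
    qed (use An0 in auto)
    then have h3: "homotopic_loops (level f (poly f x0 + r\<^sup>2)) (C \<circ> w) (C \<circ> (\<lambda>s. r * \<mu> * unit_loop \<sigma> s))"
      using homotopic_loops_continuous_image[OF homotopic_loops_trans[OF h1 h2]] Cl by blast
    have Cw: "C (w s) = \<phi> (circle_pair r s)" for s
    proof -
      have wA: "w s \<in> An" using near by (rule An1)
      have n: "norm (circle_pair r s) < \<rho>0" using r' by (simp add: norm_circle_pair)
      have "w s * \<Omega> (- 1) (circle_pair r s) = r\<^sup>2 * of_real ((cos (2 * pi * s))\<^sup>2 + (sin (2 * pi * s))\<^sup>2)"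
        using prod[OF n] by (simp add: w_def circle_pair_def power_mult_distrib algebra_simps del: sin_cos_squared_add2)
      then have q: "r\<^sup>2 / w s = \<Omega> (- 1) (circle_pair r s)" using An0[OF wA] by (simp add: field_simps)
      show ?thesis
        unfolding C_def q using X(4)[OF \<rho>0(3)[OF n]] by (simp add: w_def \<Omega>_def prod_eq_iff)
    qed
    have Cs: "C (r * \<mu> * unit_loop \<sigma> s) = (X (r * \<mu> * of_real (cos (2 * pi * s))), \<sigma> * r * \<mu> * of_real (sin (2 * pi * s)))" for s
    proof -
      have u0: "unit_loop \<sigma> s \<noteq> 0" using unit_loop_inverse[OF \<sigma>(1), of s] by auto
      have "r * \<mu> * unit_loop \<sigma> s * (r * \<mu> * unit_loop (- \<sigma>) s) = r\<^sup>2"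
        using unit_loop_inverse[OF \<sigma>(1), of s] \<mu> by (auto simp: power2_eq_square mult_ac)
      moreover have "r * \<mu> * unit_loop \<sigma> s \<noteq> 0" using u0 r(1) \<mu> by auto
      ultimately have q: "r\<^sup>2 / (r * \<mu> * unit_loop \<sigma> s) = r * \<mu> * unit_loop (- \<sigma>) s" by (metis nonzero_mult_div_cancel_left)
      show ?thesis unfolding C_def q by (simp add: unit_loop_def algebra_simps)
    qed
    show "homotopic_loops (level f (poly f x0 + r\<^sup>2)) (\<lambda>s. \<phi> (circle_pair r s))
         (\<lambda>s. (X (r * \<mu> * of_real (cos (2 * pi * s))), \<sigma> * r * \<mu> * of_real (sin (2 * pi * s))))"
      using h3 by (simp add: o_def Cw Cs)
  qed
qed

end

section \<open>Algebras of polynomials closed under division\<close>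

abbreviation lift_const :: "complex poly \<Rightarrow> complex poly poly" where
  "lift_const S \<equiv> map_poly (\<lambda>c. [:c:]) S"

text \<open>In \<open>\<complex>[x][T]\<close> with outer indeterminate \<open>T\<close> this is \<open>S(T) - S(x)\<close>.\<close>

definition diff_poly :: "complex poly \<Rightarrow> complex poly poly" where
  "diff_poly S = lift_const S - [:S:]"

text \<open>Exchange of the two indeterminates: each coefficient in \<open>x\<close> becomes a
  polynomial in \<open>T\<close>.\<close>

lemma coeff_poly_const:
  fixes M :: "complex poly poly"
  shows "coeff (poly M [:\<tau>:]) k = poly (map_poly (\<lambda>a. coeff a k) M) \<tau>"
  by (induction M) (auto simp: map_poly_pCons)

lemma poly_lift_const: "poly (lift_const S) [:\<tau>:] = [:poly S \<tau>:]"
  by (induction S) (auto simp: map_poly_pCons)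

lemma lift_const_of_degree_0:
  assumes "\<And>i. degree (coeff m i) = 0"
  shows "m = lift_const (map_poly (\<lambda>a. coeff a 0) m)"
  by (rule poly_eqI) (simp add: coeff_map_poly degree_0_id[OF assms])

lemma poly_lift_const_X: "poly (lift_const S) [:0, 1:] = S"
  by (induction S) (auto simp: map_poly_pCons)

lemma poly_diff_poly_self: "poly (diff_poly S) [:0, 1:] = 0"
  by (simp add: diff_poly_def poly_lift_const_X)

lemma map_poly_eval_mult:
  fixes p q :: "complex poly poly"
  shows "map_poly (\<lambda>a. poly a \<alpha>) (p * q) = map_poly (\<lambda>a. poly a \<alpha>) p * map_poly (\<lambda>a. poly a \<alpha>) q"
  by (rule poly_eqI) (simp add: coeff_map_poly coeff_mult poly_sum)

lemma map_poly_eval_diff_poly: "map_poly (\<lambda>a. poly a \<alpha>) (diff_poly S) = S - [:poly S \<alpha>:]"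
  by (rule poly_eqI) (simp add: diff_poly_def coeff_map_poly coeff_pCons split: nat.split)

text \<open>The last axiom says that \<open>A\<close> is the intersection of its fraction field with
  \<open>\<complex>[x]\<close>; it lets all arguments stay within polynomials.\<close>

locale division_closed_subalgebra =
  fixes A :: "complex poly set"
  assumes const_closed: "[:c:] \<in> A"
    and add_closed: "a \<in> A \<Longrightarrow> b \<in> A \<Longrightarrow> a + b \<in> A"
    and mult_closed: "a \<in> A \<Longrightarrow> b \<in> A \<Longrightarrow> a * b \<in> A"
    and division_closed: "a * b \<in> A \<Longrightarrow> a \<in> A \<Longrightarrow> a \<noteq> 0 \<Longrightarrow> b \<in> A"
begin

definition over :: "complex poly poly \<Rightarrow> bool" where
  "over M \<longleftrightarrow> (\<forall>i. coeff M i \<in> A)"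

lemma zero_closed: "0 \<in> A" using const_closed[of 0] by simp
lemma diff_closed: "a \<in> A \<Longrightarrow> b \<in> A \<Longrightarrow> a - b \<in> A"
  using add_closed[of a "[:-1:] * b"] mult_closed[of "[:-1:]" b] const_closed by simp

lemma over_diff: "over M \<Longrightarrow> over N \<Longrightarrow> over (M - N)"
  by (auto simp: over_def diff_closed)

lemma over_smult: "a \<in> A \<Longrightarrow> over N \<Longrightarrow> over (smult a N)"
  by (auto simp: over_def mult_closed)

lemma over_monom_mult: "a \<in> A \<Longrightarrow> over N \<Longrightarrow> over (monom a n * N)"
  by (auto simp: over_def coeff_monom_mult mult_closed zero_closed)

lemma over_diff_poly: "S \<in> A \<Longrightarrow> over (diff_poly S)"
  unfolding diff_poly_def
  by (rule over_diff) (auto simp: over_def coeff_map_poly const_closed zero_closed coeff_pCons split: nat.split)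

text \<open>The leading coefficient of \<open>N\<close> cannot be inverted in \<open>A\<close>, so
  \<open>M\<close> is multiplied by a power of it. Membership over \<open>A\<close> is claimed for
  the remainder, which is what minimality of degree is applied to.\<close>

lemma pseudo_division:
  assumes N: "over N" "N \<noteq> 0" and "over M"
  shows "\<exists>k q r. smult (lead_coeff N ^ k) M = N * q + r \<and> over r \<and> (r = 0 \<or> degree r < degree N)"
  using assms(3)
\<comment> \<open>The zero polynomial has degree 0 as well; the shift makes the passage from a
  nonzero constant to zero decrease the measure.\<close>
proof (induction "if M = 0 then 0 else Suc (degree M)" arbitrary: M rule: less_induct)
  case less
  show ?case
  proof (cases "M = 0 \<or> degree M < degree N")
    case True
    show ?thesis
      by (rule exI[of _ 0], rule exI[of _ 0], rule exI[of _ M]) (use True less in auto)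
  next
    case False
    define n where "n = degree M - degree N"
    define M' where "M' = smult (lead_coeff N) M - monom (lead_coeff M) n * N"
    have lN: "lead_coeff N \<in> A" "lead_coeff M \<in> A" using N less by (auto simp: over_def)
    have oM': "over M'" unfolding M'_def
      by (intro over_diff over_smult over_monom_mult lN N less)
    have deg: "M' = 0 \<or> degree M' < degree M"
    proof (rule disjCI)
      assume "\<not> degree M' < degree M"
      have "degree M' \<le> degree M" unfolding M'_def
        by (rule degree_diff_le) (use False N in \<open>auto simp: n_def degree_mult_eq degree_monom_eq\<close>)
      moreover have "coeff M' (degree M) = 0"
        using False by (auto simp: M'_def coeff_monom_mult n_def)
      ultimately show "M' = 0" using \<open>\<not> degree M' < degree M\<close>
        by (metis leading_coeff_0_iff order_le_imp_less_or_eq)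
    qed
    have "(if M' = 0 then 0 else Suc (degree M')) < (if M = 0 then 0 else Suc (degree M))"
      using deg False by auto
    from less(1)[OF this oM'] obtain k q r where
      *: "smult (lead_coeff N ^ k) M' = N * q + r" "over r" "r = 0 \<or> degree r < degree N" by blast
    have "smult (lead_coeff N ^ Suc k) M
        = smult (lead_coeff N ^ k) M' + smult (lead_coeff N ^ k) (monom (lead_coeff M) n * N)"
      by (simp add: M'_def smult_diff_right mult.commute)
    also have "\<dots> = N * (q + smult (lead_coeff N ^ k) (monom (lead_coeff M) n)) + r"
      using * by (simp add: algebra_simps)
    finally show ?thesis using * by blast
  qed
qed

text \<open>\<open>m\<close> is the minimal polynomial of \<open>x\<close> over the fraction field of \<open>A\<close>.\<close>

lemma monic_minimal_relation:
  assumes f: "f \<in> A" "degree f > 0"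
  obtains m where "over m" "lead_coeff m = 1" "poly m [:0, 1:] = 0"
    "\<And>S. S \<in> A \<Longrightarrow> m dvd diff_poly S"
proof -
  define P where "P N \<longleftrightarrow> over N \<and> N \<noteq> 0 \<and> poly N [:0, 1:] = 0" for N
  have lc: "lead_coeff (diff_poly f) = [:lead_coeff f:]" and f0: "diff_poly f \<noteq> 0"
  proof -
    have d: "degree (diff_poly f) = degree f"
      unfolding diff_poly_def using f(2)
      using degree_add_eq_left[of "- [:f:]" "lift_const f"]
      by (simp add: degree_map_poly del: minus_pCons)
    show "lead_coeff (diff_poly f) = [:lead_coeff f:]"
      unfolding d unfolding diff_poly_def using f(2)
      by (auto simp: coeff_map_poly coeff_pCons split: nat.split)
    then show "diff_poly f \<noteq> 0" using f(2) by auto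
  qed
  have "P (diff_poly f)" using f0 over_diff_poly[OF f(1)] poly_diff_poly_self by (auto simp: P_def)
  then obtain N where PN: "P N" and min: "\<And>M. P M \<Longrightarrow> degree N \<le> degree M"
    using exists_least_iff[of "\<lambda>n. \<exists>N. P N \<and> degree N = n"] by (metis linorder_not_le)
  have rem0: "r = 0" if "over r" "poly r [:0,1:] = 0" "r = 0 \<or> degree r < degree N" for r
    using min[of r] that unfolding P_def by (metis linorder_not_le)
  obtain k q r where kqr: "smult (lead_coeff N ^ k) (diff_poly f) = N * q + r" "over r"
      "r = 0 \<or> degree r < degree N"
    using pseudo_division[of N "diff_poly f"] PN over_diff_poly f by (auto simp: P_def)
  have "poly (smult (lead_coeff N ^ k) (diff_poly f)) [:0,1:] = 0"
    by (simp add: poly_diff_poly_self)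
  then have "r = 0" using kqr PN by (intro rem0) (auto simp: P_def)
  then have dvd: "N dvd smult (lead_coeff N ^ k) (diff_poly f)" using kqr by simp
  \<comment> \<open>By Gauss's lemma the primitive part of \<open>N\<close> divides \<open>f(T) - f(x)\<close>, whose leading coefficient
    in \<open>T\<close> is a unit.\<close>
  have "primitive_part N dvd primitive_part (smult (lead_coeff N ^ k) (diff_poly f))"
    using dvd by (rule primitive_part_dvd_primitive_partI)
  also have "\<dots> = smult (unit_factor (lead_coeff N ^ k)) (primitive_part (diff_poly f))"
    by (rule primitive_part_smult)
  also have "\<dots> dvd smult (unit_factor (lead_coeff N ^ k)) (diff_poly f)"
  proof -
    have "primitive_part (diff_poly f) dvd diff_poly f"
      using dvd_smult[OF dvd_refl, of "primitive_part (diff_poly f)" "content (diff_poly f)"]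
      by (simp only: content_times_primitive_part)
    then have "[:u:] * primitive_part (diff_poly f) dvd [:u:] * diff_poly f" for u
      by (intro mult_dvd_mono) auto
    then show ?thesis by simp
  qed
  finally obtain w where w: "smult (unit_factor (lead_coeff N ^ k)) (diff_poly f) = primitive_part N * w"
    by (auto elim: dvdE)
  have "is_unit (lead_coeff (smult (unit_factor (lead_coeff N ^ k)) (diff_poly f)))"
  proof -
    have "lead_coeff N ^ k \<noteq> 0" using PN by (auto simp: P_def)
    then have "is_unit (unit_factor (lead_coeff N ^ k))" by (rule unit_factor_is_unit)
    moreover have "is_unit [:lead_coeff f:]" using f(2) by (auto simp: is_unit_const_poly_iff dvd_field_iff)
    ultimately show ?thesis unfolding lead_coeff_smult lc by (rule is_unit_mult_iff[THEN iffD2, OF conjI])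
  qed
  then have "is_unit (lead_coeff (primitive_part N))"
    unfolding w lead_coeff_mult is_unit_mult_iff ..
  then obtain c where c: "lead_coeff (primitive_part N) = [:c:]" "c \<noteq> 0"
    by (auto simp: is_unit_poly_iff dvd_field_iff)
  define m where "m = smult [:1/c:] (primitive_part N)"
  have m1: "lead_coeff m = 1" using c by (simp add: m_def one_pCons)
  have lcN: "lead_coeff N = content N * [:c:]"
    using c(1) arg_cong[OF content_times_primitive_part[of N], of lead_coeff] by (simp only: lead_coeff_smult)
  have Nm: "N = smult (lead_coeff N) m"
    unfolding lcN m_def using c by (simp add: smult_smult)
  \<comment> \<open>Each coefficient of \<open>m\<close> is the exact quotient of a coefficient of
    \<open>N\<close> by the leading one, and both are in \<open>A\<close>.\<close>
  have om: "over m" unfolding over_def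
  proof
    fix i
    have "lead_coeff N * coeff m i = coeff N i" using arg_cong[OF Nm, of "\<lambda>p. coeff p i"] by (simp only: coeff_smult)
    then show "coeff m i \<in> A" using PN by (auto simp: P_def over_def intro: division_closed[of "lead_coeff N"])
  qed
  have "poly N [:0,1:] = lead_coeff N * poly m [:0,1:]" using arg_cong[OF Nm, of "\<lambda>p. poly p [:0,1:]"] by (simp only: poly_smult)
  then have mx: "poly m [:0,1:] = 0" using PN by (auto simp: P_def)
  have dm: "degree m = degree N"
    using PN by (subst Nm) (simp add: P_def)
  show thesis
  proof (rule that[OF om m1 mx])
    fix S assume S: "S \<in> A"
    obtain k q r where kqr: "smult (lead_coeff m ^ k) (diff_poly S) = m * q + r" "over r"
      "r = 0 \<or> degree r < degree m"
      using pseudo_division[of m "diff_poly S"] om m1 over_diff_poly S by force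
    have e: "diff_poly S = m * q + r" using kqr(1) m1 by simp
    have "poly (diff_poly S) [:0,1:] = 0" by (rule poly_diff_poly_self)
    then have "r = 0" using kqr mx dm unfolding e by (intro rem0) auto
    then show "m dvd diff_poly S" using e by simp
  qed
qed

text \<open>
  A coefficient \<open>h\<close> of \<open>m\<close> of maximal degree in \<open>x\<close> is a generator. Indeed \<open>m\<close> divides
  \<open>h(T) - h(x)\<close> and has the same degree in \<open>x\<close>, so the quotient is a polynomial in \<open>T\<close>; a root of it
  would make \<open>h\<close> constant.
\<close>

lemma generator:
  assumes f: "f \<in> A" "degree f > 0"
  obtains h where "h \<in> A" "degree h > 0" "\<And>S. S \<in> A \<Longrightarrow> \<exists>g. S = g \<circ>\<^sub>p h"
proof -
  obtain m where m: "over m" "lead_coeff m = 1" "poly m [:0, 1:] = 0"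
    "\<And>S. S \<in> A \<Longrightarrow> m dvd diff_poly S"
    using monic_minimal_relation[OF f] by blast
  define d where "d = Max ((\<lambda>i. degree (coeff m i)) ` {..degree m})"
  have le_d: "degree (coeff m i) \<le> d" for i
  proof (cases "i \<le> degree m")
    case True then show ?thesis unfolding d_def by (intro Max_ge) auto
  qed (simp add: coeff_eq_0)
  have "d \<in> (\<lambda>i. degree (coeff m i)) ` {..degree m}" unfolding d_def by (rule Max_in) auto
  then obtain i where i: "degree (coeff m i) = d" by auto
  define h where "h = coeff m i"
  have hA: "h \<in> A" using m by (auto simp: h_def over_def)
  \<comment> \<open>If all coefficients were constants, \<open>m(x) = 0\<close> would be an
    algebraic relation for \<open>x\<close> over \<open>\<complex>\<close>.\<close>
  have d0: "d > 0"
  proof (rule ccontr)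
    assume "\<not> d > 0"
    then have "m = lift_const (map_poly (\<lambda>a. coeff a 0) m)"
      using le_d by (intro lift_const_of_degree_0) auto
    then obtain m0 where m0: "m = lift_const m0" by blast
    then have "m0 = 0" using m(3) by (simp add: poly_lift_const_X)
    then show False using m0 m(2) by simp
  qed
  have dh: "degree h = d" using i by (simp add: h_def)
  obtain q where q: "diff_poly h = m * q" using m(4)[OF hA] by (auto elim: dvdE)
  have ev: "poly m [:\<tau>:] * poly q [:\<tau>:] = [:poly h \<tau>:] - h" for \<tau>
  proof -
    have "poly (diff_poly h) [:\<tau>:] = [:poly h \<tau>:] - h" by (simp add: diff_poly_def poly_lift_const)
    then show ?thesis by (simp add: q)
  qed
  have degev: "degree ([:poly h \<tau>:] - h) = d" for \<tau>
    using d0 dh using degree_add_eq_right[of "[:poly h \<tau>:]" "- h"] by simp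
  \<comment> \<open>\<open>e(\<tau>)\<close> is the coefficient of \<open>x\<^sup>d\<close> in
    \<open>m(\<tau>)\<close>. Where it is nonzero, \<open>m(\<tau>)\<close> uses up the whole degree
    \<open>d\<close> of \<open>h(\<tau>) - h\<close> and leaves a constant for
    \<open>q(\<tau>)\<close>.\<close>
  define e where "e = map_poly (\<lambda>a. coeff a d) m"
  have "coeff e i \<noteq> 0" using d0 i by (auto simp: e_def coeff_map_poly)
  then have e0: "e \<noteq> 0" by auto
  have q0: "degree (poly q [:\<tau>:]) = 0" if "poly e \<tau> \<noteq> 0" for \<tau>
  proof -
    have "coeff (poly m [:\<tau>:]) d \<noteq> 0" using that by (simp add: coeff_poly_const e_def)
    then have "degree (poly m [:\<tau>:]) \<ge> d" by (rule le_degree)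
    moreover have "degree (poly m [:\<tau>:]) + degree (poly q [:\<tau>:]) = d"
      using degev[of \<tau>] ev[of \<tau>] d0 by (metis degree_0 degree_mult_eq less_not_refl mult_eq_0_iff)
    ultimately show ?thesis by simp
  qed
  have "degree (coeff q j) = 0" for j
  proof (rule ccontr)
    assume ne: "degree (coeff q j) \<noteq> 0"
    define k where "k = degree (coeff q j)"
    define z where "z = map_poly (\<lambda>a. coeff a k) q"
    have "coeff z j \<noteq> 0" using ne by (auto simp: z_def coeff_map_poly k_def)
    \<comment> \<open>The factor \<open>e\<close> covers the exceptional \<open>\<tau>\<close>, so
      that the product vanishes at every point.\<close>
    then have z0: "z * e \<noteq> 0" using e0 by auto
    have "poly (z * e) \<tau> = 0" for \<tau>
    proof (cases "poly e \<tau> = 0")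
      case False
      then have "coeff (poly q [:\<tau>:]) k = 0" using q0[OF False] ne by (auto simp: k_def coeff_eq_0)
      then show ?thesis by (simp add: coeff_poly_const z_def)
    qed simp
    then show False using z0 poly_all_0_iff_0 by blast
  qed
  then obtain q0 where q0': "q = lift_const q0" using lift_const_of_degree_0 by blast
  have root: "poly q0 \<tau> \<noteq> 0" for \<tau>
    using ev[of \<tau>] degev[of \<tau>] d0 by (auto simp: q0' poly_lift_const)
  then have "degree q0 = 0"
    using fundamental_theorem_of_algebra[of q0] constant_degree by blast
  then obtain c where "q0 = [:c:]" by (metis degree_eq_zeroE)
  with root[of 0] have c: "q = [:[:c:]:]" "c \<noteq> 0" by (auto simp: q0' map_poly_pCons)
  have dvd: "diff_poly h dvd diff_poly S" if "S \<in> A" for S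
  proof -
    have "[:1/c:] * [:c:] = 1" using c(2) by (simp add: one_pCons)
    then have "smult [:1/c:] (smult [:c:] m) = m" by (simp only: smult_smult smult_1_left)
    then have "smult [:c:] m dvd m" using dvd_smult[OF dvd_refl, of "smult [:c:] m" "[:1/c:]"] by simp
    then have "diff_poly h dvd m" unfolding q c(1) by simp
    then show ?thesis using m(4)[OF that] dvd_trans by blast
  qed
  obtain \<alpha> where \<alpha>: "poly h \<alpha> = 0"
    using fundamental_theorem_of_algebra[of h] dh d0 constant_degree by force
  \<comment> \<open>Setting \<open>x = \<alpha>\<close> shows that \<open>h\<close> divides \<open>S - S(\<alpha>)\<close>, and the quotient is again in \<open>A\<close>.\<close>
  have "\<exists>g. S = g \<circ>\<^sub>p h" if "S \<in> A" for S
    using that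
  proof (induction "degree S" arbitrary: S rule: less_induct)
    case less
    obtain w where "diff_poly S = diff_poly h * w" using dvd[OF less(2)] by (auto elim: dvdE)
    then have "S - [:poly S \<alpha>:] = h * map_poly (\<lambda>a. poly a \<alpha>) w"
      by (metis (no_types, lifting) \<alpha> diff_zero map_poly_eval_diff_poly map_poly_eval_mult pCons_0_0)
    then obtain S1 where S1: "S - [:poly S \<alpha>:] = h * S1" by blast
    have "h * S1 \<in> A" unfolding S1[symmetric] by (intro diff_closed less const_closed)
    then have S1A: "S1 \<in> A" using hA d0 dh by (intro division_closed[of h S1]) auto
    show ?case
    proof (cases "S1 = 0")
      case True
      then have "S = [:poly S \<alpha>:]" using S1 by simp
      then show ?thesis by (metis pcompose_const)
    next
      case False
      have e: "S = [:poly S \<alpha>:] + h * S1" using S1 by (metis add.commute diff_add_cancel)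
      have "degree (h * S1) = d + degree S1" using False d0 dh by (subst degree_mult_eq) auto
      moreover have "degree S = degree (h * S1)"
        by (subst e, rule degree_add_eq_right) (use calculation d0 in auto)
      ultimately have "degree S1 < degree S" using d0 by simp
      from less(1)[OF this S1A] obtain g where "S1 = g \<circ>\<^sub>p h" by blast
      then have "S = pCons (poly S \<alpha>) g \<circ>\<^sub>p h" using e by (simp add: pcompose_pCons)
      then show ?thesis by blast
    qed
  qed
  then show thesis using that[of h] hA dh d0 by auto
qed

end

section \<open>The tangential center problem\<close>

text \<open>A vanishing cycle is prescribed only for parameters in \<open>[0,1]\<close>; derivatives
  within this interval do not see the rest.\<close>

lemma form_integral_cong:
  assumes "\<And>s. s \<in> {0..1} \<Longrightarrow> \<gamma> s = \<gamma>' s"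
  shows "form_integral \<omega> \<gamma> = form_integral \<omega> \<gamma>'"
  unfolding form_integral_def
proof (rule integral_cong)
  fix s :: real assume s: "s \<in> {0..1}"
  have "vector_derivative (\<lambda>s. fst (\<gamma> s)) (at s within {0..1}) = vector_derivative (\<lambda>s. fst (\<gamma>' s)) (at s within {0..1})"
    "vector_derivative (\<lambda>s. snd (\<gamma> s)) (at s within {0..1}) = vector_derivative (\<lambda>s. snd (\<gamma>' s)) (at s within {0..1})"
    using assms s by (auto intro!: vector_derivative_cong_eq always_eventually)
  then show "eval2 (fst \<omega>) (\<gamma> s) * vector_derivative (\<lambda>s. fst (\<gamma> s)) (at s within {0..1}) +
         eval2 (snd \<omega>) (\<gamma> s) * vector_derivative (\<lambda>s. snd (\<gamma> s)) (at s within {0..1}) =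
    eval2 (fst \<omega>) (\<gamma>' s) * vector_derivative (\<lambda>s. fst (\<gamma>' s)) (at s within {0..1}) +
         eval2 (snd \<omega>) (\<gamma>' s) * vector_derivative (\<lambda>s. snd (\<gamma>' s)) (at s within {0..1})"
    using assms[OF s] by simp
qed

lemma null_homotopic_in_cong:
  assumes "null_homotopic_in S \<gamma>" "\<And>s. s \<in> {0..1} \<Longrightarrow> \<gamma> s = \<gamma>' s"
  shows "null_homotopic_in S \<gamma>'"
proof -
  obtain a where a: "homotopic_loops S \<gamma> (\<lambda>_. a)" using assms(1) by (auto simp: null_homotopic_in_def)
  then have "homotopic_loops S \<gamma> \<gamma>'"
    using assms(2) homotopic_loops_imp_path homotopic_loops_imp_subset homotopic_loops_imp_loop
    by (metis homotopic_loops_eq)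
  then have "homotopic_loops S \<gamma>' (\<lambda>_. a)" using a homotopic_loops_sym homotopic_loops_trans by blast
  then show ?thesis unfolding null_homotopic_in_def by blast
qed

section \<open>The integral of \<open>y a(x) dx\<close> along the standard loop\<close>

lemma standard_loop_derivatives:
  assumes X: "X holomorphic_on ball 0 e" and r: "norm r < e"
  shows "((\<lambda>s. X (r * of_real (cos (2 * pi * s)))) has_vector_derivative
      deriv X (r * of_real (cos (2 * pi * s))) * (r * of_real (- sin (2 * pi * s) * (2 * pi)))) (at s within S)"
    "((\<lambda>s. \<sigma> * r * of_real (sin (2 * pi * s))) has_vector_derivative
      \<sigma> * (r * of_real (cos (2 * pi * s) * (2 * pi)))) (at s within S)"
proof -
  note D = has_vector_derivative_circle_pair[of r s S, unfolded has_vector_derivative_def]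
  have "norm (r * of_real (cos (2 * pi * s))) \<le> norm r" by (simp add: norm_mult mult_left_le)
  then have "(X has_field_derivative deriv X (r * of_real (cos (2 * pi * s)))) (at (r * of_real (cos (2 * pi * s))))"
    using r by (intro holomorphic_derivI[OF X open_ball]) auto
  then have "(X has_derivative (*) (deriv X (r * of_real (cos (2 * pi * s))))) (at (fst (circle_pair r s)))"
    by (simp add: has_field_derivative_def circle_pair_def)
  from has_derivative_compose[OF has_derivative_fst[OF D] this]
  show "((\<lambda>s. X (r * of_real (cos (2 * pi * s)))) has_vector_derivative
      deriv X (r * of_real (cos (2 * pi * s))) * (r * of_real (- sin (2 * pi * s) * (2 * pi)))) (at s within S)"
    by (simp add: has_vector_derivative_def circle_pair_def)
  from has_derivative_mult_right[OF has_derivative_snd[OF D], of \<sigma>]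
  show "((\<lambda>s. \<sigma> * r * of_real (sin (2 * pi * s))) has_vector_derivative
      \<sigma> * (r * of_real (cos (2 * pi * s) * (2 * pi)))) (at s within S)"
    by (simp add: has_vector_derivative_def circle_pair_def mult.assoc)
qed

lemma standard_loop_differentiable:
  assumes X: "X holomorphic_on ball 0 e" and r: "norm r < e"
  shows "differentiable_path (\<lambda>s. (X (r * of_real (cos (2 * pi * s))), \<sigma> * r * of_real (sin (2 * pi * s))))"
  unfolding differentiable_path_def
  using has_vector_derivative_Pair[OF standard_loop_derivatives[OF assms], unfolded has_vector_derivative_def]
  by (blast intro: differentiableI)

text \<open>With \<open>\<theta> = 2 pi s\<close>, \<open>y\<close> contributes
  \<open>\<sigma> r sin \<theta>\<close> and \<open>dx\<close> contributes
  \<open>- 2 pi r sin \<theta> X'(r cos \<theta>)\<close>: hence the squared sine and the nonzero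
  constant \<open>K\<close>.\<close>

lemma standard_loop_integral:
  assumes X: "X holomorphic_on ball 0 e" and r: "norm r < e" "r \<noteq> 0" and \<sigma>: "\<sigma> \<noteq> 0"
    and I: "has_form_integral ([:0, a:], 0) (\<lambda>s. (X (r * of_real (cos (2 * pi * s))), \<sigma> * r * of_real (sin (2 * pi * s)))) 0"
  shows "((\<lambda>s. of_real ((sin (2 * pi * s))\<^sup>2) *
     (poly a (X (r * of_real (cos (2 * pi * s)))) * deriv X (r * of_real (cos (2 * pi * s))))) has_integral 0) {0..1}"
proof -
  define K where "K = - 2 * of_real pi * \<sigma> * r\<^sup>2"
  define J where "J s = of_real ((sin (2 * pi * s))\<^sup>2) *
     (poly a (X (r * of_real (cos (2 * pi * s)))) * deriv X (r * of_real (cos (2 * pi * s))))" for s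
  have "((\<lambda>s. K * J s) has_integral 0) {0..1}"
  proof (rule has_integral_eq[rotated, OF I[unfolded has_form_integral_def]])
    fix s :: real assume s: "s \<in> {0..1}"
    note v = vector_derivative_01[OF standard_loop_derivatives(1)[OF X r(1)] s]
    show "eval2 (fst ([:0, a:], 0)) (X (r * of_real (cos (2 * pi * s))), \<sigma> * r * of_real (sin (2 * pi * s))) *
        vector_derivative (\<lambda>s. fst (X (r * of_real (cos (2 * pi * s))), \<sigma> * r * of_real (sin (2 * pi * s)))) (at s within {0..1}) +
        eval2 (snd ([:0, a:], 0)) (X (r * of_real (cos (2 * pi * s))), \<sigma> * r * of_real (sin (2 * pi * s))) *
        vector_derivative (\<lambda>s. snd (X (r * of_real (cos (2 * pi * s))), \<sigma> * r * of_real (sin (2 * pi * s)))) (at s within {0..1})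
      = K * J s"
      by (simp add: v K_def J_def power2_eq_square)
  qed
  then have "((\<lambda>s. inverse K * (K * J s)) has_integral inverse K * 0) {0..1}" by (rule has_integral_mult_right)
  moreover have "K \<noteq> 0" using r \<sigma> by (simp add: K_def)
  ultimately show ?thesis by (simp add: J_def mult.assoc[symmetric])
qed

section \<open>Polynomials invariant under the local involution\<close>

lemma has_field_derivative_reflect:
  fixes f :: "complex \<Rightarrow> complex"
  assumes "(f has_field_derivative D) (at (- w))"
  shows "((\<lambda>w. f (- w)) has_field_derivative - D) (at w)"
proof -
  have "(uminus has_field_derivative - 1) (at w)" by (rule DERIV_minus[OF DERIV_ident])
  from DERIV_chain2[where g = uminus, OF assms this] show ?thesis by simp
qed

lemma even_of_odd_derivative:
  assumes d: "d > 0" and X: "X holomorphic_on ball 0 d"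
    and odd: "\<And>w. w \<in> ball 0 d \<Longrightarrow> poly (pderiv R) (X w) * deriv X w + poly (pderiv R) (X (- w)) * deriv X (- w) = 0"
    and w: "w \<in> ball 0 d"
  shows "poly R (X w) = poly R (X (- w))"
proof -
  have D: "((\<lambda>w. poly R (X w)) has_field_derivative poly (pderiv R) (X w) * deriv X w) (at w)" if "w \<in> ball 0 d" for w
    by (rule DERIV_chain2[OF poly_DERIV holomorphic_derivI[OF X open_ball that]])
  have "((\<lambda>w. poly R (X w) - poly R (X (- w))) has_field_derivative 0) (at w within ball 0 d)" if w: "w \<in> ball 0 d" for w
  proof -
    have m: "- w \<in> ball 0 d" using w by simp
    have "((\<lambda>w. poly R (X (- w))) has_field_derivative - (poly (pderiv R) (X (- w)) * deriv X (- w))) (at w)"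
      by (rule has_field_derivative_reflect[OF D[OF m]])
    note this = DERIV_diff[OF D[OF w] this]
    also have "poly (pderiv R) (X w) * deriv X w - - (poly (pderiv R) (X (- w)) * deriv X (- w)) = 0"
      using odd[OF w] by (simp only: diff_minus_eq_add)
    finally show ?thesis by (rule has_field_derivative_at_within)
  qed
  from has_field_derivative_zero_constant[OF convex_ball this]
  obtain c where c: "\<forall>w\<in>ball 0 d. poly R (X w) - poly R (X (- w)) = c" by blast
  have "poly R (X 0) - poly R (X (- 0)) = c" using c d by (intro bspec[OF c]) simp
  then show ?thesis using bspec[OF c w] by simp
qed

text \<open>For division, \<open>a (X w)\<close> has to be cancelled. The condition concerns germs,
  so the neighbourhood may shrink until this factor has no zero at
  \<open>w \<noteq> 0\<close>.\<close>

lemma division_closed_subalgebra_even: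
  assumes e: "e > 0" and X: "continuous_on (ball 0 e) X" "inj_on X (ball 0 e)"
  shows "division_closed_subalgebra {S. \<forall>\<^sub>F w in at 0. poly S (X w) = poly S (X (- w))}"
proof
  fix a b :: "complex poly"
  assume a: "a * b \<in> {S. \<forall>\<^sub>F w in at 0. poly S (X w) = poly S (X (- w))}"
    "a \<in> {S. \<forall>\<^sub>F w in at 0. poly S (X w) = poly S (X (- w))}" "a \<noteq> 0"
  \<comment> \<open>\<open>X 0\<close> may itself be a root of \<open>a\<close>; injectivity of
    \<open>X\<close> keeps \<open>X w\<close> away from it, continuity away from the others.\<close>
  define Z where "Z = {x. poly a x = 0} - {X 0}"
  have "finite Z" using a(3) by (simp add: Z_def poly_roots_finite)
  then have "open (- Z)" by (intro open_Compl finite_imp_closed)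
  moreover have "(X \<longlongrightarrow> X 0) (at 0)"
    using X(1) e by (metis centre_in_ball continuous_on_def at_within_open open_ball)
  moreover have "X 0 \<in> - Z" by (simp add: Z_def)
  ultimately have "\<forall>\<^sub>F w in at 0. X w \<in> - Z" by (metis topological_tendstoD)
  moreover have "\<forall>\<^sub>F w in at 0. w \<in> ball 0 e - {0}"
    unfolding eventually_at_topological using e by (intro exI[of _ "ball 0 e"]) auto
  ultimately have nz: "\<forall>\<^sub>F w in at 0. poly a (X w) \<noteq> 0"
  proof eventually_elim
    case (elim w)
    then have "X w \<noteq> X 0" using X(2) e by (auto simp: inj_on_def)
    then show ?case using elim(1) by (auto simp: Z_def)
  qed
  have "\<forall>\<^sub>F w in at 0. poly (a * b) (X w) = poly (a * b) (X (- w))" "\<forall>\<^sub>F w in at 0. poly a (X w) = poly a (X (- w))"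
    using a by auto
  with nz have "\<forall>\<^sub>F w in at 0. poly b (X w) = poly b (X (- w))"
    by eventually_elim auto
  then show "b \<in> {S. \<forall>\<^sub>F w in at 0. poly S (X w) = poly S (X (- w))}" by simp
qed (auto elim: eventually_elim2)

text \<open>The derivative of an even function vanishes at 0, and \<open>X'(0) \<noteq> 0\<close>
  because \<open>X\<close> is injective.\<close>

lemma pderiv_even_zero:
  assumes e: "e > 0" and X: "X holomorphic_on ball 0 e" "inj_on X (ball 0 e)"
    and h: "\<forall>\<^sub>F w in at 0. poly h (X w) = poly h (X (- w))"
  shows "poly (pderiv h) (X 0) = 0"
proof -
  have z: "(0::complex) \<in> ball 0 e" using e by simp
  have dX: "(X has_field_derivative deriv X 0) (at 0)" by (rule holomorphic_derivI[OF X(1) open_ball z])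
  have d0: "deriv X 0 \<noteq> 0" by (rule holomorphic_injective_imp_regular[OF X(1) open_ball X(2) z])
  have D: "((\<lambda>w. poly h (X w)) has_field_derivative poly (pderiv h) (X 0) * deriv X 0) (at 0)"
    by (rule DERIV_chain2[OF poly_DERIV dX])
  then have "((\<lambda>w. poly h (X (- w))) has_field_derivative - (poly (pderiv h) (X 0) * deriv X 0)) (at 0)"
    by (intro has_field_derivative_reflect) simp
  moreover have "((\<lambda>w. poly h (X (- w))) has_field_derivative poly (pderiv h) (X 0) * deriv X 0) (at 0)"
    using D unfolding has_field_derivative_def
    by (rule has_derivative_transform_eventually[OF _ h]) simp_all
  ultimately have "- (poly (pderiv h) (X 0) * deriv X 0) = poly (pderiv h) (X 0) * deriv X 0"
    by (rule DERIV_unique)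
  then show ?thesis using d0 by (simp add: eq_neg_iff_add_eq_0 equation_minus_iff)
qed


context morse_chart begin

text \<open>
  As \<open>h'(x\<^sub>0) = 0\<close> forces \<open>g'(h(x\<^sub>0)) \<noteq> 0\<close>, the projected loop lies in a part of the curve that is a graph
  over a disc in the \<open>y\<close>-line.
\<close>

lemma projected_loop_null_homotopic:
  assumes fgh: "f = g \<circ>\<^sub>p h" and f: "poly (pderiv (pderiv f)) x0 \<noteq> 0" and h: "poly (pderiv h) x0 = 0"
  obtains \<rho> where "\<rho> > 0"
    "\<And>r. norm r < \<rho> \<Longrightarrow> null_homotopic_in (level g (poly f x0 + r\<^sup>2)) (proj_map h \<circ> (\<lambda>s. \<phi> (circle_pair r s)))"
proof -
  define z0 where "z0 = poly h x0"
  \<comment> \<open>With \<open>h'(x0) = 0\<close> the chain rule leaves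
    \<open>f''(x0) = g'(h(x0)) h''(x0)\<close>.\<close>
  have "deriv (poly g) z0 \<noteq> 0"
    using f h by (auto simp: fgh pderiv_pcompose pderiv_mult poly_pcompose deriv_poly z0_def)
  then obtain G e d where G: "e > 0" "d > 0" "G holomorphic_on ball (poly g z0) e"
      "\<And>w. w \<in> ball (poly g z0) e \<Longrightarrow> poly g (G w) = w" "\<And>z. z \<in> ball z0 d \<Longrightarrow> G (poly g z) = z"
    using local_inverse[OF poly_holomorphic_on[OF holomorphic_on_ident] open_UNIV UNIV_I, of g z0] by metis
  have gz0: "poly g z0 = poly f x0" by (simp add: fgh z0_def poly_pcompose)
  \<comment> \<open>Both \<open>r\<^sup>2\<close> and \<open>y\<^sup>2\<close> then stay below
    \<open>e / 2\<close> in modulus, so \<open>t - y\<^sup>2\<close> remains in the domain of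
    \<open>G\<close>.\<close>
  define \<epsilon> where "\<epsilon> = sqrt (e / 2)"
  have \<epsilon>: "\<epsilon> > 0" "\<epsilon>\<^sup>2 = e / 2" using G(1) by (auto simp: \<epsilon>_def)
  define N where "N = (poly h -` ball z0 d) \<times> ball (0::complex) \<epsilon>"
  have "open N" unfolding N_def by (intro open_Times open_vimage continuous_intros) auto
  moreover have "(x0, 0) \<in> N" using G(2) \<epsilon> by (auto simp: N_def z0_def)
  ultimately obtain \<rho> where \<rho>: "\<rho> > 0" "\<And>v. norm v < \<rho> \<Longrightarrow> v \<in> W" "\<And>v. norm v < \<rho> \<Longrightarrow> \<phi> v \<in> N"
    using loop_near by metis
  show thesis
  proof (rule that)
    show "min \<rho> \<epsilon> > 0" using \<rho>(1) \<epsilon>(1) by simp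
    fix r :: complex assume r: "norm r < min \<rho> \<epsilon>"
    define t where "t = poly f x0 + r\<^sup>2"
    define \<gamma> where "\<gamma> s = \<phi> (circle_pair r s)" for s
    have inW: "circle_pair r s \<in> W" and inN: "\<gamma> s \<in> N" for s
      using \<rho>(2,3)[of "circle_pair r s"] r by (simp_all add: norm_circle_pair \<gamma>_def)
    have lev: "(snd (\<gamma> s))\<^sup>2 + poly g (poly h (fst (\<gamma> s))) = t" for s
      using loop_in_level[OF inW, of s] by (cases "\<gamma> s") (simp add: \<gamma>_def t_def fgh poly_pcompose)
    have tb: "t - y\<^sup>2 \<in> ball (poly g z0) e" if "y \<in> ball 0 \<epsilon>" for y
    proof -
      have "norm (y\<^sup>2) < e / 2" "norm (r\<^sup>2) < e / 2"
        using that r power_strict_mono[of "norm y" \<epsilon> 2] power_strict_mono[of "norm r" \<epsilon> 2] \<epsilon>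
        by (auto simp: norm_power)
      then have "norm (y\<^sup>2 - r\<^sup>2) < e" using norm_triangle_ineq4[of "y\<^sup>2" "r\<^sup>2"] by simp
      then show ?thesis by (simp add: t_def gz0 dist_norm algebra_simps)
    qed
    have "continuous_on UNIV \<gamma>" unfolding \<gamma>_def
      by (rule continuous_on_compose2[OF continuous_\<phi> continuous_on_circle_pair]) (use inW in auto)
    then have path: "continuous_on S (\<lambda>s. snd (\<gamma> s))" for S
      by (intro continuous_on_snd) (rule continuous_on_subset, auto)
    have closed_loop: "\<gamma> 1 = \<gamma> 0" by (simp add: \<gamma>_def circle_pair_def)
    have "homotopic_loops (ball 0 \<epsilon>) (\<lambda>s. snd (\<gamma> s)) (\<lambda>s. 0)"
    proof (rule homotopic_loops_linear)
      show "closed_segment (snd (\<gamma> s)) 0 \<subseteq> ball 0 \<epsilon>" for s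
        using inN[of s] \<epsilon>(1) by (intro closed_segment_subset convex_ball) (auto simp: N_def mem_Times_iff)
    qed (auto simp: path_def pathstart_def pathfinish_def path closed_loop)
    moreover have "continuous_on (ball 0 \<epsilon>) (\<lambda>y. (G (t - y\<^sup>2), y))"
      by (intro continuous_intros continuous_on_compose2[OF holomorphic_on_imp_continuous_on[OF G(3)]])
        (use tb in auto)
    moreover have "(\<lambda>y. (G (t - y\<^sup>2), y)) \<in> ball 0 \<epsilon> \<rightarrow> level g t" using tb G(4) by auto
    ultimately have "homotopic_loops (level g t) ((\<lambda>y. (G (t - y\<^sup>2), y)) \<circ> (\<lambda>s. snd (\<gamma> s))) ((\<lambda>y. (G (t - y\<^sup>2), y)) \<circ> (\<lambda>s. 0))"
      by (rule homotopic_loops_continuous_image)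
    moreover have "(\<lambda>y. (G (t - y\<^sup>2), y)) \<circ> (\<lambda>s. snd (\<gamma> s)) = proj_map h \<circ> \<gamma>"
    proof
      fix s
      have "poly g (poly h (fst (\<gamma> s))) = t - (snd (\<gamma> s))\<^sup>2" using lev[of s] by (simp add: algebra_simps)
      then have "G (t - (snd (\<gamma> s))\<^sup>2) = poly h (fst (\<gamma> s))"
        using G(5)[of "poly h (fst (\<gamma> s))"] inN[of s] by (auto simp: N_def mem_Times_iff)
      then show "((\<lambda>y. (G (t - y\<^sup>2), y)) \<circ> (\<lambda>s. snd (\<gamma> s))) s = (proj_map h \<circ> \<gamma>) s"
        by (simp add: proj_map_def)
    qed
    ultimately show "null_homotopic_in (level g (poly f x0 + r\<^sup>2)) (proj_map h \<circ> (\<lambda>s. \<phi> (circle_pair r s)))"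
      unfolding null_homotopic_in_def t_def[symmetric] \<gamma>_def[symmetric] by (auto simp: o_def)
  qed
qed

lemma loop_properties:
  obtains \<rho> where "\<rho> > 0" "\<And>r. norm r < \<rho> \<Longrightarrow> differentiable_path (\<lambda>s. \<phi> (circle_pair r s))"
    "\<And>r. norm r < \<rho> \<Longrightarrow> (\<lambda>s. \<phi> (circle_pair r s)) ` {0..1} \<subseteq> level f (poly f x0 + r\<^sup>2)"
    "\<And>r. \<phi> (circle_pair r 0) = \<phi> (circle_pair r 1)"
proof -
  obtain \<rho> where \<rho>: "\<rho> > 0" "\<And>v. norm v < \<rho> \<Longrightarrow> v \<in> W" using loop_near[of UNIV] by auto
  have inW: "circle_pair r s \<in> W" if "norm r < \<rho>" for r s
    using \<rho>(2)[of "circle_pair r s"] that by (simp add: norm_circle_pair)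
  show thesis
  proof (rule that[OF \<rho>(1)])
    fix r :: complex assume r: "norm r < \<rho>"
    show "differentiable_path (\<lambda>s. \<phi> (circle_pair r s))" by (rule loop_differentiable[OF inW[OF r]])
    show "(\<lambda>s. \<phi> (circle_pair r s)) ` {0..1} \<subseteq> level f (poly f x0 + r\<^sup>2)"
      using loop_in_level[OF inW[OF r]] by blast
  qed (simp add: circle_pair_def)
qed

lemma common_right_factor:
  assumes f: "poly (pderiv f) x0 = 0" "poly (pderiv (pderiv f)) x0 \<noteq> 0" and \<rho>0: "\<rho>0 > 0"
    and int: "\<And>r. r \<noteq> 0 \<Longrightarrow> norm r < \<rho>0 \<Longrightarrow> \<exists>r'. r'\<^sup>2 = r\<^sup>2 \<and> smooth_curve (level f (poly f x0 + r\<^sup>2)) \<and>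
        has_form_integral ([:0, pderiv R:], 0) (\<lambda>s. \<phi> (circle_pair r' s)) 0"
  shows "\<exists>g h S. f = g \<circ>\<^sub>p h \<and> R = S \<circ>\<^sub>p h \<and> degree h > 0 \<and> poly (pderiv h) x0 = 0"
proof -
  obtain \<xi> X e N where \<xi>: "e > 0" "open N" "x0 \<in> N" "\<xi> holomorphic_on N" "\<xi> x0 = 0"
    "\<And>x. x \<in> N \<Longrightarrow> poly f x = poly f x0 + (\<xi> x)\<^sup>2" and X: "X holomorphic_on ball 0 e"
    "\<And>w. w \<in> ball 0 e \<Longrightarrow> X w \<in> N" "\<And>w. w \<in> ball 0 e \<Longrightarrow> \<xi> (X w) = w" "\<And>x. x \<in> N \<Longrightarrow> X (\<xi> x) = x"
    using morse_function_coordinate[OF f] by metis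
  have X0: "X 0 = x0" using X(4)[OF \<xi>(3)] \<xi>(5) by simp
  have inj: "inj_on X (ball 0 e)" using X(3) by (rule inj_on_inverseI)
  obtain \<rho>1 \<sigma> where \<rho>1: "\<rho>1 > 0" and \<sigma>: "\<sigma> = 1 \<or> \<sigma> = - 1"
    and hom: "\<And>r \<mu>. r \<noteq> 0 \<Longrightarrow> norm r < \<rho>1 \<Longrightarrow> \<mu> = 1 \<or> \<mu> = - 1 \<Longrightarrow>
       homotopic_loops (level f (poly f x0 + r\<^sup>2)) (\<lambda>s. \<phi> (circle_pair r s))
         (\<lambda>s. (X (r * \<mu> * of_real (cos (2 * pi * s))), \<sigma> * r * \<mu> * of_real (sin (2 * pi * s))))"
  proof (rule loop_homotopic_standard[of e N \<xi> X])
    fix \<rho> \<sigma>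
    assume "0 < \<rho>" "\<sigma> = 1 \<or> \<sigma> = - 1"
      "\<And>r \<mu>. r \<noteq> 0 \<Longrightarrow> norm r < \<rho> \<Longrightarrow> \<mu> = 1 \<or> \<mu> = - 1 \<Longrightarrow>
       homotopic_loops (level f (poly f x0 + r\<^sup>2)) (\<lambda>s. \<phi> (circle_pair r s))
         (\<lambda>s. (X (r * \<mu> * of_real (cos (2 * pi * s))), \<sigma> * r * \<mu> * of_real (sin (2 * pi * s))))"
    then show thesis by (rule that)
  qed (assumption | rule \<xi> X)+
  obtain \<rho>2 where \<rho>2: "\<rho>2 > 0" "\<And>r. norm r < \<rho>2 \<Longrightarrow> differentiable_path (\<lambda>s. \<phi> (circle_pair r s))"
    using loop_properties by metis
  define \<rho> where "\<rho> = Min {\<rho>0, \<rho>1, \<rho>2, e}"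
  have \<rho>: "\<rho> > 0" using \<rho>0 \<rho>1 \<rho>2(1) \<xi>(1) by (simp add: \<rho>_def)
  define q where "q w = poly (pderiv R) (X w) * deriv X w" for w
  have q: "q holomorphic_on ball 0 e" unfolding q_def by (intro holomorphic_intros X holomorphic_deriv) auto
  have "((\<lambda>s. of_real ((sin (2 * pi * s))\<^sup>2) * q (r * of_real (cos (2 * pi * s)))) has_integral 0) {0..1}"
    if r: "r \<noteq> 0" "norm r < \<rho>" for r
  proof -
    obtain r' where r': "r'\<^sup>2 = r\<^sup>2" and sm: "smooth_curve (level f (poly f x0 + r\<^sup>2))"
      and I: "has_form_integral ([:0, pderiv R:], 0) (\<lambda>s. \<phi> (circle_pair r' s)) 0"
      using int r by (auto simp: \<rho>_def)
    \<comment> \<open>The root \<open>r'\<close> used by the cycle may be \<open>r\<close> or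
      \<open>- r\<close>; the sign leads both to the standard loop of \<open>r\<close>, so the
      integral is known for every small \<open>r\<close>.\<close>
    obtain \<mu> where \<mu>: "\<mu> = 1 \<or> \<mu> = - 1" "r' * \<mu> = r"
    proof -
      have "r' = r \<or> r' = - r" using r' by (simp add: power2_eq_iff)
      then show thesis using that[of 1] that[of "- 1"] by auto
    qed
    have nr: "norm r' = norm r" using \<mu> by auto
    let ?\<gamma> = "\<lambda>s. (X (r * of_real (cos (2 * pi * s))), \<sigma> * r * of_real (sin (2 * pi * s)))"
    have "homotopic_loops (level f (poly f x0 + r\<^sup>2)) (\<lambda>s. \<phi> (circle_pair r' s)) ?\<gamma>"
    proof -
      have "r' \<noteq> 0" "norm r' < \<rho>1" using r nr by (auto simp: \<rho>_def)
      from hom[OF this \<mu>(1)] show ?thesis by (simp only: r' \<mu>(2) mult.assoc[of \<sigma>])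
    qed
    moreover have "differentiable_path ?\<gamma>" "differentiable_path (\<lambda>s. \<phi> (circle_pair r' s))"
      using r nr \<rho>2(2) by (auto simp: \<rho>_def intro!: standard_loop_differentiable[OF X(1)])
    ultimately obtain J where J: "has_form_integral ([:0, pderiv R:], 0) (\<lambda>s. \<phi> (circle_pair r' s)) J"
      "has_form_integral ([:0, pderiv R:], 0) ?\<gamma> J"
      using homotopic_loops_form_integral[OF sm] by blast
    have "J = 0" using I J(1) form_integral_eqI by metis
    moreover have "norm r < e" "\<sigma> \<noteq> 0" using r \<sigma> by (auto simp: \<rho>_def)
    ultimately show ?thesis unfolding q_def
      using standard_loop_integral[OF X(1) _ r(1)] J(2) by blast
  qed
  from holomorphic_even_part_zero[OF \<xi>(1) q \<rho> this]
  obtain d where d: "d > 0" "d \<le> e" "\<And>w. w \<in> ball 0 d \<Longrightarrow> q w + q (- w) = 0" by blast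
  have Xd: "X holomorphic_on ball 0 d" using X(1) d(2) by (meson holomorphic_on_subset subset_ball)
  define A where "A = {S. \<forall>\<^sub>F w in at 0. poly S (X w) = poly S (X (- w))}"
  interpret A: division_closed_subalgebra A
    unfolding A_def by (rule division_closed_subalgebra_even[OF \<xi>(1) holomorphic_on_imp_continuous_on[OF X(1)] inj])
  have "poly R (X w) = poly R (X (- w))" if "w \<in> ball 0 d" for w
    using even_of_odd_derivative[OF d(1) Xd _ that] d(3) by (simp add: q_def)
  then have R: "R \<in> A"
    using d(1) unfolding A_def eventually_at by (auto intro!: exI[of _ d] simp: dist_norm)
  have "poly f (X w) = poly f (X (- w))" if "w \<in> ball 0 e" for w
    using \<xi>(6)[OF X(2)[OF that]] X(3)[OF that] \<xi>(6)[OF X(2), of "- w"] X(3)[of "- w"] that by simp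
  then have fA: "f \<in> A"
    using \<xi>(1) unfolding A_def eventually_at by (auto intro!: exI[of _ e] simp: dist_norm)
  have "degree f > 0" using f(2) by (metis pderiv_0 poly_0 pderiv_eq_0_iff gr0I)
  then obtain h where h: "h \<in> A" "degree h > 0" "\<And>S. S \<in> A \<Longrightarrow> \<exists>g. S = g \<circ>\<^sub>p h"
    using A.generator[OF fA] by metis
  have "poly (pderiv h) x0 = 0"
    using pderiv_even_zero[OF \<xi>(1) X(1) inj] h(1) by (simp add: A_def X0)
  then show ?thesis using h(2) h(3)[OF fA] h(3)[OF R] by blast
qed

end

theorem theorem1p5:
  fixes f :: "complex poly" and F P Q :: "complex poly poly"
    and p :: "complex \<times> complex" and \<delta> :: "complex \<Rightarrow> real \<Rightarrow> complex \<times> complex"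
  assumes "F = [:f, 0, 1:]"
    and "morse_point F p"
    and "vanishing_cycles F p \<delta>"
  shows "tangential_center F (P, Q) p \<delta> \<longleftrightarrow>
    relatively_exact F (P, Q) \<or>
    (\<exists>g h \<omega>' \<eta>. degree g > 1 \<and> degree h > 1 \<and> f = g \<circ>\<^sub>p h \<and>
       relatively_exact F \<omega>' \<and> (P, Q) = \<omega>' + pullback_form h \<eta> \<and>
       (\<forall>\<^sub>F t in at (eval2 F p).
          null_homotopic_in {(z, y). y\<^sup>2 + poly g z = t} (proj_map h \<circ> \<delta> t)))"
proof -
  define x0 where "x0 = fst p"
  have dF: "partial_x F = [:pderiv f:]" "partial_y F = [:0, 2:]"
    by (simp_all add: assms(1) partial_y_def pderiv_pCons numeral_poly)
  have "snd p = 0" and f1: "poly (pderiv f) x0 = 0" and f2: "poly (pderiv (pderiv f)) x0 \<noteq> 0"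
    using assms(2) unfolding morse_point_def dF by (auto simp: x0_def partial_y_def pderiv_pCons)
  then have p: "p = (x0, 0)" by (simp add: x0_def prod_eq_iff)
  define c where "c = poly f x0"
  have Fp: "eval2 F p = c" by (simp add: assms(1) p c_def)
  obtain V W \<psi> \<phi> where coords: "morse_coordinates F p V W \<psi> \<phi>"
    and ev: "\<forall>\<^sub>F t in at c. \<exists>r. r\<^sup>2 = t - c \<and> (\<forall>s\<in>{0..1}. \<delta> t s = \<phi> (circle_pair r s))"
    using assms(3) unfolding vanishing_cycles_def Fp circle_pair_def by blast
  interpret morse_chart f x0 V W \<psi> \<phi>
    using coords by unfold_locales (simp add: assms(1) p)
  have good: "\<forall>\<^sub>F t in at c. \<exists>r. r \<noteq> 0 \<and> norm r < \<rho> \<and> t = c + r\<^sup>2 \<and> (\<forall>s\<in>{0..1}. \<delta> t s = \<phi> (circle_pair r s))"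
    if \<rho>: "\<rho> > 0" for \<rho>
  proof -
    have "\<forall>\<^sub>F t in at c. t \<noteq> c \<and> dist t c < \<rho>\<^sup>2"
      unfolding eventually_at using \<rho> by (intro exI[of _ "\<rho>\<^sup>2"]) auto
    with ev show ?thesis
    proof eventually_elim
      case (elim t)
      then obtain r where r: "r\<^sup>2 = t - c" "\<forall>s\<in>{0..1}. \<delta> t s = \<phi> (circle_pair r s)" by blast
      have "(norm r)\<^sup>2 < \<rho>\<^sup>2" using elim(2) by (simp add: dist_norm r(1)[symmetric] norm_power)
      then have "norm r < \<rho>" using \<rho> by (intro power_less_imp_less_base[of "norm r" 2 \<rho>]) auto
      moreover have "r \<noteq> 0" using r(1) elim(2) by auto
      ultimately show ?case using r by (intro exI[of _ r]) auto
    qed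
  qed
  obtain \<rho>1 where \<rho>1: "\<rho>1 > 0" and diff: "\<And>r. norm r < \<rho>1 \<Longrightarrow> differentiable_path (\<lambda>s. \<phi> (circle_pair r s))"
    and lev: "\<And>r. norm r < \<rho>1 \<Longrightarrow> (\<lambda>s. \<phi> (circle_pair r s)) ` {0..1} \<subseteq> level f (c + r\<^sup>2)"
    and closed: "\<And>r. \<phi> (circle_pair r 0) = \<phi> (circle_pair r 1)"
    using loop_properties unfolding c_def by metis
  have df: "degree f > 0" using f2 by (metis pderiv_0 poly_0 pderiv_eq_0_iff gr0I)
  have smf: "\<forall>\<^sub>F t in at c. smooth_curve (level f t)" by (rule eventually_smooth_level[OF df])
  have exact0: "has_form_integral \<omega>' (\<lambda>s. \<phi> (circle_pair r s)) 0"
    if "relatively_exact F \<omega>'" "norm r < \<rho>1" for \<omega>' r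
    using relatively_exact_integral[OF that(1)[unfolded assms(1)] diff[OF that(2)] lev[OF that(2)] closed] .
  show ?thesis
  proof
    assume center: "tangential_center F (P, Q) p \<delta>"
    obtain a where a: "relatively_exact F ((P, Q) - ([:0, a:], 0))"
      using normal_form[OF assms(1)] by blast
    define R where "R = antideriv a"
    have aR: "a = pderiv R" by (simp add: R_def)
    have PQ: "(P, Q) = ((P, Q) - ([:0, a:], 0)) + ([:0, a:], 0)" by simp
    have "\<forall>\<^sub>F t in at c. \<exists>r'. r'\<^sup>2 = t - c \<and> smooth_curve (level f t) \<and>
        has_form_integral ([:0, a:], 0) (\<lambda>s. \<phi> (circle_pair r' s)) 0"
      using good[OF \<rho>1] smf center[unfolded tangential_center_def Fp]
    proof eventually_elim
      case (elim t)
      then obtain r where r: "norm r < \<rho>1" "t = c + r\<^sup>2" "\<forall>s\<in>{0..1}. \<delta> t s = \<phi> (circle_pair r s)" by blast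
      let ?\<gamma> = "\<lambda>s. \<phi> (circle_pair r s)"
      have "path ?\<gamma>"
        using diff[OF r(1)] unfolding differentiable_path_def path_def
        by (intro differentiable_imp_continuous_on) (simp add: differentiable_on_def)
      \<comment> \<open>The constant homotopy serves to obtain the existence of the integral, which
        \<open>form_integral\<close> alone would not give.\<close>
      then have "homotopic_loops (level f t) ?\<gamma> ?\<gamma>"
        using lev[OF r(1)] closed[of r] r(2) by (simp add: homotopic_loops_refl path_image_def pathstart_def pathfinish_def)
      then obtain I where I: "has_form_integral ([:0, a:], 0) ?\<gamma> I"
        using homotopic_loops_form_integral[OF elim(2) _ diff[OF r(1)] diff[OF r(1)]] by blast
      have "has_form_integral (P, Q) ?\<gamma> (0 + I)"
        by (subst PQ) (rule has_form_integral_add[OF exact0[OF a r(1)] I])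
      then have "form_integral (P, Q) ?\<gamma> = I" using form_integral_eqI by force
      moreover have "form_integral (P, Q) ?\<gamma> = form_integral (P, Q) (\<delta> t)"
        by (rule form_integral_cong) (use r(3) in simp)
      ultimately have "I = 0" using elim(3) by simp
      with I elim(2) r(2) show ?case by (intro exI[of _ r]) auto
    qed
    then obtain d where d: "d > 0" "\<And>t. t \<noteq> c \<Longrightarrow> dist t c < d \<Longrightarrow> \<exists>r'. r'\<^sup>2 = t - c \<and> smooth_curve (level f t) \<and>
        has_form_integral ([:0, a:], 0) (\<lambda>s. \<phi> (circle_pair r' s)) 0"
      unfolding eventually_at by blast
    have "\<exists>g h S. f = g \<circ>\<^sub>p h \<and> R = S \<circ>\<^sub>p h \<and> degree h > 0 \<and> poly (pderiv h) x0 = 0"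
    proof (rule common_right_factor[OF f1 f2])
      show "sqrt d > 0" using d(1) by simp
      fix r :: complex assume r: "r \<noteq> 0" "norm r < sqrt d"
      have "(norm r)\<^sup>2 < (sqrt d)\<^sup>2" using r(2) by (intro power_strict_mono) auto
      then have "dist (c + r\<^sup>2) c < d" using d(1) by (simp add: dist_norm norm_power)
      from d(2)[OF _ this] r(1)
      show "\<exists>r'. r'\<^sup>2 = r\<^sup>2 \<and> smooth_curve (level f (poly f x0 + r\<^sup>2)) \<and>
          has_form_integral ([:0, pderiv R:], 0) (\<lambda>s. \<phi> (circle_pair r' s)) 0"
        by (simp add: aR[symmetric] c_def[symmetric])
    qed
    then obtain g h S where gh: "f = g \<circ>\<^sub>p h" and RS: "R = S \<circ>\<^sub>p h" and h0: "degree h > 0" and h1: "poly (pderiv h) x0 = 0"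
      by blast
    have "degree h \<noteq> 1"
    proof
      assume "degree h = 1"
      then have "degree (pderiv h) = 0" by (simp add: degree_pderiv)
      then obtain k where k: "pderiv h = [:k:]" by (metis degree_eq_zeroE)
      with h1 have "pderiv h = 0" by simp
      then show False using h0 by (simp add: pderiv_eq_0_iff)
    qed
    then have h2: "degree h > 1" using h0 by simp
    have g0: "degree g > 0" using df by (simp add: gh degree_pcompose)
    show "relatively_exact F (P, Q) \<or> (\<exists>g h \<omega>' \<eta>. degree g > 1 \<and> degree h > 1 \<and> f = g \<circ>\<^sub>p h \<and>
       relatively_exact F \<omega>' \<and> (P, Q) = \<omega>' + pullback_form h \<eta> \<and>
       (\<forall>\<^sub>F t in at (eval2 F p). null_homotopic_in {(z, y). y\<^sup>2 + poly g z = t} (proj_map h \<circ> \<delta> t)))"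
    proof (cases "degree g = 1")
      case True
      obtain u g' where g': "g = pCons u g'" by (cases g)
      with True have "degree g' = 0" "g' \<noteq> 0" by (auto split: if_splits)
      then obtain v where g: "g = [:u, v:]" "v \<noteq> 0" unfolding g' by (metis degree_eq_zeroE pCons_0_0)
      \<comment> \<open>A linear \<open>g\<close> is invertible, so \<open>h\<close>, and with it
        \<open>R\<close>, is a polynomial in \<open>f\<close>.\<close>
      have "h = [:- u / v, 1 / v:] \<circ>\<^sub>p f"
        using g(2) by (simp add: gh g(1) pcompose_pCons smult_add_right)
      then have "R = (S \<circ>\<^sub>p [:- u / v, 1 / v:]) \<circ>\<^sub>p f" by (metis RS pcompose_assoc)
      from relatively_exact_compose[OF assms(1) this] have "relatively_exact F ([:0, a:], 0)" by (simp add: aR)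
      from relatively_exact_add[OF a this] show ?thesis by simp
    next
      case False
      define \<eta> where "\<eta> = ([:0, pderiv S:], 0 :: complex poly poly)"
      have "pullback_form h \<eta> = ([:0, a:], 0)"
        by (simp add: \<eta>_def pullback_form_def subst_x_pCons aR RS pderiv_pcompose) (simp add: subst_x_def mult.commute)
      then have "(P, Q) = ((P, Q) - ([:0, a:], 0)) + pullback_form h \<eta>" by simp
      moreover have "\<forall>\<^sub>F t in at (eval2 F p). null_homotopic_in {(z, y). y\<^sup>2 + poly g z = t} (proj_map h \<circ> \<delta> t)"
      proof -
        obtain \<rho>2 where \<rho>2: "\<rho>2 > 0" "\<And>r. norm r < \<rho>2 \<Longrightarrow>
            null_homotopic_in (level g (c + r\<^sup>2)) (proj_map h \<circ> (\<lambda>s. \<phi> (circle_pair r s)))"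
          unfolding c_def using projected_loop_null_homotopic[OF gh f2 h1] by metis
        show ?thesis unfolding Fp using good[OF \<rho>2(1)]
        proof eventually_elim
          case (elim t)
          then obtain r where r: "norm r < \<rho>2" "t = c + r\<^sup>2" "\<forall>s\<in>{0..1}. \<delta> t s = \<phi> (circle_pair r s)" by blast
          show ?case
            using null_homotopic_in_cong[OF \<rho>2(2)[OF r(1)], of "proj_map h \<circ> \<delta> t"] r(2,3)
            by (simp add: level_def)
        qed
      qed
      ultimately have "degree g > 1 \<and> degree h > 1 \<and> f = g \<circ>\<^sub>p h \<and> relatively_exact F ((P, Q) - ([:0, a:], 0)) \<and>
         (P, Q) = ((P, Q) - ([:0, a:], 0)) + pullback_form h \<eta> \<and>
         (\<forall>\<^sub>F t in at (eval2 F p). null_homotopic_in {(z, y). y\<^sup>2 + poly g z = t} (proj_map h \<circ> \<delta> t))"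
        using False g0 h2 gh a by linarith
      then show ?thesis by blast
    qed
  next
    assume "relatively_exact F (P, Q) \<or> (\<exists>g h \<omega>' \<eta>. degree g > 1 \<and> degree h > 1 \<and> f = g \<circ>\<^sub>p h \<and>
       relatively_exact F \<omega>' \<and> (P, Q) = \<omega>' + pullback_form h \<eta> \<and>
       (\<forall>\<^sub>F t in at (eval2 F p). null_homotopic_in {(z, y). y\<^sup>2 + poly g z = t} (proj_map h \<circ> \<delta> t)))"
    then show "tangential_center F (P, Q) p \<delta>"
    proof (elim disjE exE conjE)
      assume ex: "relatively_exact F (P, Q)"
      show ?thesis unfolding tangential_center_def Fp using good[OF \<rho>1]
      proof eventually_elim
        case (elim t)
        then obtain r where r: "norm r < \<rho>1" "\<forall>s\<in>{0..1}. \<delta> t s = \<phi> (circle_pair r s)" by blast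
        have "form_integral (P, Q) (\<delta> t) = form_integral (P, Q) (\<lambda>s. \<phi> (circle_pair r s))"
          by (rule form_integral_cong) (use r(2) in simp)
        then show ?case using form_integral_eqI[OF exact0[OF ex r(1)]] by simp
      qed
    next
      fix g h \<omega>' \<eta>
      assume g: "degree g > 1" and ex: "relatively_exact F \<omega>'" and PQ: "(P, Q) = \<omega>' + pullback_form h \<eta>"
        and null: "\<forall>\<^sub>F t in at (eval2 F p). null_homotopic_in {(z, y). y\<^sup>2 + poly g z = t} (proj_map h \<circ> \<delta> t)"
      \<comment> \<open>The pulled-back part is integrated on the curve of \<open>g\<close>, so the
        critical values of \<open>g\<close> have to be avoided here.\<close>
      have smg: "\<forall>\<^sub>F t in at c. smooth_curve (level g t)" by (rule eventually_smooth_level) (use g in simp)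
      show ?thesis unfolding tangential_center_def Fp using good[OF \<rho>1] smg null[unfolded Fp]
      proof eventually_elim
        case (elim t)
        then obtain r where r: "norm r < \<rho>1" "\<forall>s\<in>{0..1}. \<delta> t s = \<phi> (circle_pair r s)" by blast
        let ?\<gamma> = "\<lambda>s. \<phi> (circle_pair r s)"
        have "null_homotopic_in (level g t) (proj_map h \<circ> ?\<gamma>)"
          using null_homotopic_in_cong[OF elim(3), of "proj_map h \<circ> ?\<gamma>"] r(2) by (simp add: level_def)
        then have "has_form_integral (pullback_form h \<eta>) ?\<gamma> 0"
          unfolding has_form_integral_pullback[OF diff[OF r(1)]]
          using null_homotopic_integral[OF elim(2) _ differentiable_path_proj[OF diff[OF r(1)]]] by blast
        from has_form_integral_add[OF exact0[OF ex r(1)] this]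
        have "form_integral (P, Q) ?\<gamma> = 0" unfolding PQ by (intro form_integral_eqI) simp
        moreover have "form_integral (P, Q) (\<delta> t) = form_integral (P, Q) ?\<gamma>"
          by (rule form_integral_cong) (use r(2) in simp)
        ultimately show ?case by simp
      qed
    qed
  qed
qed

end
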